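(* Let $(X_n)_{n\ge1}$ be a Pólya process which is large and principally nonsemisimple. Fix a Jordan basis of linear forms $(u_k)_{1\le k\le s}$ (with dual basis $(v_k)$ and reduced polynomials $(Q_\alpha)$); let $J_2,\dots,J_r$ be all the principal blocks of indices and let $\nu+1$ be their common size ($\nu\ge1$). Then there exist unique complex-valued random variables $W_2,\dots,W_r$ such that $$X_n=nv_1+\frac1{\nu!}\log^\nu n\sum_{2\le k\le r}n^{\lambda(J_k)}W_kv_{\max J_k}+o\big(n^{\sigma_2}\log^\nu n\big),$$ the $o$ holding almost surely and in $\mathrm L^p$ for every $p\ge1$. Moreover all joint moments of $W_2,\dots,W_r$ exist and for all $\alpha_2,\dots,\alpha_r\in\mathbb Z_{\ge0}$, $$E\Big(\prod_{2\le k\le r}W_k^{\alpha_k}\Big)=\frac{\Gamma(\tau_1)}{\Gamma(\tau_1+\langle\alpha,\lambda\rangle)}Q_\alpha(X_1),\qquad\alpha=\sum_{2\le k\le r}\alpha_k\delta_{\min J_k},$$ where $(\delta_k)$ is the canonical basis of $\mathbb Z^s$.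
   Context: Let $V$ be a real vector space of finite dimension $s\ge1$ and $V_{\mathbb C}=V\otimes_{\mathbb R}\mathbb C$. A Pólya process is given by vectors $X_1,w_1,\dots,w_s\in V$ and a basis $(l_k)_{1\le k\le s}$ of $V^*$ such that: (i) $X_1\ne0$ and $l_k(X_1)\ge0$ for all $k$; (ii) $\sum_{j=1}^s l_j(w_k)=1$ for all $k$; (iii) $l_k(w_{k'})\ge0$ whenever $k\ne k'$, and for each $k$ either $l_k(w_k)\ge0$ or $l_k(X_1)\mathbb Z+\sum_{j=1}^s l_k(w_j)\mathbb Z=l_k(w_k)\mathbb Z$. Put $\tau_1=\sum_{k} l_k(X_1)>0$. The process is the Markov chain $(X_n)_{n\ge1}$ started at $X_1$ with $\mathrm{Prob}(X_{n+1}=X_n+w_k\mid X_n)=l_k(X_n)/(n+\tau_1-1)$. Its replacement endomorphism is $A(v)=\sum_k l_k(v)w_k$; its transition operator is $\Phi(f)(v)=\sum_{k} l_k(v)[f(v+w_k)-f(v)]$. $\sigma_2$ is defined as $1$ if $1$ is a multiple eigenvalue of $A$, and otherwise as $\max\{\Re\mu:\mu$ eigenvalue of $A$, $\mu\ne1\}$. The process is small if $\sigma_2\le1/2$ and large otherwise. A Jordan basis of linear forms is a basis $(u_k)_{1\le k\le s}$ of complex linear forms on $V_{\mathbb C}$ with $u_1=\sum_k l_k$ (so $u_1\circ A=u_1$; set $\lambda_1=1,\varepsilon_1=0$) and for $k\ge2$, $u_k\circ A=\lambda_ku_k+\varepsilon_ku_{k-1}$, $\lambda_k\in\mathbb C$,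 $\varepsilon_k\in\{0,1\}$, $\varepsilon_k=0$ whenever $\lambda_k\ne\lambda_{k-1}$. $\lambda=(\lambda_1,\dots,\lambda_s)$; $(v_k)$ is the dual basis of $V_{\mathbb C}$. A monogenic block of indices is a maximal set $J=\{m,\dots,m+r'\}$ with $\varepsilon_m=0$ and $\varepsilon_k=1$ for $m<k\le m+r'$; its root $\lambda(J)$ is the common value of $\lambda_k$, $k\in J$. A principal block is a monogenic block $J$ with $\Re\lambda(J)=\sigma_2$ and of maximal size among monogenic blocks with root of real part $\sigma_2$. The process is principally semisimple if all principal blocks have size one, and principally nonsemisimple otherwise (this does not depend on the Jordan basis). For $\alpha\in(\mathbb Z_{\ge0})^s$: $\langle\alpha,\lambda\rangle=\sum_k\alpha_k\lambda_k$, $\mathbf u^\alpha=\prod_k u_k^{\alpha_k}$. $\Phi$ preserves polynomial functions of degree $\le d$ on $V_{\mathbb C}$, so polynomial functions decompose as the direct sum of characteristic subspaces $\ker(\Phi-z)^\infty=\bigcup_p\ker(\Phi-z)^p$, $z\in\mathbb C$; the reduced polynomial $Q_\alpha$ is the component of $\mathbf u^\alpha$ in $\ker(\Phi-\langle\alpha,\lambda\rangle)^\infty$. Convention: $1/\Gamma(w)=0$ for $w\in\mathbb Z_{\le0}$. *)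

theory Defs
  imports "HOL-Probability.Probability"
begin

(* V is a type 'a of class euclidean_space, of dimension s = DIM('a) >= 1; the inner product
   plays no role except to supply the topology and a norm.  Families indexed by 1..s are
   functions on nat whose values outside {1..s} are irrelevant. *)

text \<open>The complexification of V is the real vector space V x V, the pair (x, y) standing
  for x + i y, with the following multiplication by complex scalars.\<close>

definition cscale :: "complex \<Rightarrow> 'a::real_vector \<times> 'a \<Rightarrow> 'a \<times> 'a" where
  "cscale c z = (Re c *\<^sub>R fst z - Im c *\<^sub>R snd z, Re c *\<^sub>R snd z + Im c *\<^sub>R fst z)"

interpretation cplx: vector_space cscale
  by unfold_locales
    (auto simp: cscale_def algebra_simps scaleR_add_left scaleR_add_right
       scaleR_diff_left scaleR_diff_right)

definition cembed :: "'a::real_vector \<Rightarrow> 'a \<times> 'a" where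
  "cembed x = (x, 0)"

definition cext_form :: "('a \<Rightarrow> real) \<Rightarrow> 'a \<times> 'a \<Rightarrow> complex" where
  "cext_form f z = Complex (f (fst z)) (f (snd z))"

definition cext_endo :: "('a \<Rightarrow> 'a) \<Rightarrow> 'a \<times> 'a \<Rightarrow> 'a \<times> 'a" where
  "cext_endo f z = (f (fst z), f (snd z))"

definition complex_linear_form :: "('a::real_vector \<times> 'a \<Rightarrow> complex) \<Rightarrow> bool" where
  "complex_linear_form f \<longleftrightarrow> Vector_Spaces.linear cscale (*) f"

definition basis_of_forms :: "('v \<Rightarrow> 'k::field) set \<Rightarrow> nat \<Rightarrow> (nat \<Rightarrow> 'v \<Rightarrow> 'k) \<Rightarrow> bool" where
  "basis_of_forms L s f \<longleftrightarrow>
     (\<forall>k\<in>{1..s}. f k \<in> L) \<and>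
     (\<forall>g\<in>L. \<exists>c. \<forall>v. g v = (\<Sum>k=1..s. c k * f k v)) \<and>
     (\<forall>c. (\<forall>v. (\<Sum>k=1..s. c k * f k v) = 0) \<longrightarrow> (\<forall>k\<in>{1..s}. c k = 0))"

definition polya_data ::
    "'a::euclidean_space \<Rightarrow> (nat \<Rightarrow> 'a) \<Rightarrow> (nat \<Rightarrow> 'a \<Rightarrow> real) \<Rightarrow> bool" where
  "polya_data x1 w l \<longleftrightarrow>
     (let s = DIM('a) in
      basis_of_forms {f. linear f} s l \<and>
      x1 \<noteq> 0 \<and> (\<forall>k\<in>{1..s}. l k x1 \<ge> 0) \<and>
      (\<forall>k\<in>{1..s}. (\<Sum>j=1..s. l j (w k)) = 1) \<and>
      (\<forall>k\<in>{1..s}. \<forall>k'\<in>{1..s}. k \<noteq> k' \<longrightarrow> l k (w k') \<ge> 0) \<and>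
      (\<forall>k\<in>{1..s}. l k (w k) \<ge> 0 \<or>
         {of_int a * l k x1 + (\<Sum>j=1..s. of_int (b j) * l k (w j)) | (a::int) (b::nat \<Rightarrow> int). True}
           = {of_int a * l k (w k) | a::int. True}))"

definition tau1 :: "'a::euclidean_space \<Rightarrow> (nat \<Rightarrow> 'a \<Rightarrow> real) \<Rightarrow> real" where
  "tau1 x1 l = (\<Sum>k=1..DIM('a). l k x1)"

text \<open>The Markov property is stated on finite trajectories, which is enough since the chain
  almost surely visits only countably many states.  The vectors w k need not be distinct, so
  the probability of jumping from x to y collects all k with y = x + w k.\<close>

definition polya_process ::
    "'b measure \<Rightarrow> (nat \<Rightarrow> 'b \<Rightarrow> 'a::euclidean_space) \<Rightarrow> 'a \<Rightarrow> (nat \<Rightarrow> 'a)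
       \<Rightarrow> (nat \<Rightarrow> 'a \<Rightarrow> real) \<Rightarrow> bool" where
  "polya_process M X x1 w l \<longleftrightarrow>
     polya_data x1 w l \<and> prob_space M \<and>
     (\<forall>n\<ge>1. X n \<in> borel_measurable M) \<and>
     (AE \<omega> in M. X 1 \<omega> = x1) \<and>
     (\<forall>n\<ge>1. \<forall>x y.
        measure M {\<omega> \<in> space M. (\<forall>i\<in>{1..n}. X i \<omega> = x i) \<and> X (n + 1) \<omega> = y}
        = measure M {\<omega> \<in> space M. \<forall>i\<in>{1..n}. X i \<omega> = x i}
          * (\<Sum>k | k \<in> {1..DIM('a)} \<and> y = x n + w k. l k (x n) / (real n + tau1 x1 l - 1)))"

definition replacement :: "(nat \<Rightarrow> 'a::euclidean_space) \<Rightarrow> (nat \<Rightarrow> 'a \<Rightarrow> real) \<Rightarrow> 'a \<Rightarrow> 'a" where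
  "replacement w l v = (\<Sum>k=1..DIM('a). l k v *\<^sub>R w k)"

definition eigenvalue :: "('a::euclidean_space \<Rightarrow> 'a) \<Rightarrow> complex \<Rightarrow> bool" where
  "eigenvalue A \<mu> \<longleftrightarrow> (\<exists>z. z \<noteq> 0 \<and> cext_endo A z = cscale \<mu> z)"

definition alg_multiplicity :: "('a::euclidean_space \<Rightarrow> 'a) \<Rightarrow> complex \<Rightarrow> nat" where
  "alg_multiplicity A \<mu> =
     cplx.dim {z. \<exists>p. ((\<lambda>x. cext_endo A x - cscale \<mu> x) ^^ p) z = 0}"

text \<open>For DIM('a) = 1 the maximum below is over the empty set and hence unspecified.\<close>

definition sigma2 :: "(nat \<Rightarrow> 'a::euclidean_space) \<Rightarrow> (nat \<Rightarrow> 'a \<Rightarrow> real) \<Rightarrow> real" where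
  "sigma2 w l =
     (let A = replacement w l in
      if alg_multiplicity A 1 \<ge> 2 then 1
      else Max {Re \<mu> | \<mu>. eigenvalue A \<mu> \<and> \<mu> \<noteq> 1})"

definition small_process :: "(nat \<Rightarrow> 'a::euclidean_space) \<Rightarrow> (nat \<Rightarrow> 'a \<Rightarrow> real) \<Rightarrow> bool" where
  "small_process w l \<longleftrightarrow> sigma2 w l \<le> 1 / 2"

abbreviation large_process :: "(nat \<Rightarrow> 'a::euclidean_space) \<Rightarrow> (nat \<Rightarrow> 'a \<Rightarrow> real) \<Rightarrow> bool" where
  "large_process w l \<equiv> \<not> small_process w l"

definition jordan_basis ::
    "(nat \<Rightarrow> 'a::euclidean_space) \<Rightarrow> (nat \<Rightarrow> 'a \<Rightarrow> real) \<Rightarrow> (nat \<Rightarrow> 'a \<times> 'a \<Rightarrow> complex)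
       \<Rightarrow> (nat \<Rightarrow> complex) \<Rightarrow> (nat \<Rightarrow> nat) \<Rightarrow> bool" where
  "jordan_basis w l u \<Lambda> \<epsilon> \<longleftrightarrow>
     (let s = DIM('a); A = cext_endo (replacement w l) in
      basis_of_forms {f. complex_linear_form f} s u \<and>
      u 1 = (\<lambda>z. \<Sum>k=1..s. cext_form (l k) z) \<and> \<Lambda> 1 = 1 \<and> \<epsilon> 1 = 0 \<and>
      (\<forall>k\<in>{2..s}.
         (\<forall>z. u k (A z) = \<Lambda> k * u k z + of_nat (\<epsilon> k) * u (k - 1) z) \<and>
         \<epsilon> k \<in> {0, 1} \<and> (\<Lambda> k \<noteq> \<Lambda> (k - 1) \<longrightarrow> \<epsilon> k = 0)))"

definition dual_basis ::
    "(nat \<Rightarrow> 'a::euclidean_space \<times> 'a \<Rightarrow> complex) \<Rightarrow> (nat \<Rightarrow> 'a \<times> 'a) \<Rightarrow> bool" where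
  "dual_basis u v \<longleftrightarrow>
     (\<forall>i\<in>{1..DIM('a)}. \<forall>j\<in>{1..DIM('a)}. u i (v j) = (if i = j then 1 else 0))"

definition monogenic_indices :: "nat \<Rightarrow> (nat \<Rightarrow> nat) \<Rightarrow> nat set \<Rightarrow> bool" where
  "monogenic_indices s \<epsilon> J \<longleftrightarrow>
     (\<exists>m r'. 1 \<le> m \<and> m + r' \<le> s \<and> J = {m..m + r'} \<and> \<epsilon> m = 0 \<and>
        (\<forall>k. m < k \<and> k \<le> m + r' \<longrightarrow> \<epsilon> k = 1))"

definition monogenic_block :: "nat \<Rightarrow> (nat \<Rightarrow> nat) \<Rightarrow> nat set \<Rightarrow> bool" where
  "monogenic_block s \<epsilon> J \<longleftrightarrow>
     monogenic_indices s \<epsilon> J \<and> (\<forall>J'. monogenic_indices s \<epsilon> J' \<and> J \<subseteq> J' \<longrightarrow> J' = J)"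

text \<open>In a Jordan basis the eigenvalue is constant on a monogenic block.\<close>

definition block_root :: "(nat \<Rightarrow> complex) \<Rightarrow> nat set \<Rightarrow> complex" where
  "block_root \<Lambda> J = \<Lambda> (Min J)"

definition principal_block ::
    "nat \<Rightarrow> (nat \<Rightarrow> complex) \<Rightarrow> (nat \<Rightarrow> nat) \<Rightarrow> real \<Rightarrow> nat set \<Rightarrow> bool" where
  "principal_block s \<Lambda> \<epsilon> \<sigma> J \<longleftrightarrow>
     monogenic_block s \<epsilon> J \<and> Re (block_root \<Lambda> J) = \<sigma> \<and>
     (\<forall>J'. monogenic_block s \<epsilon> J' \<and> Re (block_root \<Lambda> J') = \<sigma> \<longrightarrow> card J' \<le> card J)"

definition principally_semisimple ::
    "nat \<Rightarrow> (nat \<Rightarrow> complex) \<Rightarrow> (nat \<Rightarrow> nat) \<Rightarrow> real \<Rightarrow> bool" where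
  "principally_semisimple s \<Lambda> \<epsilon> \<sigma> \<longleftrightarrow>
     (\<forall>J. principal_block s \<Lambda> \<epsilon> \<sigma> J \<longrightarrow> card J = 1)"

inductive_set polynomial_functions :: "('a::real_vector \<times> 'a \<Rightarrow> complex) set" where
  const: "(\<lambda>_. c) \<in> polynomial_functions"
| form: "complex_linear_form f \<Longrightarrow> f \<in> polynomial_functions"
| add: "f \<in> polynomial_functions \<Longrightarrow> g \<in> polynomial_functions
    \<Longrightarrow> (\<lambda>z. f z + g z) \<in> polynomial_functions"
| mult: "f \<in> polynomial_functions \<Longrightarrow> g \<in> polynomial_functions
    \<Longrightarrow> (\<lambda>z. f z * g z) \<in> polynomial_functions"

definition transition_op ::
    "(nat \<Rightarrow> 'a::euclidean_space) \<Rightarrow> (nat \<Rightarrow> 'a \<Rightarrow> real)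
       \<Rightarrow> ('a \<times> 'a \<Rightarrow> complex) \<Rightarrow> 'a \<times> 'a \<Rightarrow> complex" where
  "transition_op w l f z =
     (\<Sum>k=1..DIM('a). cext_form (l k) z * (f (z + cembed (w k)) - f z))"

definition char_subspace ::
    "(nat \<Rightarrow> 'a::euclidean_space) \<Rightarrow> (nat \<Rightarrow> 'a \<Rightarrow> real) \<Rightarrow> complex
       \<Rightarrow> ('a \<times> 'a \<Rightarrow> complex) set" where
  "char_subspace w l c =
     {f \<in> polynomial_functions.
        \<exists>p. ((\<lambda>g z. transition_op w l g z - c * g z) ^^ p) f = (\<lambda>_. 0)}"

text \<open>The decomposition of f is unique because characteristic subspaces are in direct sum, whence
  THE; C may contain values d for which the component vanishes.\<close>

definition char_component ::
    "(nat \<Rightarrow> 'a::euclidean_space) \<Rightarrow> (nat \<Rightarrow> 'a \<Rightarrow> real) \<Rightarrow> complex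
       \<Rightarrow> ('a \<times> 'a \<Rightarrow> complex) \<Rightarrow> 'a \<times> 'a \<Rightarrow> complex" where
  "char_component w l c f =
     (THE q. \<exists>C g. finite C \<and> c \<in> C \<and> (\<forall>d\<in>C. g d \<in> char_subspace w l d) \<and>
        f = (\<lambda>z. \<Sum>d\<in>C. g d z) \<and> q = g c)"

definition pairing :: "nat \<Rightarrow> (nat \<Rightarrow> nat) \<Rightarrow> (nat \<Rightarrow> complex) \<Rightarrow> complex" where
  "pairing s \<alpha> \<Lambda> = (\<Sum>k=1..s. of_nat (\<alpha> k) * \<Lambda> k)"

definition reduced_polynomial ::
    "(nat \<Rightarrow> 'a::euclidean_space) \<Rightarrow> (nat \<Rightarrow> 'a \<Rightarrow> real) \<Rightarrow> (nat \<Rightarrow> 'a \<times> 'a \<Rightarrow> complex)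
       \<Rightarrow> (nat \<Rightarrow> complex) \<Rightarrow> (nat \<Rightarrow> nat) \<Rightarrow> 'a \<times> 'a \<Rightarrow> complex" where
  "reduced_polynomial w l u \<Lambda> \<alpha> =
     char_component w l (pairing DIM('a) \<alpha> \<Lambda>) (\<lambda>z. \<Prod>k=1..DIM('a). u k z ^ \<alpha> k)"

text \<open>Small-o for a sequence (n = 1, 2, ...) of random vectors with respect to a deterministic
  scale, simultaneously almost surely and in every Lp with p >= 1.\<close>

definition smallo_as_Lp ::
    "'b measure \<Rightarrow> (nat \<Rightarrow> 'b \<Rightarrow> 'c::real_normed_vector) \<Rightarrow> (nat \<Rightarrow> real) \<Rightarrow> bool" where
  "smallo_as_Lp M R g \<longleftrightarrow>
     (AE \<omega> in M. (\<lambda>n. norm (R n \<omega>)) \<in> o(g)) \<and>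
     (\<forall>p::real. p \<ge> 1 \<longrightarrow>
        (\<forall>n\<ge>1. integrable M (\<lambda>\<omega>. norm (R n \<omega>) powr p)) \<and>
        (\<lambda>n. (\<integral>\<omega>. norm (R n \<omega>) powr p \<partial>M) powr (1 / p)) \<in> o(g))"

definition polya_expansion ::
    "'b measure \<Rightarrow> (nat \<Rightarrow> 'b \<Rightarrow> 'a::euclidean_space) \<Rightarrow> (nat \<Rightarrow> 'a \<times> 'a)
       \<Rightarrow> (nat \<Rightarrow> complex) \<Rightarrow> real \<Rightarrow> nat \<Rightarrow> nat \<Rightarrow> (nat \<Rightarrow> nat set) \<Rightarrow> (nat \<Rightarrow> 'b \<Rightarrow> complex)
       \<Rightarrow> bool" where
  "polya_expansion M X v \<Lambda> \<sigma> \<nu> r J W \<longleftrightarrow>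
     smallo_as_Lp M
       (\<lambda>n \<omega>. cembed (X n \<omega>)
          - (real n *\<^sub>R v 1
             + (1 / fact \<nu> * ln (real n) ^ \<nu>) *\<^sub>R
               (\<Sum>k=2..r. cscale (of_nat n powr block_root \<Lambda> (J k) * W k \<omega>) (v (Max (J k))))))
       (\<lambda>n. real n powr \<sigma> * ln (real n) ^ \<nu>)"

end

theory Submission
  imports Defs "HOL-Real_Asymp.Real_Asymp"
begin

text \<open>Every step of the process is \<open>A X\<^sub>n / (n + \<tau> - 1)\<close> plus a bounded martingale difference. Applied to
  this decomposition, an eigenform \<open>u\<close> of eigenvalue \<open>\<lambda>\<close> with \<open>Re \<lambda> > 1/2\<close> becomes, after division by
  the product of the factors \<open>1 + \<lambda> / (i + \<tau> - 1)\<close>, \<open>1 \<le> i < n\<close>, which is equivalent to \<open>n\<^sup>\<lambda> \<Gamma>(\<tau>) / \<Gamma>(\<tau> + \<lambda>)\<close>, a martingale whose differences are bounded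
  by square-summable constants; exponential moments then give convergence almost surely and in every
  \<open>L\<^sup>p\<close>. Going up a Jordan chain, each form is obtained from its predecessor by a summation against
  \<open>1/j\<close>, which costs one factor \<open>log n\<close> (Stolz-Cesaro), whereas the forms with \<open>Re \<lambda> < \<sigma>\<^sub>2\<close> stay of order
  \<open>n\<^sup>\<rho>\<close> for some \<open>\<rho> < \<sigma>\<^sub>2\<close>. No Jordan block of size at least two sits at the eigenvalue 1, hence
  \<open>\<sigma>\<^sub>2 < 1\<close>. For the moments, give \<open>u\<^sub>1\<close> weight 1 and every other form weight \<open>\<sigma>\<^sub>2\<close>: because \<open>2 \<sigma>\<^sub>2 > 1\<close>, the
  transition operator acts on a monomial in root forms as the eigenvalue \<open>\<langle>\<alpha>,\<lambda>\<rangle>\<close> up to strictly smaller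
  weight. The reduced polynomial is therefore a genuine eigenvector, its expectation is explicit, and
  the difference with the monomial is asymptotically negligible.\<close>

subsection \<open>Asymptotics of scalar recursions\<close>

text \<open>Two choices shape the proof. A form with real part below \<sigma> cannot in general be
  normalised by its own eigenvalue: if that real part is at most 1/2, the square-summability that
  makes the normalised noise converge is lost. Such forms are normalised by a real exponent
  \<open>\<rho>\<close> with \<open>1/2 < \<rho> < \<sigma>\<close>, which exists because
  \<open>\<sigma> > 1/2\<close>; their recursion then becomes a contraction with a small
  perturbation. The second choice is that a single weight bounds both the real part of an eigenvalue
  and the growth exponent of a coordinate. The correction to a monomial in root forms is thereby
  controlled twice by one inequality: its spectrum stays away from the eigenvalue of the monomial,
  so that the equation defining it can be solved, and its expectation is of smaller order. The
  restriction to roots matters here: the nilpotent part of the endomorphism does not lower the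
  weight, but it does not act on a root form.\<close>

lemma stolz_cesaro:
  fixes a :: "nat \<Rightarrow> 'v::real_normed_vector" and b :: "nat \<Rightarrow> real"
  assumes incr: "eventually (\<lambda>n. b n < b (Suc n)) sequentially"
    and top: "filterlim b at_top sequentially"
    and lim: "(\<lambda>n. (a (Suc n) - a n) /\<^sub>R (b (Suc n) - b n)) \<longlonglongrightarrow> L"
  shows "(\<lambda>n. a n /\<^sub>R b n) \<longlonglongrightarrow> L"
proof (rule LIMSEQ_I)
  fix e :: real assume e: "e > 0"
  have "eventually (\<lambda>n. b n < b (Suc n) \<and>
          norm ((a (Suc n) - a n) /\<^sub>R (b (Suc n) - b n) - L) < e / 2) sequentially"
    using incr tendstoD[OF lim, of "e/2"] e by (auto simp: dist_norm eventually_conj)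
  then obtain N where N: "\<And>n. n \<ge> N \<Longrightarrow> b n < b (Suc n)"
      "\<And>n. n \<ge> N \<Longrightarrow> norm ((a (Suc n) - a n) /\<^sub>R (b (Suc n) - b n) - L) < e / 2"
    by (auto simp: eventually_sequentially)
  \<comment> \<open>\<open>c\<close> is \<open>a\<close> centred at the limit, so its increments are
    at most \<open>e / 2\<close> times those of \<open>b\<close>. The other half of \<open>e\<close>
    is spent on the initial terms, collected below in \<open>H\<close>.\<close>
  define c where "c n = a n - b n *\<^sub>R L" for n
  have step_bound: "norm (c (Suc n) - c n) \<le> e / 2 * (b (Suc n) - b n)" if "n \<ge> N" for n
  proof -
    define d where "d = b (Suc n) - b n"
    have d: "d > 0" using N(1)[OF that] by (simp add: d_def)
    have "c (Suc n) - c n = d *\<^sub>R ((a (Suc n) - a n) /\<^sub>R d - L)"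
    proof -
      have "b (Suc n) = b n + d" by (simp add: d_def)
      then show ?thesis using d by (simp add: c_def scaleR_diff_right scaleR_add_left)
    qed
    then have "norm (c (Suc n) - c n) = d * norm ((a (Suc n) - a n) /\<^sub>R d - L)"
      using d by simp
    also have "\<dots> \<le> d * (e / 2)"
      using N(2)[OF that] d unfolding d_def by (intro mult_left_mono) auto
    finally show ?thesis by (simp add: d_def mult.commute)
  qed
  have diff: "norm (c n - c N) \<le> e / 2 * (b n - b N)" if "n \<ge> N" for n
    using that
  proof (induction n rule: dec_induct)
    case (step n)
    have "norm (c (Suc n) - c N) \<le> norm (c (Suc n) - c n) + norm (c n - c N)"
      using norm_triangle_ineq[of "c (Suc n) - c n" "c n - c N"] by simp
    moreover have "norm (c (Suc n) - c n) \<le> e / 2 * (b (Suc n) - b n)"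
      using step_bound step.hyps by simp
    ultimately show ?case using step.IH by (simp add: algebra_simps)
  qed simp
  define H where "H = norm (c N) + e / 2 * \<bar>b N\<bar>"
  have "eventually (\<lambda>n. b n > 0 \<and> b n > 2 * H / e) sequentially"
    using top by (intro eventually_conj) (auto simp: filterlim_at_top_dense)
  then obtain N' where N': "\<And>n. n \<ge> N' \<Longrightarrow> b n > 0 \<and> b n > 2 * H / e"
    by (auto simp: eventually_sequentially)
  show "\<exists>no. \<forall>n\<ge>no. norm (a n /\<^sub>R b n - L) < e"
  proof (intro exI allI impI)
    fix n assume n: "n \<ge> max N N'"
    have bn: "b n > 0" "b n > 2 * H / e" using N' n by auto
    have "norm (c n) \<le> norm (c n - c N) + norm (c N)"
      using norm_triangle_ineq[of "c n - c N" "c N"] by simp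
    also have "\<dots> \<le> e / 2 * (b n - b N) + norm (c N)" using diff n by simp
    also have "\<dots> \<le> e / 2 * b n + H"
    proof -
      have "- (e * b N) \<le> e * \<bar>b N\<bar>" using mult_left_mono[of "- b N" "\<bar>b N\<bar>" e] e by simp
      then show ?thesis by (simp add: H_def algebra_simps)
    qed
    also have "\<dots> < e * b n" using bn e by (simp add: field_simps)
    finally have "norm (c n) < e * b n" .
    moreover have "a n /\<^sub>R b n - L = c n /\<^sub>R b n" using bn by (simp add: c_def algebra_simps)
    ultimately show "norm (a n /\<^sub>R b n - L) < e" using bn by (simp add: field_simps)
  qed
qed

section \<open>The normalising products and their power asymptotics\<close>

definition polya_factor :: "real \<Rightarrow> complex \<Rightarrow> nat \<Rightarrow> complex" where
  "polya_factor \<tau> c n = (\<Prod>i=1..<n. 1 + c / of_real (real i + \<tau> - 1))"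

lemma polya_factor_1 [simp]: "polya_factor \<tau> c (Suc 0) = 1"
  by (simp add: polya_factor_def)

lemma polya_factor_Suc:
  "n \<ge> 1 \<Longrightarrow> polya_factor \<tau> c (Suc n) = polya_factor \<tau> c n * (1 + c / of_real (real n + \<tau> - 1))"
  by (simp add: polya_factor_def)

lemma polya_factor_pochhammer:
  assumes "\<tau> > 0"
  shows "polya_factor \<tau> c (Suc n) = pochhammer (of_real \<tau> + c) n / pochhammer (of_real \<tau>) n"
proof (induction n)
  case (Suc n)
  have nz: "of_real \<tau> + of_nat n \<noteq> (0::complex)"
    using assms by (metis add_pos_nonneg of_nat_0_le_iff of_real_add of_real_eq_0_iff of_real_of_nat_eq less_irrefl)
  have "polya_factor \<tau> c (Suc (Suc n)) = polya_factor \<tau> c (Suc n) * (1 + c / (of_real \<tau> + of_nat n))"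
    by (subst polya_factor_Suc) (auto simp: algebra_simps)
  also have "1 + c / (of_real \<tau> + of_nat n) = (of_real \<tau> + c + of_nat n) / (of_real \<tau> + of_nat n)"
    using nz by (simp add: field_simps)
  finally show ?case by (simp add: Suc pochhammer_Suc)
qed simp

lemma polya_factor_nonzero:
  assumes "\<tau> > 0" "Re c \<ge> 0" "n \<ge> 1"
  shows "polya_factor \<tau> c n \<noteq> 0"
proof -
  have "1 + c / of_real (real i + \<tau> - 1) \<noteq> 0" if "i \<ge> 1" for i
  proof -
    have "Re (1 + c / of_real (real i + \<tau> - 1)) \<ge> 1"
      using assms that by (simp add: Re_divide_of_real)
    then show ?thesis by (metis zero_complex.sel(1) not_one_le_zero)
  qed
  then show ?thesis by (auto simp: polya_factor_def)
qed

lemma rGamma_real_nonzero: "Re z > 0 \<Longrightarrow> rGamma (z::complex) \<noteq> 0"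
  by (auto simp: rGamma_eq_zero_iff elim!: nonpos_Ints_cases)

text \<open>\<open>rGamma_series z m\<close> carries a Pochhammer symbol of length
  \<open>m + 1\<close>, which is the numerator or denominator of \<open>polya_factor\<close> at
  \<open>m + 2\<close>; the exponential in \<open>F\<close> replaces \<open>m\<close> by
  \<open>m + 2\<close> in the power. Writing the limit with the entire function
  \<open>rGamma\<close> covers the poles of \<open>Gamma\<close> as well.\<close>

lemma polya_factor_asymp:
  assumes \<tau>: "\<tau> > 0"
  shows "(\<lambda>n. polya_factor \<tau> c n / of_nat n powr c)
           \<longlonglongrightarrow> Gamma (of_real \<tau>) * rGamma (of_real \<tau> + c)"
proof -
  define F where "F m = rGamma_series (of_real \<tau> + c) m / rGamma_series (of_real \<tau>) m *
     exp (c * of_real (ln (real m) - ln (real (m + 2))))" for m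
  have "F \<longlonglongrightarrow> rGamma (of_real \<tau> + c) / rGamma (of_real \<tau>) * exp (c * of_real 0)"
    unfolding F_def using \<tau>
    by (intro tendsto_intros) (auto simp: rGamma_real_nonzero, real_asymp)
  moreover have "rGamma (of_real \<tau> + c) / rGamma (of_real \<tau>) * exp (c * of_real 0)
       = Gamma (of_real \<tau>) * rGamma (of_real \<tau> + c)"
    by (simp add: rGamma_inverse_Gamma divide_simps)
  ultimately have "F \<longlonglongrightarrow> Gamma (of_real \<tau>) * rGamma (of_real \<tau> + c)" by simp
  moreover have "eventually (\<lambda>m. F m = polya_factor \<tau> c (m + 2) / of_nat (m + 2) powr c) sequentially"
    using eventually_gt_at_top[of 0]
  proof eventually_elim
    case (elim m)
    have pw: "of_nat (m + 2) powr c = exp (c * of_real (ln (real (m + 2))))"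
    proof -
      have "of_nat (m + 2) \<noteq> (0::complex)" by (simp only: of_nat_eq_0_iff)
      moreover have "Ln (of_nat (m + 2)) = of_real (ln (real (m + 2)))" by (rule Ln_of_nat) simp
      ultimately show ?thesis by (simp only: powr_def if_False)
    qed
    have ex: "exp ((of_real \<tau> + c) * of_real (ln (real m)))
        = exp (of_real \<tau> * of_real (ln (real m))) * exp (c * complex_of_real (ln (real m)))"
      by (simp add: exp_add[symmetric] algebra_simps)
    have ex2: "exp (c * of_real (ln (real m) - ln (real (m + 2))))
       = exp (c * complex_of_real (ln (real m))) / exp (c * of_real (ln (real (m + 2))))"
      by (simp add: exp_diff[symmetric] algebra_simps)
    have nz: "2 + of_nat m \<noteq> (0::complex)"
    proof -
      have "2 + of_nat m = (of_nat (m + 2) :: complex)" by simp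
      then show ?thesis by (simp only: of_nat_eq_0_iff)
    qed
    show ?case
      unfolding F_def rGamma_series_def pw ex ex2
      using polya_factor_pochhammer[OF \<tau>, of c "m + 1"] elim
      using nz by simp
  qed
  ultimately have "(\<lambda>m. polya_factor \<tau> c (m + 2) / of_nat (m + 2) powr c)
      \<longlonglongrightarrow> Gamma (of_real \<tau>) * rGamma (of_real \<tau> + c)"
    by (rule Lim_transform_eventually)
  then show ?thesis by (rule LIMSEQ_offset)
qed

lemma norm_of_nat_powr: "n \<ge> 1 \<Longrightarrow> norm (of_nat n powr c :: complex) = real n powr Re c"
  using norm_powr_real_powr[of "real n" c] by simp

lemma positive_sequence_bounded_below:
  fixes f :: "nat \<Rightarrow> complex"
  assumes "f \<longlonglongrightarrow> L" "L \<noteq> 0" "\<And>n. n \<ge> 1 \<Longrightarrow> f n \<noteq> 0"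
  shows "\<exists>B>0. \<forall>n\<ge>1. norm (inverse (f n)) \<le> B"
proof -
  have "(\<lambda>n. inverse (f n)) \<longlonglongrightarrow> inverse L" using assms by (intro tendsto_inverse)
  then have "Bseq (\<lambda>n. inverse (f n))" by (intro convergent_imp_Bseq convergentI)
  then show ?thesis by (auto simp: Bseq_def)
qed

text \<open>\<open>Re c \<ge> 0\<close> keeps \<open>\<tau> + c\<close> away from the poles of
  \<open>Gamma\<close>, so the limit is nonzero and the estimate is two-sided. The bound on the
  inverse serves to estimate normalised noise, the other one to return to the coordinates.\<close>

lemma polya_factor_bounds:
  assumes \<tau>: "\<tau> > 0" and c: "Re c \<ge> 0"
  obtains B where "B > 0" "\<And>n. n \<ge> 1 \<Longrightarrow> norm (polya_factor \<tau> c n) \<le> B * real n powr Re c"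
    "\<And>n. n \<ge> 1 \<Longrightarrow> norm (inverse (polya_factor \<tau> c n)) \<le> B * real n powr (- Re c)"
proof -
  let ?f = "\<lambda>n. polya_factor \<tau> c n / of_nat n powr c"
  have L: "Gamma (of_real \<tau>) * rGamma (of_real \<tau> + c) \<noteq> 0"
    using \<tau> c rGamma_real_nonzero[of "of_real \<tau>"] rGamma_real_nonzero[of "of_real \<tau> + c"]
    by (auto simp: rGamma_inverse_Gamma)
  obtain B1 where B1: "B1 > 0" "\<And>n. norm (?f n) \<le> B1"
    using convergent_imp_Bseq[OF convergentI[OF polya_factor_asymp[OF \<tau>, of c]]] by (auto simp: Bseq_def)
  obtain B2 where B2: "B2 > 0" "\<And>n. n \<ge> 1 \<Longrightarrow> norm (inverse (?f n)) \<le> B2"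
    using positive_sequence_bounded_below[OF polya_factor_asymp[OF \<tau>, of c] L]
      polya_factor_nonzero[OF \<tau> c] by auto
  show ?thesis
  proof (rule that[of "max B1 B2"])
    fix n :: nat assume n: "n \<ge> 1"
    have p: "real n powr Re c > 0" using n by simp
    have "norm (polya_factor \<tau> c n) / real n powr Re c \<le> B1"
      using B1(2)[of n] n by (simp add: norm_divide norm_of_nat_powr)
    then have "norm (polya_factor \<tau> c n) \<le> B1 * real n powr Re c" using p by (simp add: field_simps)
    also have "\<dots> \<le> max B1 B2 * real n powr Re c" by (intro mult_right_mono) auto
    finally show "norm (polya_factor \<tau> c n) \<le> max B1 B2 * real n powr Re c" .
    have "norm (inverse (polya_factor \<tau> c n)) * real n powr Re c \<le> B2"
      using B2(2)[of n] n by (simp add: norm_divide norm_inverse norm_of_nat_powr field_simps)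
    also have "\<dots> \<le> max B1 B2" by simp
    finally show "norm (inverse (polya_factor \<tau> c n)) \<le> max B1 B2 * real n powr (- Re c)"
      using p by (simp add: powr_minus field_simps)
  qed (use B1 in auto)
qed

text \<open>With \<open>x = n + \<tau> - 1\<close> the quotient is
  \<open>(x + c) / (x + \<rho>)\<close>, of modulus \<open>1 - (\<rho> - Re c) / x\<close> up to
  terms of order \<open>1 / x^2\<close>. Half of the gap is given away in \<open>\<kappa>\<close> to
  absorb these terms and the imaginary part of \<open>c\<close>.\<close>

lemma norm_factor_quotient_bound:
  assumes "Re c < \<rho>" "\<tau> > 0"
  obtains \<kappa> where "\<kappa> > 0"
    "eventually (\<lambda>n. norm ((1 + c / of_real (real n + \<tau> - 1)) / (1 + of_real \<rho> / of_real (real n + \<tau> - 1)))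
        \<le> 1 - \<kappa> / (real n + \<tau> - 1)) sequentially"
proof -
  define \<kappa> where "\<kappa> = (\<rho> - Re c) / 2"
  have \<kappa>: "\<kappa> > 0" "Re c = \<rho> - 2 * \<kappa>" using assms by (auto simp: \<kappa>_def field_simps)
  have lim: "filterlim (\<lambda>n. real n + \<tau> - 1) at_top sequentially" by real_asymp
  have "eventually (\<lambda>x::real. norm ((1 + c / of_real x) / (1 + of_real \<rho> / of_real x)) \<le> 1 - \<kappa> / x) at_top"
  proof -
    have 1: "eventually (\<lambda>x::real. x > 0 \<and> x + \<rho> > 0 \<and> x > \<kappa>) at_top"
      using eventually_gt_at_top[of "max (max 0 (-\<rho>)) \<kappa>"] by (rule eventually_mono) auto
    \<comment> \<open>After squaring, the two sides agree to order \<open>x^2\<close> and differ by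
      \<open>2 * \<kappa> * x\<close> at the next order.\<close>
    have 2: "eventually (\<lambda>x::real. (x + (\<rho> - 2 * \<kappa>))\<^sup>2 + (Im c)\<^sup>2 \<le> (1 - \<kappa> / x)\<^sup>2 * (x + \<rho>)\<^sup>2) at_top"
      using \<kappa>(1) by real_asymp
    show ?thesis using 1 2
    proof eventually_elim
      case (elim x)
      have e: "(1 + c / of_real x) / (1 + of_real \<rho> / of_real x) = (of_real x + c) / of_real (x + \<rho>)"
        using elim by (simp add: field_simps flip: of_real_add)
      have "norm (of_real x + c) = sqrt ((x + Re c)\<^sup>2 + (Im c)\<^sup>2)" by (simp add: cmod_def)
      also have "\<dots> \<le> sqrt (((1 - \<kappa> / x) * (x + \<rho>))\<^sup>2)"
        using elim \<kappa> by (simp add: power_mult_distrib)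
      also have "\<dots> = (1 - \<kappa> / x) * (x + \<rho>)"
        unfolding real_sqrt_abs using elim by (intro abs_of_nonneg mult_nonneg_nonneg) auto
      finally show ?case using elim unfolding e by (simp add: norm_divide pos_divide_le_eq del: of_real_add)
    qed
  qed
  with \<kappa>(1) lim show ?thesis
    by (intro that[of \<kappa>]) (auto simp: filterlim_iff)
qed

text \<open>The constant is chosen before \<open>r\<close> and \<open>H\<close>, because both depend
  on the trajectory in the application while \<open>b\<close> and \<open>a\<close> do not. The
  resulting bound is affine in \<open>H\<close>, so it preserves moments.\<close>

lemma perturbed_contraction_bounded:
  fixes b :: "nat \<Rightarrow> complex" and a :: "nat \<Rightarrow> real"
  assumes a: "\<And>n. n \<ge> 1 \<Longrightarrow> a n > 0" and \<kappa>: "\<kappa> > 0"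
    and b: "eventually (\<lambda>n. norm (b n) \<le> 1 - \<kappa> / a n) sequentially"
  obtains C where "C \<ge> 0"
    "\<And>(r :: nat \<Rightarrow> complex) H n. (\<And>n. n \<ge> 1 \<Longrightarrow> norm (r (Suc n) - b n * r n) \<le> H / a n) \<Longrightarrow> n \<ge> 1
       \<Longrightarrow> norm (r n) \<le> C * (norm (r 1) + H)"
proof -
  define good where "good r H \<longleftrightarrow> (\<forall>n\<ge>1. norm (r (Suc n) - b n * r n) \<le> H / a n)" for r :: "nat \<Rightarrow> complex" and H
  have H0: "H \<ge> 0" if "good r H" for r H
  proof -
    have "0 \<le> H / a 1" using order_trans[OF norm_ge_zero that[unfolded good_def, rule_format, of 1]] by simp
    then show ?thesis using a[of 1] by (simp add: zero_le_divide_iff)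
  qed
  \<comment> \<open>Crude constants depending on \<open>n\<close>; they are used only for the
    finitely many indices before the contraction sets in.\<close>
  have "\<exists>C\<ge>0. \<forall>r H. good r H \<longrightarrow> norm (r (Suc n)) \<le> C * (norm (r 1) + H)" for n
  proof (induction n)
    case 0
    show ?case by (intro exI[of _ 1]) (auto dest: H0)
  next
    case (Suc n)
    then obtain C where C: "C \<ge> 0" "\<And>r H. good r H \<Longrightarrow> norm (r (Suc n)) \<le> C * (norm (r 1) + H)" by auto
    show ?case
    proof (intro exI[of _ "norm (b (Suc n)) * C + 1 / a (Suc n)"] conjI allI impI)
      show "0 \<le> norm (b (Suc n)) * C + 1 / a (Suc n)" using C a[of "Suc n"] by simp
      fix r H assume g: "good r H"
      have an: "a (Suc n) > 0" using a by simp
      have "norm (r (Suc (Suc n))) \<le> norm (r (Suc (Suc n)) - b (Suc n) * r (Suc n)) + norm (b (Suc n) * r (Suc n))"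
        using norm_triangle_ineq[of "r (Suc (Suc n)) - b (Suc n) * r (Suc n)" "b (Suc n) * r (Suc n)"] by simp
      also have "\<dots> \<le> H / a (Suc n) + norm (b (Suc n)) * (C * (norm (r 1) + H))"
        using g C(2)[OF g] unfolding good_def by (intro add_mono) (auto simp: norm_mult intro!: mult_left_mono)
      also have "H / a (Suc n) \<le> 1 / a (Suc n) * (norm (r 1) + H)"
        using an by (simp add: field_simps)
      finally show "norm (r (Suc (Suc n))) \<le> (norm (b (Suc n)) * C + 1 / a (Suc n)) * (norm (r 1) + H)"
        by (simp add: algebra_simps)
    qed
  qed
  then obtain C where C: "\<And>n. C n \<ge> 0" "\<And>n r H. good r H \<Longrightarrow> norm (r (Suc n)) \<le> C n * (norm (r 1) + H)"
    by metis
  obtain N where N: "\<And>n. n \<ge> N \<Longrightarrow> norm (b n) \<le> 1 - \<kappa> / a n"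
    using b by (auto simp: eventually_sequentially)
  \<comment> \<open>The sum dominates all crude constants up to \<open>N\<close>. The summand
    \<open>1 / \<kappa>\<close> makes the bound reproduce itself afterwards: the contraction gains
    \<open>\<kappa> * K * ?Z / a n\<close>, which pays for the perturbation
    \<open>H / a n\<close>.\<close>
  define K where "K = (\<Sum>n\<le>N. C n) + 1 / \<kappa>"
  have K: "C n \<le> K" if "n \<le> N" for n
    using that C(1) \<kappa> member_le_sum[of n "{..N}" C] by (auto simp: K_def add_increasing2)
  have K\<kappa>: "K \<ge> 1 / \<kappa>" using C(1) by (simp add: K_def sum_nonneg)
  then have K0: "K \<ge> 0" using \<kappa> order_trans[of 0 "1/\<kappa>" K] by simp
  have main: "norm (r (Suc n)) \<le> K * (norm (r 1) + H)" if g: "good r H" for r H n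
  proof (induction n)
    case 0
    have "norm (r (Suc 0)) \<le> C 0 * (norm (r 1) + H)" using C(2)[OF g] by simp
    also have "\<dots> \<le> K * (norm (r 1) + H)" using K[of 0] H0[OF g] by (intro mult_right_mono) auto
    finally show ?case .
  next
    case (Suc n)
    let ?Z = "norm (r 1) + H"
    have Z: "?Z \<ge> 0" "H \<le> ?Z" using H0[OF g] by auto
    show ?case
    proof (cases "Suc n \<le> N")
      case True
      then have "norm (r (Suc (Suc n))) \<le> C (Suc n) * ?Z" using C(2)[OF g] by simp
      also have "\<dots> \<le> K * ?Z" using K[OF True] Z by (intro mult_right_mono) auto
      finally show ?thesis .
    next
      case False
      let ?a = "a (Suc n)"
      have an: "?a > 0" using a by simp
      have bn: "norm (b (Suc n)) \<le> 1 - \<kappa> / ?a" using N False by simp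
      have "norm (r (Suc (Suc n))) \<le> norm (r (Suc (Suc n)) - b (Suc n) * r (Suc n)) + norm (b (Suc n) * r (Suc n))"
        using norm_triangle_ineq[of "r (Suc (Suc n)) - b (Suc n) * r (Suc n)" "b (Suc n) * r (Suc n)"] by simp
      also have "\<dots> \<le> H / ?a + (1 - \<kappa> / ?a) * (K * ?Z)"
        using g bn Suc order_trans[OF norm_ge_zero bn] unfolding good_def
        by (intro add_mono) (auto simp: norm_mult intro!: mult_mono)
      also have "\<dots> = K * ?Z + (H - \<kappa> * K * ?Z) / ?a" using an by (simp add: field_simps)
      also have "\<dots> \<le> K * ?Z"
      proof -
        have "1 * ?Z \<le> (\<kappa> * K) * ?Z" using K\<kappa> \<kappa> Z by (intro mult_right_mono) (auto simp: field_simps)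
        then have "H - \<kappa> * K * ?Z \<le> 0" using order_trans[OF Z(2)] by simp
        then show ?thesis using an by (simp add: divide_nonpos_pos)
      qed
      finally show ?thesis .
    qed
  qed
  show ?thesis
  proof (rule that[of K])
    fix r :: "nat \<Rightarrow> complex" and H and n :: nat
    assume "\<And>n. n \<ge> 1 \<Longrightarrow> norm (r (Suc n) - b n * r n) \<le> H / a n" "n \<ge> 1"
    then show "norm (r n) \<le> K * (norm (r 1) + H)" using main[of r H "n - 1"] by (simp add: good_def)
  qed (use K0 in auto)
qed

lemma sum_inverse_le_ln: "(\<Sum>j=1..<n. 1 / real j) \<le> 1 + ln (real n)" if "n \<ge> 1"
proof -
  have "(\<Sum>j=1..<Suc n. 1 / real j) \<le> 1 + ln (real n)" if "n \<ge> 1" for n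
    using that
  proof (induction n rule: dec_induct)
    case (step n)
    have "1 / real (Suc n) \<le> ln (real (Suc n)) - ln (real n)"
      using ln_le_minus_one[of "real n / real (Suc n)"] step(1)
      by (simp add: ln_div field_simps)
    then show ?case using step by simp
  qed simp
  note * = this[OF that]
  have "(\<Sum>j=1..<n. 1 / real j) \<le> (\<Sum>j=1..<Suc n. 1 / real j)" by (intro sum_mono2) auto
  with * show ?thesis by simp
qed

text \<open>Comparison with an integral. The exponent says that the squared coefficients of the
  noise after time \<open>m\<close> sum to order \<open>m powr (1 - 2 * \<sigma>)\<close>, the
  source of the polynomial rate of convergence of the martingales.\<close>

lemma sum_powr_tail_le:
  assumes \<sigma>: "\<sigma> > 1/2" and m: "m \<ge> (1::nat)"
  shows "(\<Sum>j=Suc m..n. real j powr (- 2 * \<sigma>)) \<le> real m powr (1 - 2 * \<sigma>) / (2 * \<sigma> - 1)"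
proof -
  have diff: "real (Suc j) powr (- 2 * \<sigma>) \<le> (real j powr (1 - 2*\<sigma>) - real (Suc j) powr (1 - 2*\<sigma>)) / (2*\<sigma> - 1)"
    if j: "j \<ge> 1" for j :: nat
  proof -
    have "\<exists>z>real j. z < real (Suc j) \<and>
        real (Suc j) powr (1 - 2*\<sigma>) - real j powr (1 - 2*\<sigma>)
          = (real (Suc j) - real j) * ((1 - 2*\<sigma>) * z powr (1 - 2*\<sigma> - 1))"
      by (rule MVT2) (use j in \<open>auto intro!: derivative_eq_intros\<close>)
    then obtain z where z: "z > real j" "z < real (Suc j)"
      "real (Suc j) powr (1 - 2*\<sigma>) - real j powr (1 - 2*\<sigma>) = (1 - 2*\<sigma>) * z powr (- 2*\<sigma>)" by auto
    have "real (Suc j) powr (-2*\<sigma>) \<le> z powr (-2*\<sigma>)"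
      using z j \<sigma> by (intro powr_mono2') auto
    also have "\<dots> = (real j powr (1 - 2*\<sigma>) - real (Suc j) powr (1 - 2*\<sigma>)) / (2*\<sigma> - 1)"
      using z(3) \<sigma> by (simp add: field_simps)
    finally show ?thesis .
  qed
  have "(\<Sum>j=Suc m..n. real j powr (- 2 * \<sigma>)) \<le> (real m powr (1 - 2*\<sigma>) - real n powr (1 - 2*\<sigma>)) / (2*\<sigma> - 1)"
    if "n \<ge> m" for n
    using that
  proof (induction n rule: dec_induct)
    case (step n)
    have "(\<Sum>j=Suc m..Suc n. real j powr (- 2 * \<sigma>))
       = (\<Sum>j=Suc m..n. real j powr (- 2 * \<sigma>)) + real (Suc n) powr (- 2 * \<sigma>)"
      using step by simp
    also have "\<dots> \<le> (real m powr (1 - 2*\<sigma>) - real n powr (1 - 2*\<sigma>)) / (2*\<sigma> - 1)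
       + (real n powr (1 - 2*\<sigma>) - real (Suc n) powr (1 - 2*\<sigma>)) / (2*\<sigma> - 1)"
      using step m by (intro add_mono diff) auto
    finally show ?case by (simp add: add_divide_distrib[symmetric])
  qed simp
  moreover have "(real m powr (1 - 2*\<sigma>) - real n powr (1 - 2*\<sigma>)) / (2*\<sigma> - 1) \<le> real m powr (1 - 2*\<sigma>) / (2*\<sigma> - 1)"
    using \<sigma> by (intro divide_right_mono) auto
  ultimately show ?thesis
    using \<sigma> by (cases "n \<ge> m") (fastforce intro: order_trans)+
qed

subsection \<open>Random sequences dominated by a deterministic scale\<close>

text \<open>The random constant has moments of all orders but may depend on the order. One pathwise computation
  with such bounds yields both almost sure estimates and, by dominated convergence, estimates in \<open>L\<^sup>p\<close>.\<close>

definition dominated ::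
    "'b measure \<Rightarrow> (nat \<Rightarrow> real) \<Rightarrow> (nat \<Rightarrow> 'b \<Rightarrow> 'v::real_normed_vector) \<Rightarrow> bool" where
  "dominated M g R \<longleftrightarrow>
     (\<forall>p::nat. \<exists>K\<in>borel_measurable M. (\<forall>\<omega>. 0 \<le> K \<omega>) \<and> integrable M (\<lambda>\<omega>. K \<omega> ^ p) \<and>
        (AE \<omega> in M. \<forall>n\<ge>1. norm (R n \<omega>) \<le> K \<omega> * g n))"

lemma add_power_le:
  fixes a b :: real
  assumes "a \<ge> 0" "b \<ge> 0"
  shows "(a + b) ^ p \<le> 2 ^ p * (a ^ p + b ^ p)"
proof -
  have "(a + b) ^ p \<le> (2 * max a b) ^ p" using assms by (intro power_mono) auto
  also have "\<dots> = 2 ^ p * max a b ^ p" by (simp add: power_mult_distrib)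
  also have "max a b ^ p \<le> a ^ p + b ^ p" using assms by (auto simp: max_def)
  finally show ?thesis by simp
qed

lemma mult_power_le:
  fixes a b :: real
  assumes "a \<ge> 0" "b \<ge> 0"
  shows "(a * b) ^ p \<le> a ^ (2 * p) + b ^ (2 * p)"
proof -
  have "(a * b) ^ p \<le> ((max a b) ^ 2) ^ p"
    using assms unfolding power2_eq_square by (intro power_mono mult_mono) auto
  also have "\<dots> = max a b ^ (2 * p)" by (simp add: power_mult)
  also have "\<dots> \<le> a ^ (2 * p) + b ^ (2 * p)" using assms by (auto simp: max_def)
  finally show ?thesis .
qed

section \<open>Closure rules for dominated sequences\<close>

context prob_space
begin

lemma integrable_add_power:
  fixes K L :: "'a \<Rightarrow> real"
  assumes [measurable]: "K \<in> borel_measurable M" "L \<in> borel_measurable M"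
    and "\<And>\<omega>. K \<omega> \<ge> 0" "\<And>\<omega>. L \<omega> \<ge> 0"
    and "integrable M (\<lambda>\<omega>. K \<omega> ^ p)" "integrable M (\<lambda>\<omega>. L \<omega> ^ p)"
  shows "integrable M (\<lambda>\<omega>. (K \<omega> + L \<omega>) ^ p)"
proof (rule Bochner_Integration.integrable_bound)
  show "integrable M (\<lambda>\<omega>. 2 ^ p * (K \<omega> ^ p + L \<omega> ^ p))" using assms by simp
qed (use assms in \<open>auto intro!: AE_I2 add_power_le\<close>)

lemma integrable_sum_power:
  fixes K :: "'i \<Rightarrow> 'a \<Rightarrow> real"
  assumes "finite I" "\<And>i. i \<in> I \<Longrightarrow> K i \<in> borel_measurable M"
    and "\<And>i \<omega>. i \<in> I \<Longrightarrow> K i \<omega> \<ge> 0"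
    and "\<And>i. i \<in> I \<Longrightarrow> integrable M (\<lambda>\<omega>. K i \<omega> ^ p)"
  shows "integrable M (\<lambda>\<omega>. (1 + (\<Sum>i\<in>I. K i \<omega>)) ^ p)"
  using assms
proof (induction I rule: finite_induct)
  case (insert i I)
  have "integrable M (\<lambda>\<omega>. (K i \<omega> + (1 + (\<Sum>i\<in>I. K i \<omega>))) ^ p)"
  proof (rule integrable_add_power)
    show "(\<lambda>\<omega>. 1 + (\<Sum>i\<in>I. K i \<omega>)) \<in> borel_measurable M"
      using insert by (intro borel_measurable_add borel_measurable_sum borel_measurable_const) auto
    show "0 \<le> 1 + (\<Sum>i\<in>I. K i \<omega>)" for \<omega>
      using insert by (intro add_nonneg_nonneg sum_nonneg) auto
  qed (use insert in auto)
  then show ?case using insert(1,2) by (simp add: add.left_commute)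
qed simp

text \<open>The transfer principle behind the pathwise computations. Hypothesis \<open>S\<close> is
  stated for all nonnegative constants \<open>k\<close> on one almost sure event that does not
  depend on the moment order; random constants of the order at hand are inserted afterwards. The
  estimate is affine in \<open>k\<close>, so their moments survive, and the summand 1 makes room for
  deterministic contributions.\<close>

lemma dominated_combine:
  fixes R :: "'i \<Rightarrow> nat \<Rightarrow> 'a \<Rightarrow> 'v::real_normed_vector" and S :: "nat \<Rightarrow> 'a \<Rightarrow> 'w::real_normed_vector"
  assumes I: "finite I" and R: "\<And>i. i \<in> I \<Longrightarrow> dominated M (g i) (R i)" and C: "C \<ge> 0"
    and S: "AE \<omega> in M. \<forall>k. (\<forall>i\<in>I. k i \<ge> 0 \<and> (\<forall>n\<ge>1. norm (R i n \<omega>) \<le> k i * g i n)) \<longrightarrow>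
       (\<forall>n\<ge>1. norm (S n \<omega>) \<le> C * (1 + (\<Sum>i\<in>I. k i)) * h n)"
  shows "dominated M h S"
  unfolding dominated_def
proof
  fix p :: nat
  have "\<forall>i\<in>I. \<exists>K. K \<in> borel_measurable M \<and> (\<forall>\<omega>. 0 \<le> K \<omega>) \<and> integrable M (\<lambda>\<omega>. K \<omega> ^ p) \<and>
        (AE \<omega> in M. \<forall>n\<ge>1. norm (R i n \<omega>) \<le> K \<omega> * g i n)"
    using R unfolding dominated_def by blast
  from bchoice[OF this] obtain K where "\<forall>i\<in>I. K i \<in> borel_measurable M \<and> (\<forall>\<omega>. 0 \<le> K i \<omega>) \<and>
      integrable M (\<lambda>\<omega>. K i \<omega> ^ p) \<and> (AE \<omega> in M. \<forall>n\<ge>1. norm (R i n \<omega>) \<le> K i \<omega> * g i n)" ..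
  then have K: "\<And>i. i \<in> I \<Longrightarrow> K i \<in> borel_measurable M" "\<And>i \<omega>. i \<in> I \<Longrightarrow> 0 \<le> K i \<omega>"
    "\<And>i. i \<in> I \<Longrightarrow> integrable M (\<lambda>\<omega>. K i \<omega> ^ p)"
    "\<And>i. i \<in> I \<Longrightarrow> AE \<omega> in M. \<forall>n\<ge>1. norm (R i n \<omega>) \<le> K i \<omega> * g i n"
    by auto
  show "\<exists>K\<in>borel_measurable M. (\<forall>\<omega>. 0 \<le> K \<omega>) \<and> integrable M (\<lambda>\<omega>. K \<omega> ^ p) \<and>
        (AE \<omega> in M. \<forall>n\<ge>1. norm (S n \<omega>) \<le> K \<omega> * h n)"
  proof (intro bexI[of _ "\<lambda>\<omega>. C * (1 + (\<Sum>i\<in>I. K i \<omega>))"] conjI allI)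
    show "(\<lambda>\<omega>. C * (1 + (\<Sum>i\<in>I. K i \<omega>))) \<in> borel_measurable M" 
      by (intro borel_measurable_times borel_measurable_const borel_measurable_add borel_measurable_sum K(1))
    show "0 \<le> C * (1 + (\<Sum>i\<in>I. K i \<omega>))" for \<omega>
      using K C by (intro mult_nonneg_nonneg add_nonneg_nonneg sum_nonneg) auto
    show "integrable M (\<lambda>\<omega>. (C * (1 + (\<Sum>i\<in>I. K i \<omega>))) ^ p)"
      unfolding power_mult_distrib
      by (intro Bochner_Integration.integrable_mult_right integrable_sum_power I K)
    have "AE \<omega> in M. \<forall>i\<in>I. \<forall>n\<ge>1. norm (R i n \<omega>) \<le> K i \<omega> * g i n"
      using K(4) I by (simp add: AE_finite_all)
    then show "AE \<omega> in M. \<forall>n\<ge>1. norm (S n \<omega>) \<le> C * (1 + (\<Sum>i\<in>I. K i \<omega>)) * h n"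
      using S
    proof eventually_elim
      case (elim \<omega>)
      have "\<forall>i\<in>I. K i \<omega> \<ge> 0 \<and> (\<forall>n\<ge>1. norm (R i n \<omega>) \<le> K i \<omega> * g i n)"
        using elim(1) K(2) by simp
      from elim(2)[THEN spec, of "\<lambda>i. K i \<omega>", THEN mp, OF this] show ?case .
    qed
  qed
qed

text \<open>Order \<open>p\<close> for the product uses order \<open>2 * p\<close> for both factors,
  which is why domination asks for all orders at once.\<close>

lemma dominated_mult:
  fixes R S :: "nat \<Rightarrow> 'a \<Rightarrow> 'v::real_normed_algebra"
  assumes "dominated M g R" "dominated M h S"
  shows "dominated M (\<lambda>n. g n * h n) (\<lambda>n \<omega>. R n \<omega> * S n \<omega>)"
  unfolding dominated_def
proof
  fix p :: nat
  obtain K where K: "K \<in> borel_measurable M" "\<And>\<omega>. 0 \<le> K \<omega>" "integrable M (\<lambda>\<omega>. K \<omega> ^ (2 * p))"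
    "AE \<omega> in M. \<forall>n\<ge>1. norm (R n \<omega>) \<le> K \<omega> * g n"
    using assms(1) unfolding dominated_def by blast
  obtain L where L: "L \<in> borel_measurable M" "\<And>\<omega>. 0 \<le> L \<omega>" "integrable M (\<lambda>\<omega>. L \<omega> ^ (2 * p))"
    "AE \<omega> in M. \<forall>n\<ge>1. norm (S n \<omega>) \<le> L \<omega> * h n"
    using assms(2) unfolding dominated_def by blast
  show "\<exists>K\<in>borel_measurable M. (\<forall>\<omega>. 0 \<le> K \<omega>) \<and> integrable M (\<lambda>\<omega>. K \<omega> ^ p) \<and>
        (AE \<omega> in M. \<forall>n\<ge>1. norm (R n \<omega> * S n \<omega>) \<le> K \<omega> * (g n * h n))"
  proof (intro bexI[of _ "\<lambda>\<omega>. K \<omega> * L \<omega>"] conjI allI)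
    show "(\<lambda>\<omega>. K \<omega> * L \<omega>) \<in> borel_measurable M" using K(1) L(1) by measurable
    show "integrable M (\<lambda>\<omega>. (K \<omega> * L \<omega>) ^ p)"
    proof (rule Bochner_Integration.integrable_bound)
      show "integrable M (\<lambda>\<omega>. K \<omega> ^ (2 * p) + L \<omega> ^ (2 * p))" using K(3) L(3) by simp
      show "(\<lambda>\<omega>. (K \<omega> * L \<omega>) ^ p) \<in> borel_measurable M" using K(1) L(1) by measurable
      show "AE \<omega> in M. norm ((K \<omega> * L \<omega>) ^ p) \<le> norm (K \<omega> ^ (2 * p) + L \<omega> ^ (2 * p))"
      proof (rule AE_I2)
        fix \<omega>
        have "K \<omega> * L \<omega> \<ge> 0" using K(2) L(2) by simp
        then show "norm ((K \<omega> * L \<omega>) ^ p) \<le> norm (K \<omega> ^ (2 * p) + L \<omega> ^ (2 * p))"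
          using mult_power_le[OF K(2) L(2), of \<omega> \<omega> p] by simp
      qed
    qed
    show "AE \<omega> in M. \<forall>n\<ge>1. norm (R n \<omega> * S n \<omega>) \<le> K \<omega> * L \<omega> * (g n * h n)"
      using K(4) L(4)
    proof eventually_elim
      case (elim \<omega>)
      show ?case
      proof (intro allI impI)
        fix n :: nat assume n: "n \<ge> 1"
        have "norm (R n \<omega> * S n \<omega>) \<le> norm (R n \<omega>) * norm (S n \<omega>)" by (rule norm_mult_ineq)
        also have "\<dots> \<le> (K \<omega> * g n) * (L \<omega> * h n)"
        proof (rule mult_mono)
          show *: "norm (R n \<omega>) \<le> K \<omega> * g n" "norm (S n \<omega>) \<le> L \<omega> * h n" using elim n by auto
          show "0 \<le> K \<omega> * g n" using *(1) norm_ge_zero order_trans by blast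
        qed simp
        finally show "norm (R n \<omega> * S n \<omega>) \<le> K \<omega> * L \<omega> * (g n * h n)" by (simp add: algebra_simps)
      qed
    qed
  qed (use K(2) L(2) in auto)
qed

lemma dominated_mono:
  assumes "dominated M g R" "\<And>n. n \<ge> 1 \<Longrightarrow> g n \<le> h n"
  shows "dominated M h R"
  unfolding dominated_def
proof
  fix p :: nat
  obtain K where K: "K \<in> borel_measurable M" "\<And>\<omega>. 0 \<le> K \<omega>" "integrable M (\<lambda>\<omega>. K \<omega> ^ p)"
    "AE \<omega> in M. \<forall>n\<ge>1. norm (R n \<omega>) \<le> K \<omega> * g n"
    using assms(1) unfolding dominated_def by blast
  show "\<exists>K\<in>borel_measurable M. (\<forall>\<omega>. 0 \<le> K \<omega>) \<and> integrable M (\<lambda>\<omega>. K \<omega> ^ p) \<and>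
        (AE \<omega> in M. \<forall>n\<ge>1. norm (R n \<omega>) \<le> K \<omega> * h n)"
  proof (intro bexI[of _ K] conjI allI)
    show "AE \<omega> in M. \<forall>n\<ge>1. norm (R n \<omega>) \<le> K \<omega> * h n"
      using K(4)
    proof eventually_elim
      case (elim \<omega>)
      then show ?case using mult_left_mono[OF assms(2) K(2)] order_trans by blast
    qed
  qed (use K in auto)
qed

lemma dominated_bounded:
  assumes "AE \<omega> in M. \<forall>n\<ge>1. norm (R n \<omega>) \<le> C * g n" "C \<ge> 0"
  shows "dominated M g R"
  \<comment> \<open>With an empty index set only the summand 1 of the random constant
    survives.\<close>
  using dominated_combine[of "{}" "\<lambda>_. g" "\<lambda>_. R" C R g] assms by simp

lemma dominated_add:
  fixes R S :: "nat \<Rightarrow> 'a \<Rightarrow> 'v::real_normed_vector"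
  assumes "dominated M g R" "dominated M g S" "\<And>n. n \<ge> 1 \<Longrightarrow> g n \<ge> 0"
  shows "dominated M g (\<lambda>n \<omega>. R n \<omega> + S n \<omega>)"
proof (rule dominated_combine[of "UNIV :: bool set" "\<lambda>_. g" "\<lambda>b. if b then R else S" 1])
  show "AE \<omega> in M. \<forall>k. (\<forall>i\<in>UNIV. k i \<ge> 0 \<and> (\<forall>n\<ge>1. norm ((if i then R else S) n \<omega>) \<le> k i * g n)) \<longrightarrow>
       (\<forall>n\<ge>1. norm (R n \<omega> + S n \<omega>) \<le> 1 * (1 + (\<Sum>i\<in>UNIV. k i)) * g n)"
  proof (intro AE_I2 allI impI)
    fix \<omega> k n assume k: "\<forall>i\<in>UNIV. (0::real) \<le> k i \<and> (\<forall>n\<ge>1. norm ((if i then R else S) n \<omega>) \<le> k i * g n)"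
      and n: "(1::nat) \<le> n"
    have "norm (R n \<omega>) \<le> k True * g n" using bspec[OF k, of True] n by simp
    moreover have "norm (S n \<omega>) \<le> k False * g n" using bspec[OF k, of False] n by simp
    ultimately show "norm (R n \<omega> + S n \<omega>) \<le> 1 * (1 + (\<Sum>i\<in>UNIV. k i)) * g n"
      using assms(3)[OF n] norm_triangle_ineq[of "R n \<omega>" "S n \<omega>"] by (simp add: UNIV_bool algebra_simps)
  qed
qed (use assms in auto)

lemma dominated_scale:
  fixes R :: "nat \<Rightarrow> 'a \<Rightarrow> 'v::real_normed_vector" and S :: "nat \<Rightarrow> 'a \<Rightarrow> 'w::real_normed_vector"
  assumes R: "dominated M g R" and C: "C \<ge> 0" and g: "\<And>n. n \<ge> 1 \<Longrightarrow> g n \<ge> 0"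
    and c: "\<And>n \<omega>. n \<ge> 1 \<Longrightarrow> norm (S n \<omega>) \<le> c n * norm (R n \<omega>)"
    and h: "\<And>n. n \<ge> 1 \<Longrightarrow> c n * g n \<le> C * h n" "\<And>n. n \<ge> 1 \<Longrightarrow> c n \<ge> 0"
  shows "dominated M h S"
proof (rule dominated_combine[of "{()}" "\<lambda>_. g" "\<lambda>_. R" C])
  show "AE \<omega> in M. \<forall>k. (\<forall>i\<in>{()}. k i \<ge> 0 \<and> (\<forall>n\<ge>1. norm (R n \<omega>) \<le> k i * g n)) \<longrightarrow>
       (\<forall>n\<ge>1. norm (S n \<omega>) \<le> C * (1 + (\<Sum>i\<in>{()}. k i)) * h n)"
  proof (intro AE_I2 allI impI)
    fix \<omega> and k :: "unit \<Rightarrow> real" and n :: nat assume k: "\<forall>i\<in>{()}. k i \<ge> 0 \<and> (\<forall>n\<ge>1. norm (R n \<omega>) \<le> k i * g n)"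
      and n: "(1::nat) \<le> n"
    have "norm (S n \<omega>) \<le> c n * (k () * g n)"
      using c[OF n] k n h(2)[OF n] by (meson insertI1 mult_left_mono order_trans)
    also have "\<dots> = k () * (c n * g n)" by simp
    also have "\<dots> \<le> (1 + k ()) * (c n * g n)" using g[OF n] h(2)[OF n] by (intro mult_right_mono) auto
    also have "\<dots> \<le> (1 + k ()) * (C * h n)" using h(1)[OF n] k by (intro mult_left_mono) auto
    finally show "norm (S n \<omega>) \<le> C * (1 + (\<Sum>i\<in>{()}. k i)) * h n" by (simp add: algebra_simps)
  qed
qed (use assms in auto)

lemma dominated_integrable_power:
  fixes R :: "nat \<Rightarrow> 'a \<Rightarrow> 'v::{real_normed_vector, second_countable_topology}"
  assumes "dominated M g R" "R n \<in> borel_measurable M" "n \<ge> 1"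
  shows "integrable M (\<lambda>\<omega>. norm (R n \<omega>) ^ p)"
proof -
  obtain K where K: "K \<in> borel_measurable M" "\<And>\<omega>. 0 \<le> K \<omega>" "integrable M (\<lambda>\<omega>. K \<omega> ^ p)"
    "AE \<omega> in M. \<forall>n\<ge>1. norm (R n \<omega>) \<le> K \<omega> * g n"
    using assms(1) unfolding dominated_def by blast
  show ?thesis
  proof (rule Bochner_Integration.integrable_bound)
    show "integrable M (\<lambda>\<omega>. \<bar>g n\<bar> ^ p * K \<omega> ^ p)" using K(3) by simp
    show "(\<lambda>\<omega>. norm (R n \<omega>) ^ p) \<in> borel_measurable M" using assms(2) by measurable
    show "AE \<omega> in M. norm (norm (R n \<omega>) ^ p) \<le> norm (\<bar>g n\<bar> ^ p * K \<omega> ^ p)"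
      using K(4)
    proof eventually_elim
      case (elim \<omega>)
      then have "norm (R n \<omega>) \<le> K \<omega> * g n" using assms(3) by simp
      also have "\<dots> \<le> \<bar>g n\<bar> * K \<omega>" using K(2)[of \<omega>] mult_left_mono[of "g n" "\<bar>g n\<bar>" "K \<omega>"] by (simp add: mult.commute)
      finally have "norm (R n \<omega>) ^ p \<le> (\<bar>g n\<bar> * K \<omega>) ^ p" by (intro power_mono) auto
      then show ?case using K(2)[of \<omega>] by (simp add: power_mult_distrib abs_mult)
    qed
  qed
qed

lemma dominated_expectation_bound:
  fixes R :: "nat \<Rightarrow> 'a \<Rightarrow> 'v::{banach, second_countable_topology}"
  assumes "dominated M g R" "\<And>n. n \<ge> 1 \<Longrightarrow> R n \<in> borel_measurable M"
  obtains C where "\<And>n. n \<ge> 1 \<Longrightarrow> norm (expectation (R n)) \<le> C * g n"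
proof -
  obtain K where K: "K \<in> borel_measurable M" "\<And>\<omega>. 0 \<le> K \<omega>" "integrable M (\<lambda>\<omega>. K \<omega> ^ 1)"
    "AE \<omega> in M. \<forall>n\<ge>1. norm (R n \<omega>) \<le> K \<omega> * g n"
    using assms(1) unfolding dominated_def by blast
  show ?thesis
  proof (rule that[of "expectation K"])
    fix n :: nat assume n: "n \<ge> 1"
    have "integrable M (\<lambda>\<omega>. norm (R n \<omega>) ^ 1)"
      by (rule dominated_integrable_power[OF assms(1) assms(2)[OF n] n])
    then have i: "integrable M (R n)" using assms(2)[OF n] by (simp add: integrable_norm_iff)
    have "norm (expectation (R n)) \<le> expectation (\<lambda>\<omega>. norm (R n \<omega>))" by (rule integral_norm_bound)
    also have "\<dots> \<le> expectation (\<lambda>\<omega>. K \<omega> * g n)"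
    proof (rule integral_mono_AE)
      show "AE \<omega> in M. norm (R n \<omega>) \<le> K \<omega> * g n" using K(4) n by auto
    qed (use i K(3) in auto)
    finally show "norm (expectation (R n)) \<le> expectation K * g n" by simp
  qed
qed

text \<open>Two scales are kept apart: \<open>g\<close> is a divisor and must be positive from
  \<open>n = 1\<close> on, whereas the scale \<open>h\<close> of the application contains
  \<open>ln n\<close> and vanishes at \<open>n = 1\<close>. The \<open>L^p\<close> statement is
  dominated convergence for \<open>(norm R / g) powr p\<close>, with \<open>1 + K ^ q\<close> as
  majorant for an integer \<open>q \<ge> p\<close>.\<close>

lemma dominated_smallo:
  fixes R :: "nat \<Rightarrow> 'a \<Rightarrow> 'v::{banach, second_countable_topology}"
  assumes dom: "dominated M g R" and meas: "\<And>n. n \<ge> 1 \<Longrightarrow> R n \<in> borel_measurable M"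
    and g: "\<And>n. n \<ge> 1 \<Longrightarrow> g n > 0" and gh: "g \<in> O(h)"
    and lim: "AE \<omega> in M. (\<lambda>n. norm (R n \<omega>) / g n) \<longlonglongrightarrow> 0"
  shows "smallo_as_Lp M R h"
proof -
  have ev: "eventually (\<lambda>n. g n \<noteq> 0) sequentially"
    using eventually_ge_at_top[of 1] by eventually_elim (use g in force)
  have "AE \<omega> in M. (\<lambda>n. norm (R n \<omega>)) \<in> o(h)"
    using lim
  proof eventually_elim
    case (elim \<omega>)
    have "(\<lambda>n. norm (R n \<omega>)) \<in> o(g)"
      using elim ev by (intro smalloI_tendsto)
    then show ?case using gh by (rule landau_o.small_big_trans)
  qed
  moreover have "(\<forall>n\<ge>1. integrable M (\<lambda>\<omega>. norm (R n \<omega>) powr p)) \<and>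
        (\<lambda>n. (\<integral>\<omega>. norm (R n \<omega>) powr p \<partial>M) powr (1 / p)) \<in> o(h)" if p: "p \<ge> 1" for p :: real
  proof -
    define q where "q = nat \<lceil>p\<rceil>"
    have q: "real q \<ge> p" "q \<ge> 1" using p by (auto simp: q_def) linarith+
    have pw: "x powr p \<le> 1 + x ^ q" if "x \<ge> 0" for x :: real
    proof (cases "x \<le> 1")
      case True
      then have "x powr p \<le> 1 powr p" using that p by (intro powr_mono2) auto
      then show ?thesis using zero_le_power[OF that, of q] by simp
    next
      case False
      then have "x powr p \<le> x powr real q" using q by (intro powr_mono) auto
      also have "\<dots> = x ^ q" using False by (simp add: powr_realpow)
      finally show ?thesis by simp
    qed
    obtain K where K: "K \<in> borel_measurable M" "\<And>\<omega>. 0 \<le> K \<omega>" "integrable M (\<lambda>\<omega>. K \<omega> ^ q)"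
      "AE \<omega> in M. \<forall>n\<ge>1. norm (R n \<omega>) \<le> K \<omega> * g n"
      using dom unfolding dominated_def by blast
    have int: "integrable M (\<lambda>\<omega>. norm (R n \<omega>) powr p)" if n: "n \<ge> 1" for n
    proof (rule Bochner_Integration.integrable_bound)
      show "integrable M (\<lambda>\<omega>. 1 + norm (R n \<omega>) ^ q)"
        using dominated_integrable_power[OF dom meas[OF n] n] by simp
      show "(\<lambda>\<omega>. norm (R n \<omega>) powr p) \<in> borel_measurable M" using meas[OF n] by measurable
    qed (use pw in auto)
    \<comment> \<open>The shift of the index avoids \<open>g 0\<close>, about which nothing is
      assumed.\<close>
    have "(\<lambda>n. \<integral>\<omega>. (norm (R (Suc n) \<omega>) / g (Suc n)) powr p \<partial>M) \<longlonglongrightarrow> (\<integral>\<omega>. 0 \<partial>M)"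
    proof (rule integral_dominated_convergence[where w="\<lambda>\<omega>. 1 + K \<omega> ^ q"])
      show "AE \<omega> in M. (\<lambda>n. (norm (R (Suc n) \<omega>) / g (Suc n)) powr p) \<longlonglongrightarrow> 0"
        using lim
      proof eventually_elim
        case (elim \<omega>)
        have "(\<lambda>n. norm (R (Suc n) \<omega>) / g (Suc n)) \<longlonglongrightarrow> 0" using elim by (rule LIMSEQ_Suc)
        then have "(\<lambda>n. (norm (R (Suc n) \<omega>) / g (Suc n)) powr p) \<longlonglongrightarrow> 0 powr p"
          by (intro tendsto_powr') (use p g in \<open>auto intro!: always_eventually simp: less_imp_le\<close>)
        then show ?case by simp
      qed
      show "AE \<omega> in M. norm ((norm (R (Suc n) \<omega>) / g (Suc n)) powr p) \<le> 1 + K \<omega> ^ q" for n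
        using K(4)
      proof eventually_elim
        case (elim \<omega>)
        have gp: "g (Suc n) > 0" using g by simp
        have "norm (R (Suc n) \<omega>) / g (Suc n) \<le> K \<omega>" using elim gp by (simp add: field_simps)
        then have "(norm (R (Suc n) \<omega>) / g (Suc n)) powr p \<le> K \<omega> powr p"
          using p gp by (intro powr_mono2) auto
        also have "\<dots> \<le> 1 + K \<omega> ^ q" using pw K(2) by simp
        finally show ?case by simp
      qed
    qed (use K meas in \<open>auto intro!: borel_measurable_divide borel_measurable_norm powr_real_measurable\<close>)
    then have "(\<lambda>n. \<integral>\<omega>. (norm (R n \<omega>) / g n) powr p \<partial>M) \<longlonglongrightarrow> 0"
      by (simp add: filterlim_sequentially_Suc[where f="\<lambda>n. \<integral>\<omega>. (norm (R n \<omega>) / g n) powr p \<partial>M"])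
    then have "(\<lambda>n. (\<integral>\<omega>. (norm (R n \<omega>) / g n) powr p \<partial>M) powr (1/p)) \<longlonglongrightarrow> 0 powr (1/p)"
      by (intro tendsto_powr') (use p in \<open>auto intro!: always_eventually\<close>)
    moreover have "eventually (\<lambda>n. (\<integral>\<omega>. (norm (R n \<omega>) / g n) powr p \<partial>M) powr (1/p)
          = (\<integral>\<omega>. norm (R n \<omega>) powr p \<partial>M) powr (1 / p) / g n) sequentially"
      using eventually_ge_at_top[of 1]
    proof eventually_elim
      case (elim n)
      have gp: "g n > 0" using g elim by simp
      have "(\<integral>\<omega>. (norm (R n \<omega>) / g n) powr p \<partial>M) = (\<integral>\<omega>. norm (R n \<omega>) powr p / g n powr p \<partial>M)"
        using gp by (simp add: powr_divide)
      also have "\<dots> = (\<integral>\<omega>. norm (R n \<omega>) powr p \<partial>M) / g n powr p" by simp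
      finally have e: "(\<integral>\<omega>. (norm (R n \<omega>) / g n) powr p \<partial>M)
        = (\<integral>\<omega>. norm (R n \<omega>) powr p \<partial>M) / g n powr p" .
      have nn: "(\<integral>\<omega>. norm (R n \<omega>) powr p \<partial>M) \<ge> 0" by (intro integral_nonneg_AE) auto
      show ?case
        unfolding e using gp p nn by (simp add: powr_divide powr_powr)
    qed
    ultimately have "(\<lambda>n. (\<integral>\<omega>. norm (R n \<omega>) powr p \<partial>M) powr (1 / p) / g n) \<longlonglongrightarrow> 0"
      using p by (auto intro: Lim_transform_eventually)
    then have "(\<lambda>n. (\<integral>\<omega>. norm (R n \<omega>) powr p \<partial>M) powr (1 / p)) \<in> o(g)"
      using ev by (intro smalloI_tendsto)
    then have "(\<lambda>n. (\<integral>\<omega>. norm (R n \<omega>) powr p \<partial>M) powr (1 / p)) \<in> o(h)"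
      using gh by (rule landau_o.small_big_trans)
    then show ?thesis using int by simp
  qed
  ultimately show ?thesis unfolding smallo_as_Lp_def by blast
qed

text \<open>The limit is taken along powers of two, where first moments are summable, and Fatou transfers the
  moment bounds to it. Summing a weighted high moment over all \<open>n\<close> replaces a maximal inequality.\<close>

lemma moment_cauchy_limit:
  fixes T :: "nat \<Rightarrow> 'a \<Rightarrow> complex"
  assumes meas[measurable]: "\<And>n. T n \<in> borel_measurable M" and \<delta>: "\<delta> > 0"
    and bnd: "\<And>p::nat. \<exists>C. \<forall>m\<ge>1. \<forall>n\<ge>m.
       (\<integral>\<^sup>+\<omega>. ennreal (norm (T n \<omega> - T m \<omega>) ^ p) \<partial>M) \<le> ennreal (C * real m powr (- \<delta> * real p))"
  obtains U where "U \<in> borel_measurable M"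
    "dominated M (\<lambda>n. real n powr (- \<delta> / 2)) (\<lambda>n \<omega>. T n \<omega> - U \<omega>)"
proof -
  \<comment> \<open>\<open>lim\<close> is total and measurable, so no exceptional set has to be
    removed; off the event of convergence its value is arbitrary.\<close>
  define U where "U \<omega> = lim (\<lambda>k. T (2 ^ k) \<omega>)" for \<omega>
  have U[measurable]: "U \<in> borel_measurable M" unfolding U_def by measurable
  have conv: "AE \<omega> in M. (\<lambda>k. T (2 ^ k) \<omega>) \<longlonglongrightarrow> U \<omega>"
  proof -
    obtain C where C: "\<And>m n. m \<ge> 1 \<Longrightarrow> n \<ge> m \<Longrightarrow>
       (\<integral>\<^sup>+\<omega>. ennreal (norm (T n \<omega> - T m \<omega>) ^ 1) \<partial>M) \<le> ennreal (C * real m powr (- \<delta> * real 1))"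
      using bnd[of 1] by blast
    \<comment> \<open>The ratio between the bounds for consecutive dyadic increments.\<close>
    define q where "q = 2 powr (- \<delta>)"
    have q: "0 < q" "q < 1" using \<delta> by (auto simp: q_def powr_less_one)
    let ?d = "\<lambda>k \<omega>. T (2 ^ Suc k) \<omega> - T (2 ^ k) \<omega>"
    have "(\<integral>\<^sup>+\<omega>. (\<Sum>k. ennreal (norm (?d k \<omega>))) \<partial>M) = (\<Sum>k. \<integral>\<^sup>+\<omega>. ennreal (norm (?d k \<omega>)) \<partial>M)"
      by (rule nn_integral_suminf) measurable
    also have "\<dots> \<le> (\<Sum>k. ennreal (\<bar>C\<bar> * q ^ k))"
    proof (rule suminf_le)
      fix k
      have "(\<integral>\<^sup>+\<omega>. ennreal (norm (?d k \<omega>)) \<partial>M) \<le> ennreal (C * real (2 ^ k) powr (- \<delta>))"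
        using C[of "2 ^ k" "2 ^ Suc k"] by simp
      also have "real (2 ^ k) powr (- \<delta>) = q ^ k"
        by (simp add: q_def powr_powr powr_realpow[symmetric] mult.commute)
      also have "ennreal (C * q ^ k) \<le> ennreal (\<bar>C\<bar> * q ^ k)"
        using q by (intro ennreal_leI mult_right_mono) auto
      finally show "(\<integral>\<^sup>+\<omega>. ennreal (norm (?d k \<omega>)) \<partial>M) \<le> ennreal (\<bar>C\<bar> * q ^ k)" .
    qed auto
    also have "\<dots> = ennreal (\<Sum>k. \<bar>C\<bar> * q ^ k)"
      using q by (intro suminf_ennreal2 summable_mult summable_geometric) auto
    finally have "(\<integral>\<^sup>+\<omega>. (\<Sum>k. ennreal (norm (?d k \<omega>))) \<partial>M) \<noteq> \<infinity>"
      by (auto simp: top_unique)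
    then have "AE \<omega> in M. (\<Sum>k. ennreal (norm (?d k \<omega>))) \<noteq> \<infinity>"
      by (intro nn_integral_noteq_infinite) auto
    then show ?thesis
    proof eventually_elim
      case (elim \<omega>)
      then have "summable (\<lambda>k. norm (?d k \<omega>))"
        by (intro summable_suminf_not_top) auto
      then have "summable (\<lambda>k. ?d k \<omega>)" by (rule summable_norm_cancel)
      then have "convergent (\<lambda>n. \<Sum>k<n. ?d k \<omega>)" by (simp add: summable_iff_convergent)
      then have "convergent (\<lambda>n. T (2 ^ n) \<omega> - T (2 ^ 0) \<omega>)"
        by (subst (asm) sum_lessThan_telescope[of "\<lambda>k. T (2 ^ k) \<omega>"])
      then have "convergent (\<lambda>n. (T (2 ^ n) \<omega> - T (2 ^ 0) \<omega>) + T (2 ^ 0) \<omega>)"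
        by (intro convergent_add convergent_const)
      then show ?case unfolding U_def by (simp add: convergent_LIMSEQ_iff)
    qed
  qed
  have tail: "\<exists>C\<ge>0. \<forall>n\<ge>1. (\<integral>\<^sup>+\<omega>. ennreal (norm (T n \<omega> - U \<omega>) ^ q) \<partial>M) \<le> ennreal (C * real n powr (- \<delta> * real q))" for q
  proof -
    obtain C where C: "\<And>m n. m \<ge> 1 \<Longrightarrow> n \<ge> m \<Longrightarrow>
       (\<integral>\<^sup>+\<omega>. ennreal (norm (T n \<omega> - T m \<omega>) ^ q) \<partial>M) \<le> ennreal (C * real m powr (- \<delta> * real q))"
      using bnd[of q] by blast
    show ?thesis
    proof (intro exI[of _ "\<bar>C\<bar>"] conjI allI impI)
      fix n :: nat assume n: "n \<ge> 1"
      have "(\<integral>\<^sup>+\<omega>. ennreal (norm (T n \<omega> - U \<omega>) ^ q) \<partial>M)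
          = (\<integral>\<^sup>+\<omega>. liminf (\<lambda>k. ennreal (norm (T (2 ^ k) \<omega> - T n \<omega>) ^ q)) \<partial>M)"
      proof (rule nn_integral_cong_AE, use conv in eventually_elim)
        case (elim \<omega>)
        have "(\<lambda>k. ennreal (norm (T (2 ^ k) \<omega> - T n \<omega>) ^ q)) \<longlonglongrightarrow> ennreal (norm (U \<omega> - T n \<omega>) ^ q)"
          by (intro tendsto_intros elim)
        from lim_imp_Liminf[OF _ this] show ?case by (simp add: norm_minus_commute)
      qed
      also have "\<dots> \<le> liminf (\<lambda>k. \<integral>\<^sup>+\<omega>. ennreal (norm (T (2 ^ k) \<omega> - T n \<omega>) ^ q) \<partial>M)"
        by (rule nn_integral_liminf) measurable
      also have "\<dots> \<le> limsup (\<lambda>k. \<integral>\<^sup>+\<omega>. ennreal (norm (T (2 ^ k) \<omega> - T n \<omega>) ^ q) \<partial>M)"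
        by (rule Liminf_le_Limsup) simp
      also have "\<dots> \<le> ennreal (C * real n powr (- \<delta> * real q))"
      proof (rule Limsup_bounded)
        show "eventually (\<lambda>k. (\<integral>\<^sup>+\<omega>. ennreal (norm (T (2 ^ k) \<omega> - T n \<omega>) ^ q) \<partial>M)
            \<le> ennreal (C * real n powr (- \<delta> * real q))) sequentially"
          using eventually_ge_at_top[of n]
        proof eventually_elim
          case (elim k)
          have "n \<le> 2 ^ k" using elim less_exp[of k] by linarith
          then show ?case using C n by simp
        qed
      qed
      also have "\<dots> \<le> ennreal (\<bar>C\<bar> * real n powr (- \<delta> * real q))"
        by (intro ennreal_leI mult_right_mono) auto
      finally show "(\<integral>\<^sup>+\<omega>. ennreal (norm (T n \<omega> - U \<omega>) ^ q) \<partial>M) \<le> ennreal (\<bar>C\<bar> * real n powr (- \<delta> * real q))" .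
    qed simp
  qed
  have "dominated M (\<lambda>n. real n powr (- \<delta> / 2)) (\<lambda>n \<omega>. T n \<omega> - U \<omega>)"
    unfolding dominated_def
  proof
    fix p :: nat
    \<comment> \<open>The order is so large that half of the decay, \<open>\<delta> * q / 2\<close>,
      is at least 2 and makes the weighted moments summable like \<open>1 / n^2\<close>. The other
      half is the rate that remains in the conclusion.\<close>
    define q where "q = Suc (max p (nat \<lceil>4 / \<delta>\<rceil>))"
    have q: "q \<ge> 1" "p \<le> q" by (auto simp: q_def)
    have "real q \<ge> 4 / \<delta>" unfolding q_def by linarith
    then have q4: "\<delta> * real q / 2 \<ge> 2" using \<delta> by (simp add: field_simps)
    obtain C where C: "C \<ge> 0" "\<And>n. n \<ge> 1 \<Longrightarrow>
        (\<integral>\<^sup>+\<omega>. ennreal (norm (T n \<omega> - U \<omega>) ^ q) \<partial>M) \<le> ennreal (C * real n powr (- \<delta> * real q))"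
      using tail[of q] by blast
    \<comment> \<open>Every single term is at most \<open>Y\<close>, so the \<open>q\<close>-th root
      of \<open>Y\<close> bounds all \<open>n\<close> at the same time.\<close>
    define Y where "Y \<omega> = (\<Sum>n. ennreal (norm (T (Suc n) \<omega> - U \<omega>) ^ q * real (Suc n) powr (\<delta> * real q / 2)))" for \<omega>
    have Y[measurable]: "Y \<in> borel_measurable M" unfolding Y_def by measurable
    have "(\<integral>\<^sup>+\<omega>. Y \<omega> \<partial>M)
       = (\<Sum>n. \<integral>\<^sup>+\<omega>. ennreal (norm (T (Suc n) \<omega> - U \<omega>) ^ q * real (Suc n) powr (\<delta> * real q / 2)) \<partial>M)"
      unfolding Y_def by (rule nn_integral_suminf) measurable
    also have "\<dots> \<le> (\<Sum>n. ennreal (C * inverse (real (Suc n) ^ 2)))"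
    proof (rule suminf_le)
      fix n
      let ?a = "real (Suc n)"
      have "(\<integral>\<^sup>+\<omega>. ennreal (norm (T (Suc n) \<omega> - U \<omega>) ^ q * ?a powr (\<delta> * real q / 2)) \<partial>M)
         = (\<integral>\<^sup>+\<omega>. ennreal (norm (T (Suc n) \<omega> - U \<omega>) ^ q) \<partial>M) * ennreal (?a powr (\<delta> * real q / 2))"
        by (simp add: ennreal_mult nn_integral_multc)
      also have "\<dots> \<le> ennreal (C * ?a powr (- \<delta> * real q)) * ennreal (?a powr (\<delta> * real q / 2))"
        using C(2)[of "Suc n"] by (intro mult_right_mono) auto
      also have "\<dots> = ennreal (C * ?a powr (- (\<delta> * real q / 2)))"
        using C(1) by (simp add: ennreal_mult[symmetric] powr_add[symmetric] mult.assoc)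
      also have "\<dots> \<le> ennreal (C * ?a powr (- 2))"
        using q4 C(1) by (intro ennreal_leI mult_left_mono powr_mono) auto
      also have "?a powr (- 2) = inverse (?a ^ 2)"
        by (simp add: powr_minus powr_numeral)
      finally show "(\<integral>\<^sup>+\<omega>. ennreal (norm (T (Suc n) \<omega> - U \<omega>) ^ q * ?a powr (\<delta> * real q / 2)) \<partial>M)
          \<le> ennreal (C * inverse (?a ^ 2))" .
    qed auto
    also have "\<dots> = ennreal (\<Sum>n. C * inverse (real (Suc n) ^ 2))"
    proof (intro suminf_ennreal2 summable_mult)
      have "summable (\<lambda>n. inverse (real n ^ 2))" by (rule inverse_power_summable) simp
      then show "summable (\<lambda>n. inverse (real (Suc n) ^ 2))" by (subst summable_Suc_iff[of "\<lambda>n. inverse (real n ^ 2)"])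
    qed (use C in auto)
    finally have fin: "(\<integral>\<^sup>+\<omega>. Y \<omega> \<partial>M) < \<infinity>" by (simp add: order_le_less_trans)
    then have YAE: "AE \<omega> in M. Y \<omega> \<noteq> \<infinity>" by (intro nn_integral_noteq_infinite) auto
    define K where "K \<omega> = enn2real (Y \<omega>) powr (1 / real q)" for \<omega>
    have Kq: "K \<omega> ^ q = enn2real (Y \<omega>)" for \<omega>
      using q unfolding K_def by (cases "enn2real (Y \<omega>) = 0") (auto simp: powr_realpow[symmetric] powr_powr)
    have intY: "integrable M (\<lambda>\<omega>. enn2real (Y \<omega>))"
    proof (rule integrableI_nonneg)
      have "(\<integral>\<^sup>+\<omega>. ennreal (enn2real (Y \<omega>)) \<partial>M) \<le> (\<integral>\<^sup>+\<omega>. Y \<omega> \<partial>M)"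
        by (intro nn_integral_mono) (simp add: ennreal_enn2real_if)
      then show "(\<integral>\<^sup>+\<omega>. ennreal (enn2real (Y \<omega>)) \<partial>M) < \<infinity>" using fin by (simp add: order_le_less_trans)
    qed auto
    show "\<exists>K\<in>borel_measurable M. (\<forall>\<omega>. 0 \<le> K \<omega>) \<and> integrable M (\<lambda>\<omega>. K \<omega> ^ p) \<and>
        (AE \<omega> in M. \<forall>n\<ge>1. norm (T n \<omega> - U \<omega>) \<le> K \<omega> * real n powr (- \<delta> / 2))"
    proof (intro bexI[of _ K] conjI allI)
      show Km: "K \<in> borel_measurable M" unfolding K_def by measurable
      show "integrable M (\<lambda>\<omega>. K \<omega> ^ p)"
      proof (rule Bochner_Integration.integrable_bound)
        show "integrable M (\<lambda>\<omega>. 1 + enn2real (Y \<omega>))" using intY by simp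
        show "(\<lambda>\<omega>. K \<omega> ^ p) \<in> borel_measurable M" using Km by measurable
        have Kpq: "K \<omega> ^ p \<le> 1 + K \<omega> ^ q" for \<omega>
        proof (cases "K \<omega> \<le> 1")
          case True
          have K0: "K \<omega> \<ge> 0" by (simp add: K_def)
          have "K \<omega> ^ p \<le> 1" using True K0 by (simp add: power_le_one)
          then show ?thesis using zero_le_power[OF K0, of q] by linarith
        next
          case False
          then have "K \<omega> ^ p \<le> K \<omega> ^ q" using q by (intro power_increasing) auto
          then show ?thesis by simp
        qed
        show "AE \<omega> in M. norm (K \<omega> ^ p) \<le> norm (1 + enn2real (Y \<omega>))"
        proof (rule AE_I2)
          fix \<omega>
          have "K \<omega> \<ge> 0" by (simp add: K_def)
          then show "norm (K \<omega> ^ p) \<le> norm (1 + enn2real (Y \<omega>))" using Kpq[of \<omega>] by (simp add: Kq)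
        qed
      qed
      show "AE \<omega> in M. \<forall>n\<ge>1. norm (T n \<omega> - U \<omega>) \<le> K \<omega> * real n powr (- \<delta> / 2)"
        using YAE
      proof eventually_elim
        case (elim \<omega>)
        show ?case
        proof (intro allI impI)
          fix n :: nat assume n: "n \<ge> 1"
          define m where "m = n - 1"
          have nm: "n = Suc m" using n by (simp add: m_def)
          let ?x = "norm (T n \<omega> - U \<omega>) * real n powr (\<delta> / 2)"
          have "ennreal (norm (T (Suc m) \<omega> - U \<omega>) ^ q * real (Suc m) powr (\<delta> * real q / 2)) \<le> Y \<omega>"
          proof -
            define F where "F n = ennreal (norm (T (Suc n) \<omega> - U \<omega>) ^ q * real (Suc n) powr (\<delta> * real q / 2))" for n
            have "sum F {m} \<le> suminf F" by (intro sum_le_suminf summableI) auto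
            then show ?thesis unfolding Y_def F_def[abs_def] by (simp only: sum.insert[of "{}"] finite.emptyI empty_iff not_False_eq_True sum.empty add_0_right)
          qed
          also have "Y \<omega> = ennreal (enn2real (Y \<omega>))" using elim by (simp add: ennreal_enn2real_if)
          finally have "norm (T n \<omega> - U \<omega>) ^ q * real n powr (\<delta> * real q / 2) \<le> enn2real (Y \<omega>)"
            unfolding nm by (subst (asm) ennreal_le_iff) auto
          also have "norm (T n \<omega> - U \<omega>) ^ q * real n powr (\<delta> * real q / 2) = ?x ^ q"
            using n by (simp add: power_mult_distrib powr_realpow[symmetric] powr_powr)
          also have "enn2real (Y \<omega>) = K \<omega> ^ q" by (simp add: Kq)
          finally have xK: "?x ^ q \<le> K \<omega> ^ q" .
          have "?x \<le> K \<omega>"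
          proof (rule ccontr)
            assume "\<not> ?x \<le> K \<omega>"
            then have "K \<omega> ^ q < ?x ^ q" using q by (intro power_strict_mono) (auto simp: K_def)
            with xK show False by simp
          qed
          then show "norm (T n \<omega> - U \<omega>) \<le> K \<omega> * real n powr (- \<delta> / 2)"
            using n by (simp add: powr_minus field_simps)
        qed
      qed
    qed (auto simp: K_def)
  qed
  with U that show ?thesis by blast
qed

end

subsection \<open>Trajectories and noise\<close>

lemma exp_le_quadratic:
  fixes x :: real
  assumes "\<bar>x\<bar> \<le> 1"
  shows "exp x \<le> 1 + x + x\<^sup>2"
proof (cases "x \<ge> 0")
  case True
  then show ?thesis using assms exp_bound[of x] by simp
next
  case False
  define y where "y = - x"
  have y: "y \<ge> 0" "y \<le> 1" using False assms by (auto simp: y_def)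
  have "1 + y + y\<^sup>2 / 2 \<le> exp y" using y by (intro exp_lower_Taylor_quadratic)
  then have "inverse (exp y) \<le> inverse (1 + y + y\<^sup>2 / 2)"
    using y by (intro le_imp_inverse_le add_pos_nonneg) auto
  then have "exp x \<le> inverse (1 + y + y\<^sup>2 / 2)" by (simp add: y_def exp_minus)
  also have "\<dots> \<le> 1 - y + y\<^sup>2"
  proof -
    have "(1 - y + y\<^sup>2) * (1 + y + y\<^sup>2 / 2) = 1 + y\<^sup>2 / 2 + y ^ 3 / 2 + y ^ 4 / 2"
      by (simp add: field_simps power2_eq_square power3_eq_cube power4_eq_xxxx)
    also have "\<dots> \<ge> 1" using y by simp
    finally show ?thesis using y by (simp add: inverse_eq_divide divide_le_eq add_pos_nonneg)
  qed
  finally show ?thesis by (simp add: y_def)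
qed

lemma power_le_fact_mult_exp:
  fixes x :: real
  assumes "x \<ge> 0"
  shows "x ^ p \<le> fact p * exp x"
proof -
  have "sum (\<lambda>n. x ^ n /\<^sub>R fact n) {p} \<le> (\<Sum>n. x ^ n /\<^sub>R fact n)"
    using assms by (intro sum_le_suminf summable_exp_generic) auto
  then have "x ^ p / fact p \<le> exp x" by (simp add: exp_def divide_inverse mult.commute)
  then show ?thesis by (simp add: field_simps)
qed

text \<open>The variables to which this is applied take lists as values, for which no sigma-algebra
  is fixed; measurable fibres over the finite set \<open>S\<close> suffice. Measurability of
  \<open>f (Z \<omega>)\<close> is assumed because \<open>Z\<close> lies in \<open>S\<close> only
  almost surely.\<close>

lemma (in prob_space) expectation_finite_valued:
  fixes f :: "'z \<Rightarrow> 'c::{banach, second_countable_topology}"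
  assumes S: "finite S" and Z: "AE \<omega> in M. Z \<omega> \<in> S"
    and sets: "\<And>z. z \<in> S \<Longrightarrow> {\<omega> \<in> space M. Z \<omega> = z} \<in> events"
    and meas: "(\<lambda>\<omega>. f (Z \<omega>)) \<in> borel_measurable M"
  shows "integrable M (\<lambda>\<omega>. f (Z \<omega>))"
    and "expectation (\<lambda>\<omega>. f (Z \<omega>)) = (\<Sum>z\<in>S. prob {\<omega> \<in> space M. Z \<omega> = z} *\<^sub>R f z)"
proof -
  let ?h = "\<lambda>\<omega>. \<Sum>z\<in>S. indicator {\<omega> \<in> space M. Z \<omega> = z} \<omega> *\<^sub>R f z"
  have eq: "AE \<omega> in M. f (Z \<omega>) = ?h \<omega>"
    using Z AE_space
  proof eventually_elim
    case (elim \<omega>)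
    have "?h \<omega> = (\<Sum>z\<in>S. if Z \<omega> = z then f z else 0)"
      using elim by (intro sum.cong) (auto simp: indicator_def)
    then show ?case using elim S by simp
  qed
  have h: "has_bochner_integral M ?h (\<Sum>z\<in>S. prob {\<omega> \<in> space M. Z \<omega> = z} *\<^sub>R f z)"
    using sets by (intro has_bochner_integral_sum has_bochner_integral_scaleR_left
        has_bochner_integral_indicator) (auto simp: emeasure_eq_measure)
  have "has_bochner_integral M (\<lambda>\<omega>. f (Z \<omega>)) (\<Sum>z\<in>S. prob {\<omega> \<in> space M. Z \<omega> = z} *\<^sub>R f z)"
    using h has_bochner_integral_cong_AE[OF meas borel_measurable_has_bochner_integral[OF h] eq] by simp
  then show "integrable M (\<lambda>\<omega>. f (Z \<omega>))"
    "expectation (\<lambda>\<omega>. f (Z \<omega>)) = (\<Sum>z\<in>S. prob {\<omega> \<in> space M. Z \<omega> = z} *\<^sub>R f z)"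
    by (auto simp: has_bochner_integral_iff)
qed

section \<open>Finite trajectories and their transition probabilities\<close>

locale polya_chain =
  fixes M :: "'b measure" and X :: "nat \<Rightarrow> 'b \<Rightarrow> 'a::euclidean_space"
    and x1 :: 'a and w :: "nat \<Rightarrow> 'a" and l :: "nat \<Rightarrow> 'a \<Rightarrow> real"
  assumes process: "polya_process M X x1 w l"
begin

abbreviation "\<tau> \<equiv> tau1 x1 l"
abbreviation "A \<equiv> replacement w l"

definition mass :: "'a \<Rightarrow> real" where
  "mass x = (\<Sum>k=1..DIM('a). l k x)"

lemma data: "polya_data x1 w l"
  using process by (simp add: polya_process_def)

sublocale prob_space M
  using process by (simp add: polya_process_def)

lemma X_meas [measurable]: "n \<ge> 1 \<Longrightarrow> X n \<in> borel_measurable M"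
  using process by (simp add: polya_process_def)

lemma l_basis: "basis_of_forms {f. linear f} DIM('a) l"
  using data by (simp add: polya_data_def Let_def)

lemma l_linear: "k \<in> {1..DIM('a)} \<Longrightarrow> linear (l k)"
  using l_basis by (auto simp: basis_of_forms_def)

lemma l_x1_nonneg: "k \<in> {1..DIM('a)} \<Longrightarrow> l k x1 \<ge> 0"
  using data by (simp add: polya_data_def Let_def)

lemma mass_w: "k \<in> {1..DIM('a)} \<Longrightarrow> mass (w k) = 1"
  using data by (simp add: polya_data_def Let_def mass_def)

lemma l_w_nonneg: "k \<in> {1..DIM('a)} \<Longrightarrow> j \<in> {1..DIM('a)} \<Longrightarrow> k \<noteq> j \<Longrightarrow> l k (w j) \<ge> 0"
  using data by (simp add: polya_data_def Let_def)

lemma mass_linear: "linear mass"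
  unfolding mass_def using l_linear by (intro linear_compose_sum) auto

lemma A_linear: "linear A"
proof (rule linearI)
  show "A (x + y) = A x + A y" for x y
    unfolding replacement_def sum.distrib[symmetric]
    by (intro sum.cong refl) (simp add: linear_add[OF l_linear] scaleR_add_left)
  show "A (r *\<^sub>R x) = r *\<^sub>R A x" for r x
    unfolding replacement_def scaleR_sum_right
    by (intro sum.cong refl) (simp add: linear_scale[OF l_linear])
qed

lemma l_eq_0_imp: "(\<And>k. k \<in> {1..DIM('a)} \<Longrightarrow> l k x = 0) \<Longrightarrow> x = 0"
proof -
  assume *: "\<And>k. k \<in> {1..DIM('a)} \<Longrightarrow> l k x = 0"
  have lin: "linear (\<lambda>v. x \<bullet> v)" by (simp add: bounded_linear.linear bounded_linear_inner_right)
  from l_basis have "\<forall>g. linear g \<longrightarrow> (\<exists>c. \<forall>v. g v = (\<Sum>k=1..DIM('a). c k * l k v))"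
    by (simp add: basis_of_forms_def)
  from this[rule_format, OF lin] obtain c where "\<forall>v. x \<bullet> v = (\<Sum>k=1..DIM('a). c k * l k v)" by blast
  then have "x \<bullet> x = 0" using * by simp
  then show "x = 0" by simp
qed

lemma tau_pos: "\<tau> > 0"
proof -
  have "x1 \<noteq> 0" using data by (simp add: polya_data_def Let_def)
  then obtain k where "k \<in> {1..DIM('a)}" "l k x1 \<noteq> 0" using l_eq_0_imp by blast
  then show ?thesis unfolding tau1_def
    using l_x1_nonneg by (intro sum_pos2[of _ k]) (auto simp: less_le)
qed

text \<open>The past is kept as a list because the Markov property is given for whole finite
  trajectories and almost surely only finitely many of them occur. Lists count from 0, so entry
  \<open>i\<close> is \<open>X (Suc i)\<close>.\<close>

definition trajectory :: "nat \<Rightarrow> 'b \<Rightarrow> 'a list" where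
  "trajectory n \<omega> = map (\<lambda>i. X i \<omega>) [1..<Suc n]"

text \<open>Trajectories start at time 1, so the members of \<open>reachable n\<close> have length \<open>n + 1\<close>.\<close>

primrec reachable :: "nat \<Rightarrow> 'a list set" where
  "reachable 0 = {[x1]}"
| "reachable (Suc n) = (\<lambda>(ps, k). ps @ [last ps + w k]) ` (reachable n \<times> {1..DIM('a)})"

lemma finite_reachable: "finite (reachable n)"
  by (induction n) auto

lemma reachable_props:
  "ps \<in> reachable n \<Longrightarrow> length ps = Suc n \<and> ps \<noteq> [] \<and> mass (last ps) = real n + \<tau>"
proof (induction n arbitrary: ps)
  case 0
  then show ?case by (simp add: mass_def tau1_def)
next
  case (Suc n)
  then obtain qs k where q: "qs \<in> reachable n" "k \<in> {1..DIM('a)}" "ps = qs @ [last qs + w k]" by auto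
  show ?case using Suc.IH[OF q(1)] q mass_w[of k] by (simp add: linear_add[OF mass_linear])
qed

lemma trajectory_Suc: "trajectory (Suc n) \<omega> = trajectory n \<omega> @ [X (Suc n) \<omega>]"
  by (simp add: trajectory_def)

lemma length_trajectory [simp]: "length (trajectory n \<omega>) = n"
  by (simp add: trajectory_def)

lemma last_trajectory: "n \<ge> 1 \<Longrightarrow> last (trajectory n \<omega>) = X n \<omega>"
  by (cases n) (auto simp: trajectory_Suc)

lemma trajectory_nth: "i < n \<Longrightarrow> trajectory n \<omega> ! i = X (Suc i) \<omega>"
  by (simp add: trajectory_def del: upt_Suc)

lemma trajectory_eq_iff:
  "length ps = n \<Longrightarrow> trajectory n \<omega> = ps \<longleftrightarrow> (\<forall>i\<in>{1..n}. X i \<omega> = ps ! (i - 1))"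
proof
  assume "length ps = n" "\<forall>i\<in>{1..n}. X i \<omega> = ps ! (i - 1)"
  then show "trajectory n \<omega> = ps" by (intro nth_equalityI) (auto simp: trajectory_nth)
next
  assume ps: "length ps = n" "trajectory n \<omega> = ps"
  show "\<forall>i\<in>{1..n}. X i \<omega> = ps ! (i - 1)"
  proof
    fix i assume "i \<in> {1..n}"
    then show "X i \<omega> = ps ! (i - 1)" using trajectory_nth[of "i - 1" n \<omega>] ps by auto
  qed
qed

lemma trajectory_event: "{\<omega> \<in> space M. trajectory n \<omega> = ps} \<in> events"
proof (cases "length ps = n")
  case True
  have "{\<omega> \<in> space M. \<forall>i\<in>{1..n}. X i \<omega> = ps ! (i - 1)} \<in> events"
    by (intro sets.sets_Collect_finite_All) (auto intro!: borel_measurable_eq X_meas)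
  then show ?thesis using trajectory_eq_iff[OF True] by simp
next
  case False
  then have "{\<omega> \<in> space M. trajectory n \<omega> = ps} = {}" by auto
  then show ?thesis by (simp only: sets.empty_sets)
qed

lemma transition_event:
  "n \<ge> 1 \<Longrightarrow> {\<omega> \<in> space M. (trajectory n \<omega>, X (Suc n) \<omega>) = (ps, y)} \<in> events"
proof -
  have "{\<omega> \<in> space M. (trajectory n \<omega>, X (Suc n) \<omega>) = (ps, y)} = {\<omega> \<in> space M. trajectory (Suc n) \<omega> = ps @ [y]}"
    by (auto simp: trajectory_Suc)
  then show ?thesis using trajectory_event by simp
qed

lemma transition_prob:
  assumes n: "n \<ge> 1" and len: "length ps = n"
  shows "prob {\<omega> \<in> space M. (trajectory n \<omega>, X (Suc n) \<omega>) = (ps, y)}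
    = prob {\<omega> \<in> space M. trajectory n \<omega> = ps} *
      (\<Sum>k | k \<in> {1..DIM('a)} \<and> last ps + w k = y. l k (last ps) / (real n + \<tau> - 1))"
proof -
  have last: "ps ! (n - 1) = last ps" using len n by (simp add: last_conv_nth[of ps] flip: length_greater_0_conv)
  have sets: "{\<omega> \<in> space M. (trajectory n \<omega>, X (Suc n) \<omega>) = (ps, y)}
      = {\<omega> \<in> space M. (\<forall>i\<in>{1..n}. X i \<omega> = ps ! (i - 1)) \<and> X (n + 1) \<omega> = y}"
    using trajectory_eq_iff[OF len] by auto
  have "prob {\<omega> \<in> space M. (\<forall>i\<in>{1..n}. X i \<omega> = ps ! (i - 1)) \<and> X (n + 1) \<omega> = y}
      = prob {\<omega> \<in> space M. \<forall>i\<in>{1..n}. X i \<omega> = ps ! (i - 1)}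
          * (\<Sum>k | k \<in> {1..DIM('a)} \<and> y = ps ! (n - 1) + w k. l k (ps ! (n - 1)) / (real n + tau1 x1 l - 1))"
  proof -
    have "\<forall>n\<ge>1. \<forall>x y.
        measure M {\<omega> \<in> space M. (\<forall>i\<in>{1..n}. X i \<omega> = x i) \<and> X (n + 1) \<omega> = y}
        = measure M {\<omega> \<in> space M. \<forall>i\<in>{1..n}. X i \<omega> = x i}
          * (\<Sum>k | k \<in> {1..DIM('a)} \<and> y = x n + w k. l k (x n) / (real n + tau1 x1 l - 1))"
      using process unfolding polya_process_def by (elim conjE)
    from this[rule_format, OF n, of "\<lambda>i. ps ! (i - 1)" y] show ?thesis .
  qed
  moreover have "{\<omega> \<in> space M. \<forall>i\<in>{1..n}. X i \<omega> = ps ! (i - 1)} = {\<omega> \<in> space M. trajectory n \<omega> = ps}"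
    unfolding trajectory_eq_iff[OF len] ..
  moreover have "{k. k \<in> {1..DIM('a)} \<and> y = last ps + w k} = {k. k \<in> {1..DIM('a)} \<and> last ps + w k = y}"
    by auto
  ultimately show ?thesis unfolding sets last by (simp only:)
qed

lemma jump_probs_sum:
  "ps \<in> reachable n \<Longrightarrow> (\<Sum>k=1..DIM('a). l k (last ps) / (real (Suc n) + \<tau> - 1)) = 1"
proof -
  assume "ps \<in> reachable n"
  then have "mass (last ps) = real n + \<tau>" using reachable_props by blast
  then show ?thesis using tau_pos unfolding sum_divide_distrib[symmetric] mass_def[symmetric] by simp
qed

text \<open>The process is specified by probabilities of single trajectories only, so its support is
  found by summation: over each reachable past the one-step probabilities add up to 1, hence the
  finitely many continuations carry the whole mass.\<close>

lemma AE_transition: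
  assumes "AE \<omega> in M. trajectory (Suc n) \<omega> \<in> reachable n"
  shows "AE \<omega> in M. (trajectory (Suc n) \<omega>, X (Suc (Suc n)) \<omega>)
           \<in> (SIGMA ps:reachable n. (\<lambda>k. last ps + w k) ` {1..DIM('a)})"
proof -
  let ?S = "SIGMA ps:reachable n. (\<lambda>k. last ps + w k) ` {1..DIM('a)}"
  let ?Z = "\<lambda>\<omega>. (trajectory (Suc n) \<omega>, X (Suc (Suc n)) \<omega>)"
  have fin: "finite ?S" using finite_reachable by (intro finite_SigmaI) auto
  have U: "{\<omega> \<in> space M. ?Z \<omega> \<in> ?S} = (\<Union>z\<in>?S. {\<omega> \<in> space M. ?Z \<omega> = z})" by blast
  have ev: "{\<omega> \<in> space M. ?Z \<omega> = z} \<in> events" for z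
    using transition_event[of "Suc n" "fst z" "snd z"] by simp
  have meas: "{\<omega> \<in> space M. ?Z \<omega> \<in> ?S} \<in> events"
    unfolding U using fin ev by (intro sets.finite_UN) auto
  have "prob {\<omega> \<in> space M. ?Z \<omega> \<in> ?S} = (\<Sum>z\<in>?S. prob {\<omega> \<in> space M. ?Z \<omega> = z})"
    unfolding U using fin ev by (intro finite_measure_finite_Union) (auto simp: disjoint_family_on_def)
  also have "\<dots> = (\<Sum>ps\<in>reachable n. \<Sum>y\<in>(\<lambda>k. last ps + w k) ` {1..DIM('a)}. prob {\<omega> \<in> space M. ?Z \<omega> = (ps, y)})"
    by (subst sum.Sigma) (auto simp: finite_reachable case_prod_unfold prod_eq_iff)
  also have "\<dots> = (\<Sum>ps\<in>reachable n. prob {\<omega> \<in> space M. trajectory (Suc n) \<omega> = ps})"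
  proof (rule sum.cong)
    fix ps assume ps: "ps \<in> reachable n"
    have "(\<Sum>y\<in>(\<lambda>k. last ps + w k) ` {1..DIM('a)}. prob {\<omega> \<in> space M. ?Z \<omega> = (ps, y)})
       = prob {\<omega> \<in> space M. trajectory (Suc n) \<omega> = ps} *
          (\<Sum>y\<in>(\<lambda>k. last ps + w k) ` {1..DIM('a)}.
            \<Sum>k | k \<in> {1..DIM('a)} \<and> last ps + w k = y. l k (last ps) / (real (Suc n) + \<tau> - 1))"
      unfolding sum_distrib_left
      by (intro sum.cong refl, subst transition_prob) (use reachable_props[OF ps] in \<open>auto simp: sum_distrib_left\<close>)
    also have "(\<Sum>y\<in>(\<lambda>k. last ps + w k) ` {1..DIM('a)}.
            \<Sum>k | k \<in> {1..DIM('a)} \<and> last ps + w k = y. l k (last ps) / (real (Suc n) + \<tau> - 1)) = 1"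
      using jump_probs_sum[OF ps] by (subst sum.image_gen[symmetric]) auto
    finally show "(\<Sum>y\<in>(\<lambda>k. last ps + w k) ` {1..DIM('a)}. prob {\<omega> \<in> space M. ?Z \<omega> = (ps, y)})
       = prob {\<omega> \<in> space M. trajectory (Suc n) \<omega> = ps}" by simp
  qed simp
  also have "\<dots> = prob (\<Union>ps\<in>reachable n. {\<omega> \<in> space M. trajectory (Suc n) \<omega> = ps})"
    using finite_reachable trajectory_event
    by (intro finite_measure_finite_Union[symmetric]) (auto simp: disjoint_family_on_def)
  also have "(\<Union>ps\<in>reachable n. {\<omega> \<in> space M. trajectory (Suc n) \<omega> = ps})
      = {\<omega> \<in> space M. trajectory (Suc n) \<omega> \<in> reachable n}" by auto
  also have "prob \<dots> = 1"
  proof (subst prob_Collect_eq_1)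
    have "{\<omega> \<in> space M. trajectory (Suc n) \<omega> \<in> reachable n}
        = (\<Union>ps\<in>reachable n. {\<omega> \<in> space M. trajectory (Suc n) \<omega> = ps})" by auto
    then show "{\<omega> \<in> space M. trajectory (Suc n) \<omega> \<in> reachable n} \<in> events"
      using finite_reachable trajectory_event by (simp only:) (intro sets.finite_UN)
  qed (use assms in simp)
  finally show ?thesis using meas by (simp add: prob_Collect_eq_1)
qed

lemma AE_reachable: "AE \<omega> in M. trajectory (Suc n) \<omega> \<in> reachable n"
proof (induction n)
  case 0
  have "AE \<omega> in M. X 1 \<omega> = x1" using process by (simp add: polya_process_def)
  then show ?case by (simp add: trajectory_def)
next
  case (Suc n)
  show ?case using AE_transition[OF Suc]
    by eventually_elim (auto simp: trajectory_Suc[of "Suc n"] image_iff)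
qed

lemmas AE_next = AE_transition[OF AE_reachable]

lemma AE_step: "AE \<omega> in M. \<forall>n\<ge>1. X (Suc n) \<omega> - X n \<omega> \<in> w ` {1..DIM('a)}"
  unfolding AE_all_countable
proof
  fix n
  show "AE \<omega> in M. 1 \<le> n \<longrightarrow> X (Suc n) \<omega> - X n \<omega> \<in> w ` {1..DIM('a)}"
  proof (cases n)
    case (Suc m)
    show ?thesis using AE_next[of m]
      by eventually_elim (auto simp: Suc last_trajectory)
  qed simp
qed

lemma AE_mass: "AE \<omega> in M. \<forall>n\<ge>1. mass (X n \<omega>) = real n + \<tau> - 1"
  unfolding AE_all_countable
proof
  fix n
  show "AE \<omega> in M. 1 \<le> n \<longrightarrow> mass (X n \<omega>) = real n + \<tau> - 1"
  proof (cases n)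
    case (Suc m)
    show ?thesis using AE_reachable[of m]
    proof eventually_elim
      case (elim \<omega>)
      then show ?case using reachable_props[OF elim] last_trajectory[of "Suc m" \<omega>] by (simp add: Suc)
    qed
  qed simp
qed

lemma AE_start: "AE \<omega> in M. X 1 \<omega> = x1"
  using process by (simp add: polya_process_def)

text \<open>The integrated form of conditioning on the past. Since \<open>F\<close> may depend on
  the whole trajectory, it replaces conditional expectations in the martingale arguments. Both
  measurability assumptions concern null sets, outside of which all variables are finitely
  valued.\<close>

lemma expectation_transition:
  fixes F :: "'a list \<Rightarrow> 'a \<Rightarrow> 'c::{banach, second_countable_topology}"
  assumes n: "n \<ge> 1"
    and m1: "(\<lambda>\<omega>. F (trajectory n \<omega>) (X (Suc n) \<omega>)) \<in> borel_measurable M"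
    and m2: "(\<lambda>\<omega>. \<Sum>k=1..DIM('a). (l k (X n \<omega>) / (real n + \<tau> - 1)) *\<^sub>R F (trajectory n \<omega>) (X n \<omega> + w k)) \<in> borel_measurable M"
  shows "integrable M (\<lambda>\<omega>. F (trajectory n \<omega>) (X (Suc n) \<omega>))"
    and "expectation (\<lambda>\<omega>. F (trajectory n \<omega>) (X (Suc n) \<omega>)) =
      expectation (\<lambda>\<omega>. \<Sum>k=1..DIM('a). (l k (X n \<omega>) / (real n + \<tau> - 1)) *\<^sub>R F (trajectory n \<omega>) (X n \<omega> + w k))"
proof -
  obtain m where m: "n = Suc m" using n by (cases n) auto
  let ?Y = "\<lambda>ps. (\<lambda>k. last ps + w k) ` {1..DIM('a)}"
  let ?S = "SIGMA ps:reachable m. ?Y ps"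
  let ?Z = "\<lambda>\<omega>. (trajectory n \<omega>, X (Suc n) \<omega>)"
  let ?p = "\<lambda>ps k. l k (last ps) / (real n + \<tau> - 1)"
  have fin: "finite ?S" using finite_reachable by (intro finite_SigmaI) auto
  have ev: "{\<omega> \<in> space M. ?Z \<omega> = z} \<in> events" for z
    using transition_event[OF n, of "fst z" "snd z"] by simp
  have AE: "AE \<omega> in M. ?Z \<omega> \<in> ?S" using AE_next[of m] by (simp add: m)
  note E = expectation_finite_valued[OF fin AE ev, of "case_prod F"]
  show "integrable M (\<lambda>\<omega>. F (trajectory n \<omega>) (X (Suc n) \<omega>))" using E(1) m1 by simp
  have "expectation (\<lambda>\<omega>. F (trajectory n \<omega>) (X (Suc n) \<omega>)) = (\<Sum>z\<in>?S. prob {\<omega> \<in> space M. ?Z \<omega> = z} *\<^sub>R case_prod F z)"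
    using E(2) m1 by simp
  also have "\<dots> = (\<Sum>ps\<in>reachable m. \<Sum>y\<in>?Y ps. prob {\<omega> \<in> space M. ?Z \<omega> = (ps, y)} *\<^sub>R F ps y)"
    by (subst sum.Sigma) (auto simp: finite_reachable case_prod_unfold prod_eq_iff)
  also have "\<dots> = (\<Sum>ps\<in>reachable m. prob {\<omega> \<in> space M. trajectory n \<omega> = ps} *\<^sub>R
      (\<Sum>k=1..DIM('a). ?p ps k *\<^sub>R F ps (last ps + w k)))"
  proof (rule sum.cong)
    fix ps assume ps: "ps \<in> reachable m"
    have "(\<Sum>y\<in>?Y ps. prob {\<omega> \<in> space M. ?Z \<omega> = (ps, y)} *\<^sub>R F ps y)
      = (\<Sum>y\<in>?Y ps. prob {\<omega> \<in> space M. trajectory n \<omega> = ps} *\<^sub>R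
          (\<Sum>k | k \<in> {1..DIM('a)} \<and> last ps + w k = y. ?p ps k *\<^sub>R F ps (last ps + w k)))"
    proof (rule sum.cong)
      fix y
      have "prob {\<omega> \<in> space M. ?Z \<omega> = (ps, y)} = prob {\<omega> \<in> space M. trajectory n \<omega> = ps} *
         (\<Sum>k | k \<in> {1..DIM('a)} \<and> last ps + w k = y. ?p ps k)"
        using transition_prob[OF n, of ps y] reachable_props[OF ps] by (simp add: m)
      moreover have "(\<Sum>k | k \<in> {1..DIM('a)} \<and> last ps + w k = y. ?p ps k *\<^sub>R F ps (last ps + w k))
        = (\<Sum>k | k \<in> {1..DIM('a)} \<and> last ps + w k = y. ?p ps k) *\<^sub>R F ps y"
        by (simp add: scaleR_sum_left)
      ultimately show "prob {\<omega> \<in> space M. ?Z \<omega> = (ps, y)} *\<^sub>R F ps y = prob {\<omega> \<in> space M. trajectory n \<omega> = ps} *\<^sub>R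
          (\<Sum>k | k \<in> {1..DIM('a)} \<and> last ps + w k = y. ?p ps k *\<^sub>R F ps (last ps + w k))" by simp
    qed simp
    \<comment> \<open>Undoes the grouping by target points, which is needed because different
      indices may have equal vectors \<open>w k\<close>.\<close>
    also have "\<dots> = prob {\<omega> \<in> space M. trajectory n \<omega> = ps} *\<^sub>R
      (\<Sum>k=1..DIM('a). ?p ps k *\<^sub>R F ps (last ps + w k))"
      by (subst scaleR_sum_right[symmetric], subst sum.image_gen[symmetric]) auto
    finally show "(\<Sum>y\<in>?Y ps. prob {\<omega> \<in> space M. ?Z \<omega> = (ps, y)} *\<^sub>R F ps y)
      = prob {\<omega> \<in> space M. trajectory n \<omega> = ps} *\<^sub>R
      (\<Sum>k=1..DIM('a). ?p ps k *\<^sub>R F ps (last ps + w k))" .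
  qed simp
  also have "\<dots> = expectation (\<lambda>\<omega>. \<Sum>k=1..DIM('a). ?p (trajectory n \<omega>) k *\<^sub>R F (trajectory n \<omega>) (last (trajectory n \<omega>) + w k))"
    using AE_reachable[of m] m2 last_trajectory[OF n]
    by (intro expectation_finite_valued(2)[OF finite_reachable[of m], where Z="trajectory n" and
          f="\<lambda>ps. \<Sum>k=1..DIM('a). ?p ps k *\<^sub>R F ps (last ps + w k)", symmetric] trajectory_event)
       (auto simp: m)
  also have "\<dots> = expectation (\<lambda>\<omega>. \<Sum>k=1..DIM('a). (l k (X n \<omega>) / (real n + \<tau> - 1)) *\<^sub>R F (trajectory n \<omega>) (X n \<omega> + w k))"
    using last_trajectory[OF n] by simp
  finally show "expectation (\<lambda>\<omega>. F (trajectory n \<omega>) (X (Suc n) \<omega>)) =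
      expectation (\<lambda>\<omega>. \<Sum>k=1..DIM('a). (l k (X n \<omega>) / (real n + \<tau> - 1)) *\<^sub>R F (trajectory n \<omega>) (X n \<omega> + w k))" .
qed

end

lemma linear_borel_measurable:
  fixes f :: "'a::euclidean_space \<Rightarrow> 'b::euclidean_space"
  assumes "linear f" "g \<in> borel_measurable M"
  shows "(\<lambda>\<omega>. f (g \<omega>)) \<in> borel_measurable M"
  using assms by (intro borel_measurable_continuous_on[of f] linear_continuous_on)
    (auto simp: linear_conv_bounded_linear)

text \<open>The four unit multipliers produce the real and imaginary part of \<open>z\<close> with
  both signs, so moments of a complex martingale reduce to exponential moments of real ones.\<close>

lemma complex_power_le_exp:
  assumes "s \<ge> 0"
  shows "(s * norm z) ^ p \<le> 2 ^ p * fact p * (\<Sum>\<theta>\<in>{1, -1, \<i>, -\<i>}. exp (s * Re (\<theta> * z)))"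
proof -
  have e: "\<bar>x\<bar> ^ p \<le> fact p * (exp x + exp (- x))" for x :: real
  proof -
    have "\<bar>x\<bar> ^ p \<le> fact p * exp \<bar>x\<bar>" by (rule power_le_fact_mult_exp) simp
    also have "exp \<bar>x\<bar> \<le> exp x + exp (- x)" by (simp add: abs_if)
    finally show ?thesis by simp
  qed
  have "(s * norm z) ^ p \<le> (\<bar>s * Re z\<bar> + \<bar>s * Im z\<bar>) ^ p"
    using assms cmod_le[of z] by (intro power_mono) (auto simp: abs_mult distrib_left[symmetric] mult_left_mono)
  also have "\<dots> \<le> 2 ^ p * (\<bar>s * Re z\<bar> ^ p + \<bar>s * Im z\<bar> ^ p)" by (rule add_power_le) auto
  also have "\<dots> \<le> 2 ^ p * (fact p * (exp (s * Re z) + exp (- (s * Re z))) + fact p * (exp (s * Im z) + exp (- (s * Im z))))"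
    by (intro mult_left_mono add_mono e) auto
  also have "\<dots> = 2 ^ p * fact p * (\<Sum>\<theta>\<in>{1, -1, \<i>, -\<i>}. exp (s * Re (\<theta> * z)))"
    by (subst sum.insert, simp, simp add: complex_eq_iff)+ (simp add: algebra_simps)
  finally show ?thesis .
qed

section \<open>The martingale noise and its weighted sums\<close>

context polya_chain
begin

definition noise :: "nat \<Rightarrow> 'b \<Rightarrow> 'a" where
  "noise n \<omega> = X (Suc n) \<omega> - X n \<omega> - (1 / (real n + \<tau> - 1)) *\<^sub>R A (X n \<omega>)"

lemma noise_meas [measurable]: "n \<ge> 1 \<Longrightarrow> noise n \<in> borel_measurable M"
  unfolding noise_def using linear_borel_measurable[OF A_linear X_meas] by measurable

lemma denominator_pos: "n \<ge> 1 \<Longrightarrow> real n + \<tau> - 1 > 0"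
  using tau_pos by simp

lemma AE_norm_le:
  obtains C where "C > 0" "AE \<omega> in M. \<forall>n\<ge>1. norm (X n \<omega>) \<le> C * real n"
proof -
  define V where "V = (\<Sum>k=1..DIM('a). norm (w k))"
  have V: "norm (w k) \<le> V" if "k \<in> {1..DIM('a)}" for k
    unfolding V_def using that by (intro member_le_sum) auto
  have V0: "V \<ge> 0" by (simp add: V_def sum_nonneg)
  show ?thesis
  proof (rule that[of "norm x1 + V + 1"])
    show "AE \<omega> in M. \<forall>n\<ge>1. norm (X n \<omega>) \<le> (norm x1 + V + 1) * real n"
      using AE_step AE_start
    proof eventually_elim
      case (elim \<omega>)
      have "norm (X n \<omega>) \<le> norm x1 + V * real n" if "n \<ge> 1" for n
        using that
      proof (induction n rule: dec_induct)
        case base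
        then show ?case using elim V0 by simp
      next
        case (step n)
        obtain k where "k \<in> {1..DIM('a)}" "X (Suc n) \<omega> - X n \<omega> = w k" using elim(1) step(1) by blast
        then have "norm (X (Suc n) \<omega>) \<le> norm (X n \<omega>) + V"
          using norm_triangle_ineq[of "X n \<omega>" "w k"] V[of k] by (simp add: algebra_simps)
        then show ?case using step by (simp add: algebra_simps)
      qed
      moreover have "norm x1 + V * real n \<le> (norm x1 + V + 1) * real n" if "n \<ge> 1" for n
        using that mult_left_mono[of 1 "real n" "norm x1"] by (simp add: algebra_simps)
      ultimately show ?case by (meson order_trans)
    qed
    show "norm x1 + V + 1 > 0" using V0 by (simp add: add_nonneg_pos)
  qed
qed

lemma AE_noise_bounded:
  obtains B where "B > 0" "AE \<omega> in M. \<forall>n\<ge>1. norm (noise n \<omega>) \<le> B"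
proof -
  obtain C where C: "C > 0" "AE \<omega> in M. \<forall>n\<ge>1. norm (X n \<omega>) \<le> C * real n" using AE_norm_le by blast
  obtain a where a: "a > 0" "\<And>x. norm (A x) \<le> norm x * a"
    using bounded_linear.pos_bounded[of A] A_linear by (auto simp: linear_conv_bounded_linear)
  define V where "V = (\<Sum>k=1..DIM('a). norm (w k))"
  have V: "norm (w k) \<le> V" if "k \<in> {1..DIM('a)}" for k
    unfolding V_def using that by (intro member_le_sum) auto
  have V0: "V \<ge> 0" by (simp add: V_def sum_nonneg)
  \<comment> \<open>For \<open>n \<ge> 1\<close> the denominator \<open>n + \<tau> - 1\<close> is at
    least \<open>min 1 \<tau> * n\<close>, also when \<open>\<tau> < 1\<close> and it falls below
    \<open>n\<close>.\<close>
  define t where "t = min 1 \<tau>"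
  have t: "t > 0" "t \<le> 1" "t \<le> \<tau>" using tau_pos by (auto simp: t_def)
  show ?thesis
  proof (rule that[of "V + a * C / t"])
    show "V + a * C / t > 0" using V0 a C t by (simp add: add_nonneg_pos)
    show "AE \<omega> in M. \<forall>n\<ge>1. norm (noise n \<omega>) \<le> V + a * C / t"
      using AE_step C(2)
    proof eventually_elim
      case (elim \<omega>)
      show ?case
      proof (intro allI impI)
        fix n :: nat assume n: "n \<ge> 1"
        let ?d = "real n + \<tau> - 1"
        have d: "?d > 0" using denominator_pos[OF n] .
        have "t * real n \<le> ?d" using t n mult_right_mono[of t 1 "real n - 1"] by (simp add: algebra_simps)
        then have "real n / ?d \<le> 1 / t" using t d by (simp add: field_simps)
        then have nd: "a * C * (real n / ?d) \<le> a * C * (1 / t)" using a C by (intro mult_left_mono) auto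
        have "norm (X n \<omega>) * a \<le> C * real n * a" using elim(2) n a(1) by (intro mult_right_mono) auto
        with a(2)[of "X n \<omega>"] have "norm (A (X n \<omega>)) \<le> C * real n * a" by (rule order_trans)
        then have "norm ((1 / ?d) *\<^sub>R A (X n \<omega>)) \<le> (1 / ?d) * (C * real n * a)"
          using d by (simp add: divide_right_mono)
        also have "\<dots> \<le> a * C / t" using nd by (simp add: mult.commute mult.left_commute)
        finally have 1: "norm ((1 / ?d) *\<^sub>R A (X n \<omega>)) \<le> a * C / t" .
        obtain k where "k \<in> {1..DIM('a)}" "X (Suc n) \<omega> - X n \<omega> = w k" using elim(1) n by blast
        then show "norm (noise n \<omega>) \<le> V + a * C / t"
          using 1 V[of k] norm_triangle_ineq4[of "w k" "(1 / ?d) *\<^sub>R A (X n \<omega>)"] by (simp add: noise_def)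
      qed
    qed
  qed
qed

text \<open>The martingale difference property, phrased as orthogonality to every function
  \<open>g\<close> of the past.\<close>

lemma noise_mean:
  fixes g :: "'a list \<Rightarrow> real" and \<phi> :: "'a \<Rightarrow> real"
  assumes n: "n \<ge> 1" and g: "(\<lambda>\<omega>. g (trajectory n \<omega>)) \<in> borel_measurable M" and \<phi>: "linear \<phi>"
  shows "integrable M (\<lambda>\<omega>. g (trajectory n \<omega>) * \<phi> (noise n \<omega>))"
    and "expectation (\<lambda>\<omega>. g (trajectory n \<omega>) * \<phi> (noise n \<omega>)) = 0"
proof -
  let ?d = "real n + \<tau> - 1"
  define F where "F ps y = g ps * \<phi> (y - last ps - (1 / ?d) *\<^sub>R A (last ps))" for ps y
  have F: "F (trajectory n \<omega>) (X (Suc n) \<omega>) = g (trajectory n \<omega>) * \<phi> (noise n \<omega>)" for \<omega>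
    by (simp add: F_def noise_def last_trajectory[OF n])
  have m1: "(\<lambda>\<omega>. F (trajectory n \<omega>) (X (Suc n) \<omega>)) \<in> borel_measurable M"
    unfolding F using g linear_borel_measurable[OF \<phi> noise_meas[OF n]] by measurable
  have Fk: "F (trajectory n \<omega>) (X n \<omega> + w k) = g (trajectory n \<omega>) * \<phi> (w k - (1 / ?d) *\<^sub>R A (X n \<omega>))" for \<omega> k
    by (simp add: F_def last_trajectory[OF n])
  have mA: "(\<lambda>\<omega>. A (X n \<omega>)) \<in> borel_measurable M" by (rule linear_borel_measurable[OF A_linear X_meas[OF n]])
  have m\<phi>: "(\<lambda>\<omega>. \<phi> (w k - (1 / ?d) *\<^sub>R A (X n \<omega>))) \<in> borel_measurable M" for k
    by (rule linear_borel_measurable[OF \<phi>]) (use mA in measurable)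
  have ml: "(\<lambda>\<omega>. l k (X n \<omega>)) \<in> borel_measurable M" if "k \<in> {1..DIM('a)}" for k
    by (rule linear_borel_measurable[OF l_linear[OF that] X_meas[OF n]])
  have m2: "(\<lambda>\<omega>. \<Sum>k=1..DIM('a). (l k (X n \<omega>) / ?d) *\<^sub>R F (trajectory n \<omega>) (X n \<omega> + w k)) \<in> borel_measurable M"
    unfolding Fk using g m\<phi> ml
    by (intro borel_measurable_sum borel_measurable_scaleR borel_measurable_times borel_measurable_divide borel_measurable_const) auto
  show "integrable M (\<lambda>\<omega>. g (trajectory n \<omega>) * \<phi> (noise n \<omega>))"
    using expectation_transition(1)[OF n m1 m2] unfolding F .
  \<comment> \<open>The mass identity makes the jump weights \<open>l k (X n \<omega>) / ?d\<close>
    add up to 1, and their mean of the vectors \<open>w k\<close> is exactly the drift subtracted in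
    \<open>noise\<close>.\<close>
  have "AE \<omega> in M. (\<Sum>k=1..DIM('a). (l k (X n \<omega>) / ?d) *\<^sub>R F (trajectory n \<omega>) (X n \<omega> + w k)) = 0"
    using AE_mass
  proof eventually_elim
    case (elim \<omega>)
    have p1: "(\<Sum>k=1..DIM('a). l k (X n \<omega>) / ?d) = 1"
      using elim n denominator_pos[OF n] by (simp add: mass_def sum_divide_distrib[symmetric])
    have "(\<Sum>k=1..DIM('a). (l k (X n \<omega>) / ?d) *\<^sub>R F (trajectory n \<omega>) (X n \<omega> + w k))
        = g (trajectory n \<omega>) * \<phi> (\<Sum>k=1..DIM('a). (l k (X n \<omega>) / ?d) *\<^sub>R (w k - (1 / ?d) *\<^sub>R A (X n \<omega>)))"
      unfolding Fk linear_sum[OF \<phi>] linear_scale[OF \<phi>] by (simp add: sum_distrib_left mult.left_commute)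
    also have "(\<Sum>k=1..DIM('a). (l k (X n \<omega>) / ?d) *\<^sub>R (w k - (1 / ?d) *\<^sub>R A (X n \<omega>)))
       = (1 / ?d) *\<^sub>R A (X n \<omega>) - (\<Sum>k=1..DIM('a). l k (X n \<omega>) / ?d) *\<^sub>R ((1 / ?d) *\<^sub>R A (X n \<omega>))"
      unfolding scaleR_diff_right sum_subtractf scaleR_sum_left
      by (simp add: replacement_def scaleR_sum_right)
    also have "\<dots> = 0" unfolding p1 by simp
    finally show ?case by (simp add: linear_0[OF \<phi>])
  qed
  then have "expectation (\<lambda>\<omega>. \<Sum>k=1..DIM('a). (l k (X n \<omega>) / ?d) *\<^sub>R F (trajectory n \<omega>) (X n \<omega> + w k)) = 0"
    by (rule integral_eq_zero_AE)
  then show "expectation (\<lambda>\<omega>. g (trajectory n \<omega>) * \<phi> (noise n \<omega>)) = 0"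
    using expectation_transition(2)[OF n m1 m2] unfolding F by simp
qed

text \<open>Azuma's argument: \<open>exp x \<le> 1 + x + x\<^sup>2\<close> for \<open>\<bar>x\<bar> \<le> 1\<close>, and the linear term has conditional mean zero.\<close>

lemma exp_moment_bound:
  fixes \<phi> :: "nat \<Rightarrow> 'a \<Rightarrow> real"
  assumes B: "AE \<omega> in M. \<forall>n\<ge>1. norm (noise n \<omega>) \<le> B"
    and \<phi>: "\<And>j. linear (\<phi> j)" "\<And>j x. j \<ge> m \<Longrightarrow> norm x \<le> B \<Longrightarrow> \<bar>\<phi> j x\<bar> \<le> c j"
    and c: "\<And>j. j \<ge> m \<Longrightarrow> c j \<le> 1" and m: "m \<ge> 1" and n: "n \<ge> m"
  shows "integrable M (\<lambda>\<omega>. exp (\<Sum>j=m..<n. \<phi> j (noise j \<omega>))) \<and>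
    expectation (\<lambda>\<omega>. exp (\<Sum>j=m..<n. \<phi> j (noise j \<omega>))) \<le> exp (\<Sum>j=m..<n. (c j)\<^sup>2)"
  using n
proof (induction n rule: dec_induct)
  case base
  then show ?case by (simp add: prob_space)
next
  case (step n)
  have n1: "n \<ge> 1" using step m by simp
  let ?S = "\<lambda>n \<omega>. \<Sum>j=m..<n. \<phi> j (noise j \<omega>)"
  have Sm: "?S k \<in> borel_measurable M" for k
    using m by (intro borel_measurable_sum linear_borel_measurable[OF \<phi>(1)] noise_meas) auto
  have int: "integrable M (\<lambda>\<omega>. exp (?S k \<omega>))" for k
  proof (rule integrable_const_bound[of _ "exp (\<Sum>j=m..<k. c j)"])
    show "AE \<omega> in M. norm (exp (?S k \<omega>)) \<le> exp (\<Sum>j=m..<k. c j)"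
      using B
    proof eventually_elim
      case (elim \<omega>)
      have "?S k \<omega> \<le> (\<Sum>j=m..<k. c j)"
      proof (rule sum_mono)
        fix j assume "j \<in> {m..<k}"
        then show "\<phi> j (noise j \<omega>) \<le> c j" using \<phi>(2)[of j "noise j \<omega>"] elim m by auto
      qed
      then show ?case by simp
    qed
  qed (use Sm in measurable)
  \<comment> \<open>Exhibits the previous exponential as a function of the past: in a list counted
    from 0, \<open>noise j\<close> is read off the entries \<open>j\<close> and
    \<open>j - 1\<close>, and \<open>j < n\<close> keeps both inside the trajectory of length
    \<open>n\<close>.\<close>
  define G where "G ps = exp (\<Sum>j=m..<n. \<phi> j (ps ! j - ps ! (j - 1) - (1 / (real j + \<tau> - 1)) *\<^sub>R A (ps ! (j - 1))))" for ps
  have G: "G (trajectory n \<omega>) = exp (?S n \<omega>)" for \<omega>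
  proof -
    have "\<phi> j (trajectory n \<omega> ! j - trajectory n \<omega> ! (j - 1) - (1 / (real j + \<tau> - 1)) *\<^sub>R A (trajectory n \<omega> ! (j - 1))) = \<phi> j (noise j \<omega>)"
      if "j \<in> {m..<n}" for j
    proof -
      have "j < n" "j - 1 < n" "Suc (j - 1) = j" using that m by auto
      then show ?thesis using trajectory_nth[of j n \<omega>] trajectory_nth[of "j - 1" n \<omega>] by (simp only: noise_def)
    qed
    then show ?thesis unfolding G_def by (intro arg_cong[of _ _ exp] sum.cong) auto
  qed
  have Gm: "(\<lambda>\<omega>. G (trajectory n \<omega>)) \<in> borel_measurable M" unfolding G using Sm by measurable
  note N = noise_mean[OF n1 Gm \<phi>(1)[of n], unfolded G]
  have le: "AE \<omega> in M. exp (?S (Suc n) \<omega>) \<le> (1 + (c n)\<^sup>2) * exp (?S n \<omega>) + exp (?S n \<omega>) * \<phi> n (noise n \<omega>)"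
    using B
  proof eventually_elim
    case (elim \<omega>)
    let ?x = "\<phi> n (noise n \<omega>)"
    have x: "\<bar>?x\<bar> \<le> c n" using \<phi>(2)[of n "noise n \<omega>"] elim n1 step by simp
    then have x1: "\<bar>?x\<bar> \<le> 1" using c[of n] step by simp
    have "?x\<^sup>2 \<le> (c n)\<^sup>2" using x power_mono[of "\<bar>?x\<bar>" "c n" 2] by simp
    then have "exp ?x \<le> 1 + ?x + (c n)\<^sup>2" using exp_le_quadratic[OF x1] by simp
    then have "exp (?S n \<omega>) * exp ?x \<le> exp (?S n \<omega>) * (1 + ?x + (c n)\<^sup>2)" by (intro mult_left_mono) auto
    then show ?case using step by (simp add: exp_add[symmetric] algebra_simps)
  qed
  have "expectation (\<lambda>\<omega>. exp (?S (Suc n) \<omega>))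
      \<le> expectation (\<lambda>\<omega>. (1 + (c n)\<^sup>2) * exp (?S n \<omega>) + exp (?S n \<omega>) * \<phi> n (noise n \<omega>))"
  proof (rule integral_mono_AE)
    show "integrable M (\<lambda>\<omega>. (1 + (c n)\<^sup>2) * exp (?S n \<omega>) + exp (?S n \<omega>) * \<phi> n (noise n \<omega>))"
      by (intro Bochner_Integration.integrable_add Bochner_Integration.integrable_mult_right int N(1))
  qed (rule int, rule le)
  also have "\<dots> = (1 + (c n)\<^sup>2) * expectation (\<lambda>\<omega>. exp (?S n \<omega>))"
    using int[of n] N by (simp add: Bochner_Integration.integral_add)
  also have "\<dots> \<le> exp ((c n)\<^sup>2) * exp (\<Sum>j=m..<n. (c j)\<^sup>2)"
    using step by (intro mult_mono exp_ge_add_one_self) (auto intro!: integral_nonneg_AE)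
  also have "\<dots> = exp (\<Sum>j=m..<Suc n. (c j)\<^sup>2)" using step by (simp add: exp_add[symmetric] add.commute)
  finally show ?case using int[of "Suc n"] by blast
qed

text \<open>Let \<open>\<delta> = \<sigma> - 1/2\<close>. The squared coefficients after time
  \<open>m\<close> sum to order \<open>m powr (- 2 * \<delta>)\<close>, so
  \<open>m powr \<delta> * (T n - T m)\<close>, divided by a suitable constant, has exponential
  moments bounded uniformly in \<open>n \<ge> m\<close>. Hence its moments of order \<open>p\<close>
  decay like \<open>m powr (- \<delta> * p)\<close>, as \<open>moment_cauchy_limit\<close> requires;
  that lemma keeps half of the rate.\<close>

lemma martingale_transform_limit:
  fixes f :: "'a \<times> 'a \<Rightarrow> complex" and c :: "nat \<Rightarrow> complex"
  assumes f: "\<And>r x. f (cembed (r *\<^sub>R x)) = of_real r * f (cembed x)"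
      "\<And>x y. f (cembed (x + y)) = f (cembed x) + f (cembed y)"
    and \<sigma>: "\<sigma> > 1/2" and c: "\<And>j. j \<ge> 1 \<Longrightarrow> norm (c j) \<le> b * real j powr (- \<sigma>)"
  obtains U where "U \<in> borel_measurable M"
    "dominated M (\<lambda>n. real n powr (- (\<sigma> - 1/2) / 2)) (\<lambda>n \<omega>. (\<Sum>j=1..<n. c j * f (cembed (noise j \<omega>))) - U \<omega>)"
proof -
  define \<delta> where "\<delta> = \<sigma> - 1/2"
  have \<delta>: "\<delta> > 0" using \<sigma> by (simp add: \<delta>_def)
  have flin: "linear (\<lambda>x. f (cembed x))" by (rule linearI) (simp_all add: f scaleR_conv_of_real)
  then obtain \<kappa> where \<kappa>: "\<kappa> > 0" "\<And>x. norm (f (cembed x)) \<le> norm x * \<kappa>"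
    using bounded_linear.pos_bounded[of "\<lambda>x. f (cembed x)"] by (auto simp: linear_conv_bounded_linear)
  obtain B where B: "B > 0" "AE \<omega> in M. \<forall>n\<ge>1. norm (noise n \<omega>) \<le> B" using AE_noise_bounded by blast
  have b: "b \<ge> 0" using order_trans[OF norm_ge_zero c[of 1]] by simp
  \<comment> \<open>Dividing by \<open>H\<close> bounds the increments by \<open>d j\<close> below,
    which is at most 1 as Azuma's argument demands; the summand 1 keeps the divisor positive even if
    \<open>b = 0\<close>.\<close>
  define H where "H = b * \<kappa> * B + 1"
  have H: "H > 0" "b * \<kappa> * B \<le> H" using b \<kappa> B by (auto simp: H_def add_nonneg_pos)
  \<comment> \<open>A bound for the sum of the \<open>(d j)^2\<close>: 1 for the term
    \<open>j = m\<close>, the rest for the tail estimated by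
    \<open>sum_powr_tail_le\<close>.\<close>
  define E0 where "E0 = 1 + 1 / (2 * \<sigma> - 1)"
  define T where "T n \<omega> = (\<Sum>j=1..<n. c j * f (cembed (noise j \<omega>)))" for n \<omega>
  have fm: "(\<lambda>\<omega>. f (cembed (noise j \<omega>))) \<in> borel_measurable M" if "j \<ge> 1" for j
    by (rule linear_borel_measurable[OF flin noise_meas[OF that]])
  have Tm[measurable]: "T n \<in> borel_measurable M" for n
    unfolding T_def using fm by (intro borel_measurable_sum borel_measurable_times) auto
  have Tdiff: "T n \<omega> - T m \<omega> = (\<Sum>j=m..<n. c j * f (cembed (noise j \<omega>)))" if "1 \<le> m" "m \<le> n" for m n \<omega>
    unfolding T_def using sum_diff_nat_ivl[OF that, of "\<lambda>j. c j * f (cembed (noise j \<omega>))"] by simp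
  have expb: "integrable M (\<lambda>\<omega>. exp (real m powr \<delta> / H * Re (\<theta> * (T n \<omega> - T m \<omega>)))) \<and>
      expectation (\<lambda>\<omega>. exp (real m powr \<delta> / H * Re (\<theta> * (T n \<omega> - T m \<omega>)))) \<le> exp E0"
    if m: "1 \<le> m" and n: "m \<le> n" and \<theta>: "norm \<theta> = 1" for m n \<theta>
  proof -
    let ?s = "real m powr \<delta> / H"
    define \<phi> where "\<phi> j x = ?s * Re (\<theta> * (c j * f (cembed x)))" for j x
    define d where "d j = real m powr \<delta> * real j powr (- \<sigma>)" for j
    have lin: "linear (\<phi> j)" for j
      unfolding \<phi>_def by (rule linearI) (simp_all add: f algebra_simps)
    have bound: "\<bar>\<phi> j x\<bar> \<le> d j" if "j \<ge> m" "norm x \<le> B" for j x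
    proof -
      have "\<bar>Re (\<theta> * (c j * f (cembed x)))\<bar> \<le> norm (\<theta> * (c j * f (cembed x)))" by (rule abs_Re_le_cmod)
      also have "\<dots> = norm (c j) * norm (f (cembed x))" using \<theta> by (simp add: norm_mult)
      also have "\<dots> \<le> (b * real j powr (- \<sigma>)) * (B * \<kappa>)"
      proof (rule mult_mono)
        show "norm (c j) \<le> b * real j powr (- \<sigma>)" using c[of j] that m by simp
        show "norm (f (cembed x)) \<le> B * \<kappa>"
          using \<kappa>(2)[of x] mult_right_mono[OF that(2) less_imp_le[OF \<kappa>(1)]] by (rule order_trans)
      qed (use b in auto)
      also have "\<dots> = (b * \<kappa> * B) * real j powr (- \<sigma>)" by simp
      also have "\<dots> \<le> H * real j powr (- \<sigma>)" using H by (intro mult_right_mono) auto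
      finally have "?s * \<bar>Re (\<theta> * (c j * f (cembed x)))\<bar> \<le> ?s * (H * real j powr (- \<sigma>))"
        using H by (intro mult_left_mono) auto
      then show ?thesis using H by (simp add: \<phi>_def d_def abs_mult)
    qed
    have d1: "d j \<le> 1" if "j \<ge> m" for j
    proof -
      have "real m powr \<delta> \<le> real j powr \<delta>" using that m \<delta> by (intro powr_mono2) auto
      also have "\<dots> \<le> real j powr \<sigma>" using that m by (intro powr_mono) (auto simp: \<delta>_def)
      finally show ?thesis using that m by (simp add: d_def powr_minus field_simps)
    qed
    have "(\<Sum>j=m..<n. (d j)\<^sup>2) \<le> E0"
    proof -
      have sq: "(d j)\<^sup>2 = real m powr (2 * \<delta>) * real j powr (- 2 * \<sigma>)" for j
      proof -
        have "(x powr a)\<^sup>2 = x powr (2 * a)" for x a :: real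
          by (simp add: power2_eq_square powr_add[symmetric])
        then show ?thesis by (simp add: d_def power_mult_distrib)
      qed
      have "(\<Sum>j=m..<n. (d j)\<^sup>2) \<le> (\<Sum>j\<in>insert m {Suc m..n}. (d j)\<^sup>2)" by (intro sum_mono2) auto
      also have "\<dots> = (d m)\<^sup>2 + (\<Sum>j=Suc m..n. (d j)\<^sup>2)" by simp
      also have "(\<Sum>j=Suc m..n. (d j)\<^sup>2) \<le> real m powr (2 * \<delta>) * (real m powr (1 - 2 * \<sigma>) / (2 * \<sigma> - 1))"
        unfolding sq sum_distrib_left[symmetric] using sum_powr_tail_le[OF \<sigma> m] by (intro mult_left_mono) auto
      also have "\<dots> = 1 / (2 * \<sigma> - 1)" using m by (simp add: \<delta>_def powr_add[symmetric])
      also have "(d m)\<^sup>2 \<le> 1"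
        using d1[of m] by (intro power_le_one) (auto simp: d_def)
      finally show ?thesis by (simp add: E0_def)
    qed
    then have "exp (\<Sum>j=m..<n. (d j)\<^sup>2) \<le> exp E0" by simp
    moreover have "(\<Sum>j=m..<n. \<phi> j (noise j \<omega>)) = ?s * Re (\<theta> * (T n \<omega> - T m \<omega>))" for \<omega>
      unfolding Tdiff[OF m n] by (simp only: \<phi>_def sum_distrib_left[symmetric] Re_sum[symmetric])
    ultimately show ?thesis
      using exp_moment_bound[of B \<phi> m d n, OF B(2) lin bound d1 m n] by (auto intro: order_trans)
  qed
  have "\<exists>C. \<forall>m\<ge>1. \<forall>n\<ge>m. (\<integral>\<^sup>+\<omega>. ennreal (norm (T n \<omega> - T m \<omega>) ^ p) \<partial>M) \<le> ennreal (C * real m powr (- \<delta> * real p))" for p :: nat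
  proof (intro exI[of _ "2 ^ p * fact p * (4 * exp E0) * H ^ p"] allI impI)
    fix m n :: nat assume m: "1 \<le> m" and n: "m \<le> n"
    let ?s = "real m powr \<delta> / H"
    let ?Q = "\<lambda>\<omega>. \<Sum>\<theta>\<in>{1, -1, \<i>, -\<i>}. exp (?s * Re (\<theta> * (T n \<omega> - T m \<omega>)))"
    have s: "?s > 0" using m H by simp
    have \<theta>: "norm \<theta> = 1" if "\<theta> \<in> {1, -1, \<i>, -\<i>}" for \<theta> using that by auto
    have Qi: "integrable M ?Q" using expb[OF m n \<theta>] by (intro Bochner_Integration.integrable_sum) blast
    have "expectation ?Q = (\<Sum>\<theta>\<in>{1, -1, \<i>, -\<i>}. expectation (\<lambda>\<omega>. exp (?s * Re (\<theta> * (T n \<omega> - T m \<omega>)))))"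
      using expb[OF m n \<theta>] by (intro Bochner_Integration.integral_sum) blast
    also have "\<dots> \<le> (\<Sum>\<theta>\<in>{1, -1, \<i>, -\<i>}. exp E0)" using expb[OF m n \<theta>] by (intro sum_mono) blast
    also have "\<dots> \<le> 4 * exp E0"
    proof -
      have "card {1, -1, \<i>, -\<i>} \<le> 4" using card_length[of "[1, -1, \<i>, -\<i>]"] by simp
      then have "real (card {1, -1, \<i>, -\<i>}) \<le> 4" by linarith
      then show ?thesis unfolding sum_constant by (intro mult_right_mono) auto
    qed
    finally have EQ: "expectation ?Q \<le> 4 * exp E0" .
    define K where "K = 2 ^ p * fact p / ?s ^ p"
    have K: "K \<ge> 0" using s by (simp add: K_def)
    have "(\<integral>\<^sup>+\<omega>. ennreal (norm (T n \<omega> - T m \<omega>) ^ p) \<partial>M) \<le> (\<integral>\<^sup>+\<omega>. ennreal (K * ?Q \<omega>) \<partial>M)"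
    proof (intro nn_integral_mono ennreal_leI)
      fix \<omega>
      have "?s ^ p * norm (T n \<omega> - T m \<omega>) ^ p \<le> 2 ^ p * fact p * ?Q \<omega>"
        using complex_power_le_exp[OF less_imp_le[OF s]] by (simp only: power_mult_distrib)
      then show "norm (T n \<omega> - T m \<omega>) ^ p \<le> K * ?Q \<omega>" using zero_less_power[OF s, of p] unfolding K_def
        by (simp only: pos_le_divide_eq times_divide_eq_left mult.commute)
    qed
    also have "\<dots> = ennreal (expectation (\<lambda>\<omega>. K * ?Q \<omega>))"
      using Qi K by (intro nn_integral_eq_integral) (auto intro!: AE_I2 mult_nonneg_nonneg sum_nonneg simp del: sum.insert)
    also have "expectation (\<lambda>\<omega>. K * ?Q \<omega>) = K * expectation ?Q" by (rule integral_mult_right_zero)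
    also have "ennreal (K * expectation ?Q) \<le> ennreal (K * (4 * exp E0))"
      using EQ K by (intro ennreal_leI mult_left_mono)
    also have "K * (4 * exp E0) = 2 ^ p * fact p * (4 * exp E0) * H ^ p * real m powr (- \<delta> * real p)"
    proof -
      have "(real m powr \<delta>) ^ p = real m powr (\<delta> * real p)" using m by (simp add: powr_realpow[symmetric] powr_powr)
      then show ?thesis using m by (simp add: K_def power_divide powr_minus field_simps)
    qed
    finally show "(\<integral>\<^sup>+\<omega>. ennreal (norm (T n \<omega> - T m \<omega>) ^ p) \<partial>M)
       \<le> ennreal (2 ^ p * fact p * (4 * exp E0) * H ^ p * real m powr (- \<delta> * real p))" .
  qed
  from moment_cauchy_limit[OF Tm \<delta> this] that show ?thesis unfolding T_def \<delta>_def by blast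
qed

end

subsection \<open>Spectrum of the replacement endomorphism\<close>

lemma complex_linear_form_iff:
  "complex_linear_form f \<longleftrightarrow> (\<forall>x y. f (x + y) = f x + f y) \<and> (\<forall>c x. f (cscale c x) = c * f x)"
proof -
  have "vector_space ((*) :: complex \<Rightarrow> complex \<Rightarrow> complex)"
    by unfold_locales (auto simp: algebra_simps)
  then show ?thesis
    unfolding complex_linear_form_def Vector_Spaces.linear_iff using cplx.vector_space_axioms by blast
qed

lemma cembed_add: "cembed (x + y) = cembed x + cembed y"
  and cembed_scaleR: "cembed (r *\<^sub>R x) = cscale (of_real r) (cembed x)"
  by (auto simp: cembed_def cscale_def)

lemma cscale_of_real: "cscale (of_real r) z = r *\<^sub>R z"
  by (simp add: cscale_def scaleR_prod_def)

lemma complex_linear_form_add: "complex_linear_form f \<Longrightarrow> f (x + y) = f x + f y"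
  and complex_linear_form_cscale: "complex_linear_form f \<Longrightarrow> f (cscale c x) = c * f x"
  unfolding complex_linear_form_iff by blast+

lemma complex_linear_form_scaleR: "complex_linear_form f \<Longrightarrow> f (r *\<^sub>R z) = r *\<^sub>R f z"
  by (metis cscale_of_real complex_linear_form_iff scaleR_conv_of_real)

lemma complex_linear_form_bounded_linear:
  fixes f :: "'a::euclidean_space \<times> 'a \<Rightarrow> complex"
  assumes "complex_linear_form f"
  shows "bounded_linear f"
  using assms complex_linear_form_scaleR[OF assms]
  by (intro linear_conv_bounded_linear[THEN iffD1] linearI) (auto simp: complex_linear_form_iff)

lemma complex_linear_form_sum:
  "complex_linear_form f \<Longrightarrow> f (\<Sum>i\<in>I. g i) = (\<Sum>i\<in>I. f (g i))"
proof -
  assume f: "complex_linear_form f"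
  have "f 0 = 0" using f complex_linear_form_scaleR[OF f, of 0 0] by simp
  then show ?thesis
    by (induction I rule: infinite_finite_induct) (simp_all add: complex_linear_form_add[OF f])
qed

lemma complex_linear_form_diff:
  "complex_linear_form f \<Longrightarrow> f (x - y) = f x - f y"
proof -
  assume f: "complex_linear_form f"
  then have "f (x + (-1) *\<^sub>R y) = f x + f ((-1) *\<^sub>R y)" unfolding complex_linear_form_iff by blast
  then show ?thesis unfolding complex_linear_form_scaleR[OF f] by simp
qed

lemma max_norm_index:
  fixes a :: "nat \<Rightarrow> complex"
  assumes "(s::nat) \<ge> 1"
  obtains k where "k \<in> {1..s}" "\<And>j. j \<in> {1..s} \<Longrightarrow> norm (a j) \<le> norm (a k)"
proof -
  have "Max ((\<lambda>j. norm (a j)) ` {1..s}) \<in> (\<lambda>j. norm (a j)) ` {1..s}" using assms by (intro Max_in) auto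
  then obtain k where "k \<in> {1..s}" "Max ((\<lambda>j. norm (a j)) ` {1..s}) = norm (a k)" by auto
  moreover have "norm (a j) \<le> Max ((\<lambda>j. norm (a j)) ` {1..s})" if "j \<in> {1..s}" for j
    using that by (intro Max_ge) auto
  ultimately show ?thesis using that[of k] by simp
qed

text \<open>The instance is the matrix \<open>l j (w k)\<close>, whose rows sum to 1 because every
  \<open>w k\<close> has mass 1. Its diagonal entries may be negative, so it need not be a
  stochastic matrix.\<close>

locale stochastic_rows =
  fixes P :: "nat \<Rightarrow> nat \<Rightarrow> real" and s :: nat
  assumes s: "s \<ge> 1" and offdiag: "\<And>k j. k \<in> {1..s} \<Longrightarrow> j \<in> {1..s} \<Longrightarrow> k \<noteq> j \<Longrightarrow> P k j \<ge> 0"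
    and rows: "\<And>k. k \<in> {1..s} \<Longrightarrow> (\<Sum>j=1..s. P k j) = 1"
begin

text \<open>Adding \<open>shift\<close> on the diagonal gives a nonnegative matrix with row sums \<open>1 + shift\<close>, hence of norm \<open>1 + shift\<close>.\<close>

definition shift :: real where "shift = (\<Sum>k=1..s. \<bar>P k k\<bar>)"

lemma shift_nonneg: "shift \<ge> 0"
  by (simp add: shift_def sum_nonneg)

lemma shifted_norm_le:
  fixes a :: "nat \<Rightarrow> complex"
  assumes k: "k \<in> {1..s}" and a: "\<And>j. j \<in> {1..s} \<Longrightarrow> norm (a j) \<le> B"
  shows "norm ((\<Sum>j=1..s. of_real (P k j) * a j) + of_real shift * a k) \<le> (1 + shift) * B"
proof -
  define Q where "Q j = P k j + (if j = k then shift else 0)" for j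
  have Q0: "Q j \<ge> 0" if "j \<in> {1..s}" for j
  proof (cases "j = k")
    case True
    have "\<bar>P k k\<bar> \<le> shift" unfolding shift_def using k by (intro member_le_sum) auto
    then show ?thesis using True by (simp add: Q_def)
  next
    case False
    then show ?thesis using offdiag[OF k that] by (simp add: Q_def)
  qed
  have "(\<Sum>j=1..s. of_real (P k j) * a j) + of_real shift * a k = (\<Sum>j=1..s. of_real (Q j) * a j)"
  proof -
    have "(\<Sum>j=1..s. of_real (Q j) * a j)
        = (\<Sum>j=1..s. of_real (P k j) * a j + (if j = k then of_real shift * a j else 0))"
      by (intro sum.cong) (auto simp: Q_def algebra_simps)
    also have "\<dots> = (\<Sum>j=1..s. of_real (P k j) * a j) + of_real shift * a k"
      using k by (simp add: sum.distrib)
    finally show ?thesis by simp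
  qed
  also have "norm \<dots> \<le> (\<Sum>j=1..s. Q j * B)"
    using Q0 a by (intro sum_norm_le) (auto simp: norm_mult abs_of_nonneg intro!: mult_left_mono)
  also have "\<dots> = (\<Sum>j=1..s. Q j) * B" by (simp add: sum_distrib_right)
  also have "(\<Sum>j=1..s. Q j) = 1 + shift" using k rows[OF k] by (simp add: Q_def sum.distrib)
  finally show ?thesis .
qed

text \<open>Evaluated at a coordinate of maximal modulus, the norm bound confines
  \<open>\<mu>\<close> to the disc with centre \<open>- shift\<close> and radius
  \<open>1 + shift\<close>. This disc touches the line of real part 1 in the point 1 only.\<close>

lemma eigenvalue_bound:
  fixes a :: "nat \<Rightarrow> complex"
  assumes eig: "\<And>k. k \<in> {1..s} \<Longrightarrow> (\<Sum>j=1..s. of_real (P k j) * a j) = \<mu> * a k"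
    and nz: "j0 \<in> {1..s}" "a j0 \<noteq> 0" and ne: "\<mu> \<noteq> 1"
  shows "Re \<mu> < 1"
proof (rule ccontr)
  assume "\<not> Re \<mu> < 1"
  obtain k where k: "k \<in> {1..s}" "\<And>j. j \<in> {1..s} \<Longrightarrow> norm (a j) \<le> norm (a k)"
    using max_norm_index[OF s] by blast
  have ak: "norm (a k) > 0" using k(2)[OF nz(1)] nz(2) by auto
  have "norm ((\<mu> + of_real shift) * a k) \<le> (1 + shift) * norm (a k)"
    using shifted_norm_le[OF k(1), of a "norm (a k)"] k(2) eig[OF k(1)] by (simp add: distrib_right)
  then have *: "norm (\<mu> + of_real shift) \<le> 1 + shift" using ak by (simp add: norm_mult)
  have "Re \<mu> + shift \<le> norm (\<mu> + of_real shift)" using complex_Re_le_cmod[of "\<mu> + of_real shift"] by simp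
  then have re: "Re \<mu> = 1" using * \<open>\<not> Re \<mu> < 1\<close> by simp
  have "(norm (\<mu> + of_real shift))\<^sup>2 \<le> (1 + shift)\<^sup>2" using * by (intro power_mono) auto
  then have "Im \<mu> = 0" using re by (simp add: cmod_power2)
  then show False using re ne by (simp add: complex_eq_iff)
qed

lemma eigenvalue_1_semisimple:
  fixes a b :: "nat \<Rightarrow> complex"
  assumes eig: "\<And>k. k \<in> {1..s} \<Longrightarrow> (\<Sum>j=1..s. of_real (P k j) * a j) = a k"
    and gen: "\<And>k. k \<in> {1..s} \<Longrightarrow> (\<Sum>j=1..s. of_real (P k j) * b j) = b k + a k"
    and j: "j \<in> {1..s}"
  shows "a j = 0"
proof -
  define c where "c = 1 + shift"
  have c: "c > 0" using shift_nonneg by (simp add: c_def)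
  obtain k0 where k0: "k0 \<in> {1..s}" "\<And>j. j \<in> {1..s} \<Longrightarrow> norm (b j) \<le> norm (b k0)"
    using max_norm_index[OF s] by blast
  \<comment> \<open>The shifted matrix maps \<open>b + t a\<close> to \<open>c (b + (t + 1/c) a)\<close>, so the norm cannot grow with \<open>t\<close>.\<close>
  have "norm (b k + of_real (real n / c) * a k) \<le> norm (b k0)" if "k \<in> {1..s}" for k n
    using that
  proof (induction n arbitrary: k)
    case 0
    then show ?case using k0 by simp
  next
    case (Suc n)
    let ?f = "\<lambda>j. b j + of_real (real n / c) * a j"
    have "(\<Sum>j=1..s. of_real (P k j) * ?f j) = b k + a k + of_real (real n / c) * a k"
    proof -
      have "(\<Sum>j=1..s. of_real (P k j) * ?f j)
          = (\<Sum>j=1..s. of_real (P k j) * b j) + of_real (real n / c) * (\<Sum>j=1..s. of_real (P k j) * a j)"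
        by (simp add: distrib_left sum.distrib sum_distrib_left mult.left_commute)
      then show ?thesis unfolding eig[OF Suc.prems] gen[OF Suc.prems] .
    qed
    note eqS = this
    have "(\<Sum>j=1..s. of_real (P k j) * ?f j) + of_real shift * ?f k = of_real c * (b k + of_real (real (Suc n) / c) * a k)"
    proof -
      have sh: "of_real shift = (of_real c - 1 :: complex)" by (simp add: c_def)
      have cnz: "of_real c \<noteq> (0 :: complex)" using c by (simp only: of_real_eq_0_iff)
      show ?thesis unfolding eqS sh using cnz by (simp add: field_simps)
    qed
    then have "norm (of_real c * (b k + of_real (real (Suc n) / c) * a k)) \<le> c * norm (b k0)"
      using shifted_norm_le[OF Suc.prems, of ?f "norm (b k0)"] Suc.IH by (simp add: c_def)
    then show ?case using c by (simp add: norm_mult)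
  qed
  note bnd = this[OF j]
  have lin: "real n * norm (a j) \<le> 2 * norm (b k0) * c" for n
  proof -
    have "norm (of_real (real n / c) * a j) \<le> norm (b j + of_real (real n / c) * a j) + norm (b j)"
      using norm_triangle_ineq4[of "b j + of_real (real n / c) * a j" "b j"] by simp
    also have "\<dots> \<le> 2 * norm (b k0)" using bnd[of n] k0(2)[OF j] by simp
    finally show ?thesis using c by (simp add: norm_mult norm_divide field_simps)
  qed
  show ?thesis
  proof (rule ccontr)
    assume "a j \<noteq> 0"
    then obtain n where "2 * norm (b k0) * c < real n * norm (a j)"
      using reals_Archimedean3[of "norm (a j)"] by auto
    with lin[of n] show False by simp
  qed
qed

end

section \<open>Jordan bases of forms, their dual bases and the eigenvalues\<close>

locale polya_jordan = polya_chain M X x1 w l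
  for M :: "'b measure" and X :: "nat \<Rightarrow> 'b \<Rightarrow> 'a::euclidean_space"
    and x1 :: 'a and w :: "nat \<Rightarrow> 'a" and l :: "nat \<Rightarrow> 'a \<Rightarrow> real" +
  fixes u :: "nat \<Rightarrow> 'a \<times> 'a \<Rightarrow> complex" and v :: "nat \<Rightarrow> 'a \<times> 'a"
    and \<Lambda> :: "nat \<Rightarrow> complex" and \<epsilon> :: "nat \<Rightarrow> nat"
  assumes jordan: "jordan_basis w l u \<Lambda> \<epsilon>"
    and dual: "dual_basis u v"
begin

lemma u_basis: "basis_of_forms {f. complex_linear_form f} DIM('a) u"
  using jordan by (simp add: jordan_basis_def Let_def)

lemma u_form: "k \<in> {1..DIM('a)} \<Longrightarrow> complex_linear_form (u k)"
  using u_basis by (auto simp: basis_of_forms_def)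

lemma u_1: "u 1 = (\<lambda>z. \<Sum>k=1..DIM('a). cext_form (l k) z)"
  and Lam_1: "\<Lambda> 1 = 1" and eps_1: "\<epsilon> 1 = 0"
  using jordan by (simp_all add: jordan_basis_def Let_def)

lemma eps_01: "k \<in> {1..DIM('a)} \<Longrightarrow> \<epsilon> k = 0 \<or> \<epsilon> k = 1"
  using jordan eps_1 by (cases "k = 1") (auto simp: jordan_basis_def Let_def)

lemma eps_Lam: "k \<in> {1..DIM('a)} \<Longrightarrow> \<epsilon> k = 1 \<Longrightarrow> k \<ge> 2 \<and> k - 1 \<in> {1..DIM('a)} \<and> \<Lambda> k = \<Lambda> (k - 1)"
  using jordan eps_1 by (cases "k = 1") (force simp: jordan_basis_def Let_def)+

lemma cext_form_l: "k \<in> {1..DIM('a)} \<Longrightarrow> complex_linear_form (cext_form (l k))"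
  by (auto simp: complex_linear_form_iff cext_form_def cscale_def complex_eq_iff
      linear_add[OF l_linear] linear_diff[OF l_linear] linear_scale[OF l_linear])

lemma u_1_embed: "u 1 (cembed x) = of_real (mass x)"
  unfolding u_1 by (simp add: cext_form_def cembed_def mass_def complex_eq_iff linear_0[OF l_linear])

lemma cext_endo_form:
  assumes "complex_linear_form f"
  shows "f (cext_endo A z) = (\<Sum>k=1..DIM('a). cext_form (l k) z * f (cembed (w k)))"
proof -
  have "cext_endo A z = (\<Sum>k=1..DIM('a). cscale (cext_form (l k) z) (cembed (w k)))"
    by (simp add: cext_endo_def replacement_def cscale_def cext_form_def cembed_def prod_eq_iff fst_sum snd_sum)
  then show ?thesis by (simp only: complex_linear_form_sum[OF assms] complex_linear_form_cscale[OF assms])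
qed

text \<open>The definition of a Jordan basis states the relation for \<open>k \<ge> 2\<close> only;
  for \<open>k = 1\<close> it follows from \<open>u 1 (cembed (w j)) = 1\<close>.\<close>

lemma u_A:
  assumes "k \<in> {1..DIM('a)}"
  shows "u k (cext_endo A z) = \<Lambda> k * u k z + of_nat (\<epsilon> k) * u (k - 1) z"
proof (cases "k = 1")
  case True
  have "u 1 (cembed (w j)) = 1" if "j \<in> {1..DIM('a)}" for j
    using mass_w[OF that] u_1_embed[of "w j"] by simp
  then have "(\<Sum>k=1..DIM('a). cext_form (l k) z * u 1 (cembed (w k))) = (\<Sum>k=1..DIM('a). cext_form (l k) z)"
    by (intro sum.cong) auto
  moreover have "complex_linear_form (u 1)" using u_form by (simp add: DIM_positive Suc_le_eq)
  ultimately have "u 1 (cext_endo A z) = u 1 z" by (simp only: cext_endo_form) (simp only: u_1)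
  then show ?thesis using True Lam_1 eps_1 by simp
next
  case False
  then have "k \<in> {2..DIM('a)}" using assms by auto
  moreover have "\<forall>k\<in>{2..DIM('a)}. (\<forall>z. u k (cext_endo A z) = \<Lambda> k * u k z + of_nat (\<epsilon> k) * u (k - 1) z) \<and>
      \<epsilon> k \<in> {0, 1} \<and> (\<Lambda> k \<noteq> \<Lambda> (k - 1) \<longrightarrow> \<epsilon> k = 0)"
    using jordan unfolding jordan_basis_def Let_def by blast
  ultimately show ?thesis by blast
qed

lemma cext_endo_embed: "cext_endo A (cembed x) = cembed (A x)"
  by (simp add: cext_endo_def cembed_def linear_0[OF A_linear])

lemma form_expansion:
  assumes "complex_linear_form f"
  shows "\<exists>c. \<forall>z. f z = (\<Sum>k=1..DIM('a). c k * u k z)"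
  by (rule u_basis[unfolded basis_of_forms_def, THEN conjunct2, THEN conjunct1, THEN bspec]) (simp add: assms)

text \<open>The basis property speaks of forms, not of vectors. The complexified inner products with
  real vectors are forms, hence combinations of the \<open>u k\<close>, and they detect every
  nonzero \<open>z\<close>.\<close>

lemma forms_separate:
  assumes "\<And>k. k \<in> {1..DIM('a)} \<Longrightarrow> u k z = 0"
  shows "z = 0"
proof -
  have form0: "f z = 0" if "complex_linear_form f" for f :: "'a \<times> 'a \<Rightarrow> complex"
  proof -
    from form_expansion[OF that] obtain c where "\<forall>z. f z = (\<Sum>k=1..DIM('a). c k * u k z)" ..
    then have "f z = (\<Sum>k=1..DIM('a). c k * u k z)" by blast
    also have "\<dots> = 0" by (intro sum.neutral) (simp add: assms)
    finally show ?thesis .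
  qed
  have "Complex (x \<bullet> fst z) (x \<bullet> snd z) = 0" for x
    by (rule form0) (auto simp: complex_linear_form_iff cscale_def complex_eq_iff inner_add_right
        inner_diff_right)
  then have "x \<bullet> fst z = 0" "x \<bullet> snd z = 0" for x by (auto simp: complex_eq_iff)
  from this(1)[of "fst z"] this(2)[of "snd z"] show ?thesis by (simp add: prod_eq_iff)
qed

lemma u_v: "i \<in> {1..DIM('a)} \<Longrightarrow> j \<in> {1..DIM('a)} \<Longrightarrow> u i (v j) = (if i = j then 1 else 0)"
  using dual by (simp add: dual_basis_def)

lemma u_combination:
  assumes "i \<in> {1..DIM('a)}"
  shows "u i (\<Sum>j=1..DIM('a). cscale (c j) (v j)) = c i"
proof -
  have "u i (\<Sum>j=1..DIM('a). cscale (c j) (v j)) = (\<Sum>j=1..DIM('a). c j * u i (v j))"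
    by (simp only: complex_linear_form_sum[OF u_form[OF assms]] complex_linear_form_cscale[OF u_form[OF assms]])
  also have "\<dots> = (\<Sum>j=1..DIM('a). if i = j then c j else 0)"
    by (intro sum.cong) (simp_all add: u_v[OF assms])
  also have "\<dots> = c i" using assms by simp
  finally show ?thesis .
qed

lemma expand: "z = (\<Sum>k=1..DIM('a). cscale (u k z) (v k))"
proof -
  have "z - (\<Sum>k=1..DIM('a). cscale (u k z) (v k)) = 0"
  proof (rule forms_separate)
    fix i assume i: "i \<in> {1..DIM('a)}"
    show "u i (z - (\<Sum>k=1..DIM('a). cscale (u k z) (v k))) = 0"
      unfolding complex_linear_form_diff[OF u_form[OF i]] u_combination[OF i] by simp
  qed
  then show ?thesis by simp
qed

text \<open>Transposition reverses the chains: the eigenforms sit at the first index of a block, the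
  eigenvectors of the dual basis at the last. The condition on \<open>\<epsilon> (Suc k)\<close>
  says that \<open>k\<close> ends its block.\<close>

lemma A_v:
  assumes k: "k \<in> {1..DIM('a)}" and e: "k < DIM('a) \<Longrightarrow> \<epsilon> (Suc k) = 0"
  shows "cext_endo A (v k) = cscale (\<Lambda> k) (v k)"
proof -
  have "cext_endo A (v k) - cscale (\<Lambda> k) (v k) = 0"
  proof (rule forms_separate)
    fix i assume i: "i \<in> {1..DIM('a)}"
    have "\<epsilon> i = 0 \<or> u (i - 1) (v k) = 0"
    proof (cases "i = Suc k")
      case False
      show ?thesis
      proof (cases "\<epsilon> i = 0")
        case False
        then have "i \<ge> 2" "i - 1 \<in> {1..DIM('a)}" using eps_01[OF i] eps_Lam[OF i] by auto
        then show ?thesis using u_v[of "i - 1" k] k \<open>i \<noteq> Suc k\<close> by auto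
      qed simp
    qed (use e i in auto)
    then show "u i (cext_endo A (v k) - cscale (\<Lambda> k) (v k)) = 0"
      using u_v[OF i k]
      by (auto simp: complex_linear_form_diff[OF u_form[OF i]] u_A[OF i] complex_linear_form_cscale[OF u_form[OF i]])
  qed
  then show ?thesis by simp
qed

lemma v_nonzero: "k \<in> {1..DIM('a)} \<Longrightarrow> v k \<noteq> 0"
  using u_v[of k k] complex_linear_form_scaleR[OF u_form, of k 0 0] by auto

text \<open>The root is constant along a chain, so the induction climbs to the end of the chain,
  where \<open>A_v\<close> supplies an eigenvector.\<close>

lemma Lam_eigenvalue:
  assumes k: "k \<in> {1..DIM('a)}"
  shows "eigenvalue A (\<Lambda> k)"
  using k
proof (induction "DIM('a) - k" arbitrary: k)
  case 0
  then have "k = DIM('a)" by simp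
  then show ?case unfolding eigenvalue_def using A_v[OF \<open>k \<in> _\<close>] v_nonzero[OF \<open>k \<in> _\<close>] by (metis less_irrefl)
next
  case (Suc d)
  show ?case
  proof (cases "\<epsilon> (Suc k) = 1")
    case True
    have "Suc k \<in> {1..DIM('a)}" using Suc by auto
    then show ?thesis using Suc.hyps(1)[of "Suc k"] Suc.hyps(2) eps_Lam[of "Suc k"] True by auto
  next
    case False
    have "Suc k \<in> {1..DIM('a)}" using Suc by auto
    then have "\<epsilon> (Suc k) = 0" using eps_01 False by blast
    then show ?thesis unfolding eigenvalue_def using A_v[OF Suc.prems] v_nonzero[OF Suc.prems] by blast
  qed
qed

text \<open>At the first index \<open>k\<close> with \<open>u k z \<noteq> 0\<close> the nilpotent
  term of the Jordan relation vanishes and leaves \<open>\<mu> = \<Lambda> k\<close>.\<close>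

lemma eigenvalue_Lam:
  assumes "eigenvalue A \<mu>"
  shows "\<mu> \<in> \<Lambda> ` {1..DIM('a)}"
proof -
  obtain z where z: "z \<noteq> 0" "cext_endo A z = cscale \<mu> z" using assms by (auto simp: eigenvalue_def)
  define k where "k = (LEAST k. k \<in> {1..DIM('a)} \<and> u k z \<noteq> 0)"
  have "\<exists>k. k \<in> {1..DIM('a)} \<and> u k z \<noteq> 0" using forms_separate z(1) by blast
  from LeastI_ex[OF this] have k: "k \<in> {1..DIM('a)}" "u k z \<noteq> 0" by (auto simp: k_def)
  have e0: "of_nat (\<epsilon> k) * u (k - 1) z = 0"
  proof (cases "\<epsilon> k = 0")
    case False
    then have e: "k \<ge> 2" "k - 1 \<in> {1..DIM('a)}" using eps_01[OF k(1)] eps_Lam[OF k(1)] by auto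
    then have "k - 1 < k" by simp
    from not_less_Least[OF this[unfolded k_def]] e(2) show ?thesis by (simp add: k_def)
  qed simp
  have e1: "u k (cext_endo A z) = \<mu> * u k z"
    unfolding z(2) by (rule complex_linear_form_cscale[OF u_form[OF k(1)]])
  have "\<mu> * u k z = \<Lambda> k * u k z" using u_A[OF k(1), of z] unfolding e0 e1 by simp
  then have "\<mu> = \<Lambda> k" using k(2) by simp
  then show ?thesis using k(1) by simp
qed

text \<open>Evaluated on the vectors \<open>w k\<close>, the Jordan relation turns into a relation
  for the matrix \<open>l j (w k)\<close>, to which the row sum estimates apply.\<close>

definition form_vec :: "nat \<Rightarrow> nat \<Rightarrow> complex" where
  "form_vec m k = u m (cembed (w k))"

sublocale stochastic_rows "\<lambda>k j. l j (w k)" "DIM('a)"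
  by unfold_locales (use l_w_nonneg mass_w in \<open>auto simp: mass_def DIM_positive Suc_le_eq\<close>)

lemma form_vec_eq:
  assumes m: "m \<in> {1..DIM('a)}" and k: "k \<in> {1..DIM('a)}"
  shows "(\<Sum>j=1..DIM('a). of_real (l j (w k)) * form_vec m j)
    = \<Lambda> m * form_vec m k + of_nat (\<epsilon> m) * form_vec (m - 1) k"
proof -
  have c: "cext_form (l j) (cembed x) = of_real (l j x)" if "j \<in> {1..DIM('a)}" for j x
    using linear_0[OF l_linear[OF that]] by (simp add: cext_form_def cembed_def complex_eq_iff)
  show ?thesis
    unfolding form_vec_def using u_A[OF m, of "cembed (w k)"] c
    by (simp add: cext_endo_form[OF u_form[OF m]])
qed

text \<open>A form vanishing on all \<open>w k\<close> vanishes on the image of the endomorphism; an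
  eigenform of nonzero eigenvalue would then be zero.\<close>

lemma u_root_nonzero:
  assumes m: "m \<in> {1..DIM('a)}" and e: "\<epsilon> m = 0" and nz: "\<Lambda> m \<noteq> 0"
  shows "\<exists>j\<in>{1..DIM('a)}. form_vec m j \<noteq> 0"
proof (rule ccontr)
  assume "\<not> (\<exists>j\<in>{1..DIM('a)}. form_vec m j \<noteq> 0)"
  then have "u m (cext_endo A z) = 0" for z
    using cext_endo_form[OF u_form[OF m]] by (simp add: form_vec_def)
  then have "u m z = 0" for z using u_A[OF m, of z] e nz by simp
  then show False using u_v[OF m m] by simp
qed

definition block_start :: "nat \<Rightarrow> nat" where
  "block_start k = (GREATEST m. m \<le> k \<and> 1 \<le> m \<and> \<epsilon> m = 0)"

lemma block_start:
  assumes k: "k \<in> {1..DIM('a)}"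
  shows "block_start k \<le> k" "1 \<le> block_start k" "\<epsilon> (block_start k) = 0"
    "\<And>j. block_start k < j \<Longrightarrow> j \<le> k \<Longrightarrow> \<epsilon> j = 1"
proof -
  let ?P = "\<lambda>m. m \<le> k \<and> 1 \<le> m \<and> \<epsilon> m = 0"
  have "?P 1" using k eps_1 by auto
  from GreatestI_nat[of ?P, OF this, of k] have P: "?P (block_start k)" by (auto simp: block_start_def)
  then show "block_start k \<le> k" "1 \<le> block_start k" "\<epsilon> (block_start k) = 0" by auto
  fix j assume j: "block_start k < j" "j \<le> k"
  show "\<epsilon> j = 1"
  proof (rule ccontr)
    assume "\<epsilon> j \<noteq> 1"
    then have "?P j" using eps_01[of j] j k by auto
    from Greatest_le_nat[of ?P, OF this, of k] show False using j by (auto simp: block_start_def)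
  qed
qed

lemma chain_Lam:
  assumes "m \<in> {1..DIM('a)}" "m \<le> k" "k \<in> {1..DIM('a)}" "\<And>j. m < j \<Longrightarrow> j \<le> k \<Longrightarrow> \<epsilon> j = 1"
  shows "\<Lambda> k = \<Lambda> m"
  using assms(2,3,4)
proof (induction k rule: dec_induct)
  case (step n)
  have "\<Lambda> (Suc n) = \<Lambda> n" using eps_Lam[of "Suc n"] step by auto
  then show ?case using step assms(1) by auto
qed simp

lemma Lam_block_start: "k \<in> {1..DIM('a)} \<Longrightarrow> \<Lambda> (block_start k) = \<Lambda> k"
  using chain_Lam[of "block_start k" k] block_start[of k] by auto

text \<open>The estimate needs a genuine eigenvector, so the argument moves to the root of the
  block. The eigenvalue 0, for which \<open>form_vec\<close> could vanish, satisfies the claim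
  anyway.\<close>

lemma Re_Lam_less_1:
  assumes k: "k \<in> {1..DIM('a)}" and ne: "\<Lambda> k \<noteq> 1"
  shows "Re (\<Lambda> k) < 1"
proof (cases "\<Lambda> k = 0")
  case False
  let ?m = "block_start k"
  have m: "?m \<in> {1..DIM('a)}" "\<epsilon> ?m = 0" using block_start[OF k] k by auto
  obtain j where j: "j \<in> {1..DIM('a)}" "form_vec ?m j \<noteq> 0"
    using u_root_nonzero[OF m] Lam_block_start[OF k] False by auto
  show ?thesis
    by (rule eigenvalue_bound[of "form_vec ?m"])
      (use form_vec_eq[OF m(1)] m(2) j ne Lam_block_start[OF k] in auto)
qed simp

text \<open>A chain of length at least two at 1 would yield, from its first two forms, vectors
  \<open>a\<close> and \<open>b\<close> as in \<open>eigenvalue_1_semisimple\<close>, with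
  \<open>a\<close> nonzero.\<close>

lemma eps_1_imp_Lam:
  assumes k: "k \<in> {1..DIM('a)}" and e: "\<epsilon> k = 1"
  shows "\<Lambda> k \<noteq> 1"
proof
  assume L: "\<Lambda> k = 1"
  define m where "m = block_start k"
  have m: "m \<in> {1..DIM('a)}" "\<epsilon> m = 0" "m < k" "\<Lambda> m = 1"
    using block_start[OF k] k e Lam_block_start[OF k] L unfolding m_def by (auto simp: le_less)
  have sm: "Suc m \<in> {1..DIM('a)}" "\<epsilon> (Suc m) = 1" using m k block_start(4)[OF k, of "Suc m"] by (auto simp: m_def)
  then have L': "\<Lambda> (Suc m) = 1" using eps_Lam[of "Suc m"] m by simp
  obtain j where j: "j \<in> {1..DIM('a)}" "form_vec m j \<noteq> 0"
    using u_root_nonzero[OF m(1,2)] m(4) by auto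
  have "form_vec m j = 0"
  proof (rule eigenvalue_1_semisimple[of _ "form_vec (Suc m)"])
    show "(\<Sum>j=1..DIM('a). of_real (l j (w k)) * form_vec m j) = form_vec m k" if "k \<in> {1..DIM('a)}" for k
      using form_vec_eq[OF m(1) that] m by simp
    show "(\<Sum>j=1..DIM('a). of_real (l j (w k)) * form_vec (Suc m) j) = form_vec (Suc m) k + form_vec m k"
      if "k \<in> {1..DIM('a)}" for k
      using form_vec_eq[OF sm(1) that] sm L' by simp
  qed (use j in auto)
  with j show False by simp
qed

text \<open>Used contrapositively: once \<sigma>2 < 1 excludes multiplicity two, every
  \<open>\<Lambda> k\<close> with \<open>k \<ge> 2\<close> differs from 1 and takes part in the
  maximum that defines \<sigma>2. Independence of \<open>v 1\<close> and \<open>v k\<close> is read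
  off by the forms \<open>u 1\<close> and \<open>u k\<close>.\<close>

lemma multiplicity_1:
  assumes k: "k \<in> {2..DIM('a)}" and L: "\<Lambda> k = 1"
  shows "alg_multiplicity A 1 \<ge> 2"
proof -
  let ?G = "{z. \<exists>p. ((\<lambda>x. cext_endo A x - cscale 1 x) ^^ p) z = 0}"
  have in_G: "v j \<in> ?G" if "j \<in> {1..DIM('a)}" "\<Lambda> j = 1" for j
  proof -
    have "cext_endo A (v j) = cscale (\<Lambda> j) (v j)"
    proof (rule A_v[OF that(1)])
      assume "j < DIM('a)"
      then have *: "Suc j \<in> {1..DIM('a)}" by simp
      show "\<epsilon> (Suc j) = 0"
      proof (rule ccontr)
        assume "\<epsilon> (Suc j) \<noteq> 0"
        then have "\<epsilon> (Suc j) = 1" using eps_01[OF *] by simp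
        then show False using eps_Lam[OF *] eps_1_imp_Lam[OF *] that by simp
      qed
    qed
    then have "((\<lambda>x. cext_endo A x - cscale 1 x) ^^ 1) (v j) = 0" using that by simp
    then show ?thesis by blast
  qed
  have s1: "1 \<in> {1..DIM('a)}" "k \<in> {1..DIM('a)}" using k by auto
  have ne: "v 1 \<noteq> v k" using u_v[of 1 1] u_v[of 1 k] s1 k by auto
  have ind: "\<not> cplx.dependent {v 1, v k}"
  proof
    assume "cplx.dependent {v 1, v k}"
    then obtain a b where ab: "cscale a (v 1) + cscale b (v k) = 0" "a \<noteq> 0 \<or> b \<noteq> 0"
      using ne by (subst (asm) cplx.dependent_finite) auto
    have "u i (cscale a (v 1) + cscale b (v k)) = a * u i (v 1) + b * u i (v k)" if "i \<in> {1..DIM('a)}" for i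
      by (simp only: complex_linear_form_add[OF u_form[OF that]] complex_linear_form_cscale[OF u_form[OF that]])
    from this[OF s1(1)] this[OF s1(2)] have "a = 0" "b = 0"
      using ab(1) u_v s1 k complex_linear_form_scaleR[OF u_form[OF s1(1)], of 0 0]
        complex_linear_form_scaleR[OF u_form[OF s1(2)], of 0 0] by auto
    with ab(2) show False by simp
  qed
  obtain B where B: "B \<subseteq> ?G" "\<not> cplx.dependent B" "?G \<subseteq> cplx.span B" "card B = cplx.dim ?G"
    using cplx.basis_exists by blast
  have "UNIV = cplx.span (v ` {1..DIM('a)})"
  proof -
    have "z \<in> cplx.span (v ` {1..DIM('a)})" for z
      by (subst expand[of z]) (intro cplx.span_sum cplx.span_scale cplx.span_base, auto)
    then show ?thesis by auto
  qed
  \<comment> \<open>The dimension is the cardinality of a basis, which would be 0 for an infinite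
    set; finiteness therefore has to be secured before comparing with two vectors.\<close>
  then have fB: "finite B" using cplx.independent_span_bound[of "v ` {1..DIM('a)}" B] B(2) by auto
  have "card {v 1, v k} \<le> card B"
    using cplx.independent_span_bound[OF fB ind] in_G[OF s1(1)] in_G[OF s1(2)] Lam_1 L B(3) by auto
  then show ?thesis using B(4) ne unfolding alg_multiplicity_def by simp
qed

end

subsection \<open>Generalised eigenspaces of an operator on functions\<close>

definition linear_operator :: "(('z \<Rightarrow> complex) \<Rightarrow> 'z \<Rightarrow> complex) \<Rightarrow> bool" where
  "linear_operator T \<longleftrightarrow>
     (\<forall>f g. T (\<lambda>z. f z + g z) = (\<lambda>z. T f z + T g z)) \<and> (\<forall>c f. T (\<lambda>z. c * f z) = (\<lambda>z. c * T f z))"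

definition shifted_op :: "(('z \<Rightarrow> complex) \<Rightarrow> 'z \<Rightarrow> complex) \<Rightarrow> complex \<Rightarrow> ('z \<Rightarrow> complex) \<Rightarrow> 'z \<Rightarrow> complex" where
  "shifted_op T c g z = T g z - c * g z"

definition function_space :: "('z \<Rightarrow> complex) set \<Rightarrow> bool" where
  "function_space S \<longleftrightarrow> (\<lambda>_. 0) \<in> S \<and> (\<forall>f\<in>S. \<forall>g\<in>S. (\<lambda>z. f z + g z) \<in> S) \<and> (\<forall>c. \<forall>f\<in>S. (\<lambda>z. c * f z) \<in> S)"

definition gen_eigenspace :: "(('z \<Rightarrow> complex) \<Rightarrow> 'z \<Rightarrow> complex) \<Rightarrow> complex \<Rightarrow> ('z \<Rightarrow> complex) set" where
  "gen_eigenspace T c = {f. \<exists>p. (shifted_op T c ^^ p) f = (\<lambda>_. 0)}"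

text \<open>The space \<open>S\<close> and the spectrum \<open>D\<close> are recorded together, so
  that a single induction controls both the weight and the eigenvalues of the components.\<close>

definition decomposable :: "(('z \<Rightarrow> complex) \<Rightarrow> 'z \<Rightarrow> complex) \<Rightarrow> ('z \<Rightarrow> complex) set \<Rightarrow> complex set \<Rightarrow> ('z \<Rightarrow> complex) \<Rightarrow> bool" where
  "decomposable T S D f \<longleftrightarrow> (\<exists>C g. finite C \<and> C \<subseteq> D \<and> (\<forall>d\<in>C. g d \<in> S \<and> g d \<in> gen_eigenspace T d) \<and>
     f = (\<lambda>z. \<Sum>d\<in>C. g d z))"

lemma function_space_add: "function_space S \<Longrightarrow> f \<in> S \<Longrightarrow> g \<in> S \<Longrightarrow> (\<lambda>z. f z + g z) \<in> S"
  and function_space_scale: "function_space S \<Longrightarrow> f \<in> S \<Longrightarrow> (\<lambda>z. c * f z) \<in> S"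
  by (simp_all add: function_space_def)

lemma function_space_sum:
  assumes "function_space S" "\<And>i. i \<in> I \<Longrightarrow> f i \<in> S"
  shows "(\<lambda>z. \<Sum>i\<in>I. f i z) \<in> S"
  using assms by (induction I rule: infinite_finite_induct) (auto simp: function_space_def)

lemma function_space_diff:
  assumes "function_space S" "f \<in> S" "g \<in> S"
  shows "(\<lambda>z. f z - g z) \<in> S"
proof -
  have "(\<lambda>z. f z + (-1) * g z) \<in> S"
    using assms by (intro function_space_add function_space_scale)
  then show ?thesis by simp
qed

context
  fixes T :: "('z \<Rightarrow> complex) \<Rightarrow> 'z \<Rightarrow> complex"
  assumes T: "linear_operator T"
begin

lemma linear_operator_add: "T (\<lambda>z. f z + g z) = (\<lambda>z. T f z + T g z)"
  and linear_operator_scale: "T (\<lambda>z. c * f z) = (\<lambda>z. c * T f z)"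
  using T by (auto simp: linear_operator_def)

lemma linear_operator_zero: "T (\<lambda>_. 0) = (\<lambda>_. 0)"
  using linear_operator_scale[of 0 "\<lambda>_. 0"] by simp

lemma linear_operator_diff: "T (\<lambda>z. f z - g z) = (\<lambda>z. T f z - T g z)"
  using linear_operator_add[of f "\<lambda>z. (-1) * g z"] linear_operator_scale[of "-1" g] by simp

lemma linear_operator_sum: "T (\<lambda>z. \<Sum>i\<in>I. f i z) = (\<lambda>z. \<Sum>i\<in>I. T (f i) z)"
  by (induction I rule: infinite_finite_induct) (simp_all add: linear_operator_zero linear_operator_add)

lemma shifted_linear: "linear_operator (shifted_op T c)"
  unfolding linear_operator_def shifted_op_def by (auto simp: linear_operator_add linear_operator_scale algebra_simps)

lemma shifted_pow_linear: "linear_operator (shifted_op T c ^^ p)"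
proof (induction p)
  case 0
  then show ?case by (simp add: linear_operator_def)
next
  case (Suc p)
  then show ?case using shifted_linear[of c] by (simp add: linear_operator_def)
qed

lemma shifted_pow_add:
  "(shifted_op T c ^^ p) (\<lambda>z. f z + g z) = (\<lambda>z. (shifted_op T c ^^ p) f z + (shifted_op T c ^^ p) g z)"
  and shifted_pow_scale: "(shifted_op T c ^^ p) (\<lambda>z. a * f z) = (\<lambda>z. a * (shifted_op T c ^^ p) f z)"
  using shifted_pow_linear[of p c] by (auto simp: linear_operator_def)

lemma shifted_pow_zero: "(shifted_op T c ^^ p) (\<lambda>_. 0) = (\<lambda>_. 0)"
  using shifted_pow_scale[where a = 0 and f = "\<lambda>_. 0"] by simp

lemma shifted_zero: "shifted_op T c (\<lambda>_. 0) = (\<lambda>_. 0)"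
  using shifted_pow_zero[where p = 1] by simp

lemma gen_eigenspace_space: "function_space (gen_eigenspace T c)"
  unfolding function_space_def
proof (intro conjI ballI allI)
  let ?N = "\<lambda>p. shifted_op T c ^^ p"
  show "(\<lambda>_. 0) \<in> gen_eigenspace T c"
    unfolding gen_eigenspace_def by (auto intro: exI[of _ 0])
  fix f assume "f \<in> gen_eigenspace T c"
  then obtain p where p: "?N p f = (\<lambda>_. 0)" by (auto simp: gen_eigenspace_def)
  show "(\<lambda>z. a * f z) \<in> gen_eigenspace T c" for a
  proof -
    have "?N p (\<lambda>z. a * f z) = (\<lambda>z. a * ?N p f z)" by (rule shifted_pow_scale)
    then show ?thesis using p by (auto simp: gen_eigenspace_def intro!: exI[of _ p])
  qed
  fix g assume "g \<in> gen_eigenspace T c"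
  then obtain q where q: "?N q g = (\<lambda>_. 0)" by (auto simp: gen_eigenspace_def)
  have "?N (p + q) (\<lambda>z. f z + g z) = (\<lambda>z. ?N (p + q) f z + ?N (p + q) g z)"
    by (rule shifted_pow_add)
  moreover have "?N (p + q) g = (\<lambda>_. 0)" using q by (simp add: funpow_add shifted_pow_zero)
  moreover have "?N (p + q) f = (\<lambda>_. 0)" using p by (simp add: funpow_add[of q p] add.commute[of p q] shifted_pow_zero)
  ultimately show "(\<lambda>z. f z + g z) \<in> gen_eigenspace T c" by (auto simp: gen_eigenspace_def intro!: exI[of _ "p + q"])
qed

text \<open>On the kernel of a power of \<open>T - d\<close> the operator \<open>T - c\<close> is
  the scalar \<open>d - c\<close> plus a nilpotent, hence invertible. The recursion is
  \<open>h = (g - h') / (d - c)\<close>, where \<open>h'\<close> solves the equation with right-hand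
  side \<open>(T - d) g\<close>; it never leaves \<open>S\<close>.\<close>

lemma shifted_solve:
  assumes S: "function_space S" and TS: "\<And>f. f \<in> S \<Longrightarrow> T f \<in> S"
    and ne: "d \<noteq> c" and g: "g \<in> S" "(shifted_op T d ^^ p) g = (\<lambda>_. 0)"
  shows "\<exists>h\<in>S. shifted_op T c h = g \<and> (shifted_op T d ^^ p) h = (\<lambda>_. 0)"
  using g
proof (induction p arbitrary: g)
  case 0
  then show ?case using S by (intro bexI[of _ "\<lambda>_. 0"]) (auto simp: function_space_def shifted_op_def linear_operator_zero)
next
  case (Suc p)
  let ?g' = "shifted_op T d g"
  have g'S: "?g' \<in> S"
  proof -
    have "(\<lambda>z. d * g z) \<in> S" using S Suc.prems(1) by (rule function_space_scale)
    then show ?thesis using function_space_diff[OF S TS[OF Suc.prems(1)]] by (simp add: shifted_op_def[abs_def])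
  qed
  have "(shifted_op T d ^^ p) ?g' = (\<lambda>_. 0)" using Suc.prems(2) by (simp add: funpow_Suc_right del: funpow.simps)
  then obtain h' where h': "h' \<in> S" "shifted_op T c h' = ?g'" "(shifted_op T d ^^ p) h' = (\<lambda>_. 0)"
    using Suc.IH g'S by blast
  define h where "h z = inverse (d - c) * (g z + (-1) * h' z)" for z
  have hS: "h \<in> S"
    unfolding h_def[abs_def] by (intro function_space_scale function_space_add S Suc.prems(1) h'(1))
  have pow_h: "(shifted_op T e ^^ n) h
      = (\<lambda>z. inverse (d - c) * ((shifted_op T e ^^ n) g z + (-1) * (shifted_op T e ^^ n) h' z))" for e n
    unfolding h_def[abs_def] shifted_pow_scale shifted_pow_add ..
  have "shifted_op T c h = g"
  proof
    fix z
    have "shifted_op T c g z + (-1) * shifted_op T c h' z = (d - c) * g z"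
      unfolding h'(2) by (simp add: shifted_op_def algebra_simps)
    then show "shifted_op T c h z = g z" using ne pow_h[where n = 1] by simp
  qed
  moreover have "(shifted_op T d ^^ Suc p) h = (\<lambda>_. 0)"
  proof -
    have "(shifted_op T d ^^ Suc p) h' = (\<lambda>_. 0)" using h'(3) by (simp add: shifted_zero)
    then show ?thesis unfolding pow_h Suc.prems(2) by simp
  qed
  ultimately show ?case using hS by blast
qed

lemma decomposable_mono: "decomposable T S D f \<Longrightarrow> D \<subseteq> D' \<Longrightarrow> S \<subseteq> S' \<Longrightarrow> decomposable T S' D' f"
proof -
  assume f: "decomposable T S D f" and sub: "D \<subseteq> D'" "S \<subseteq> S'"
  obtain C g where "finite C" "C \<subseteq> D" "\<forall>d\<in>C. g d \<in> S \<and> g d \<in> gen_eigenspace T d" "f = (\<lambda>z. \<Sum>d\<in>C. g d z)"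
    using f unfolding decomposable_def by blast
  then show ?thesis unfolding decomposable_def using sub by (intro exI[of _ C] exI[of _ g]) auto
qed

lemma decomposable_zero: "decomposable T S D (\<lambda>_. 0)"
  unfolding decomposable_def by (intro exI[of _ "{}"]) auto

lemma decomposable_eigen: "f \<in> S \<Longrightarrow> f \<in> gen_eigenspace T d \<Longrightarrow> d \<in> D \<Longrightarrow> decomposable T S D f"
  unfolding decomposable_def by (intro exI[of _ "{d}"] exI[of _ "\<lambda>_. f"]) auto

lemma decomposable_scale:
  assumes S: "function_space S" and f: "decomposable T S D f"
  shows "decomposable T S D (\<lambda>z. c * f z)"
proof -
  obtain C g where C: "finite C" "C \<subseteq> D" "\<forall>d\<in>C. g d \<in> S \<and> g d \<in> gen_eigenspace T d" "f = (\<lambda>z. \<Sum>d\<in>C. g d z)"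
    using f unfolding decomposable_def by blast
  then show ?thesis using S gen_eigenspace_space unfolding decomposable_def function_space_def
    by (intro exI[of _ C] exI[of _ "\<lambda>d z. c * g d z"]) (simp add: sum_distrib_left)
qed

lemma decomposable_add:
  assumes S: "function_space S" and f: "decomposable T S D f" and f': "decomposable T S D f'"
  shows "decomposable T S D (\<lambda>z. f z + f' z)"
proof -
  obtain C g where C: "finite C" "C \<subseteq> D" "\<forall>d\<in>C. g d \<in> S \<and> g d \<in> gen_eigenspace T d" "f = (\<lambda>z. \<Sum>d\<in>C. g d z)"
    using f unfolding decomposable_def by blast
  obtain C' g' where C': "finite C'" "C' \<subseteq> D" "\<forall>d\<in>C'. g' d \<in> S \<and> g' d \<in> gen_eigenspace T d" "f' = (\<lambda>z. \<Sum>d\<in>C'. g' d z)"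
    using f' unfolding decomposable_def by blast
  define e where "e d = (if d \<in> C then g d else (\<lambda>_. 0))" for d
  define e' where "e' d = (if d \<in> C' then g' d else (\<lambda>_. 0))" for d
  have e: "e d \<in> S \<and> e d \<in> gen_eigenspace T d" "e' d \<in> S \<and> e' d \<in> gen_eigenspace T d" for d
    using C(3) C'(3) S gen_eigenspace_space[of d] by (auto simp: e_def e'_def function_space_def)
  have f1: "f = (\<lambda>z. \<Sum>d\<in>C \<union> C'. e d z)"
    unfolding C(4) using C(1) C'(1) by (intro ext sum.mono_neutral_cong_left) (auto simp: e_def)
  have f2: "f' = (\<lambda>z. \<Sum>d\<in>C \<union> C'. e' d z)"
    unfolding C'(4) using C(1) C'(1) by (intro ext sum.mono_neutral_cong_left) (auto simp: e'_def)
  have "(\<lambda>z. e d z + e' d z) \<in> S \<and> (\<lambda>z. e d z + e' d z) \<in> gen_eigenspace T d" for d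
    using e[of d] by (intro conjI function_space_add S gen_eigenspace_space) auto
  moreover have "(\<lambda>z. f z + f' z) = (\<lambda>z. \<Sum>d\<in>C \<union> C'. e d z + e' d z)"
    unfolding f1 f2 by (simp add: sum.distrib)
  ultimately show ?thesis unfolding decomposable_def using C C'
    by (intro exI[of _ "C \<union> C'"] exI[of _ "\<lambda>d z. e d z + e' d z"]) auto
qed

lemma decomposable_solve:
  assumes S: "function_space S" and TS: "\<And>f. f \<in> S \<Longrightarrow> T f \<in> S"
    and g: "decomposable T S D g" and c: "c \<notin> D"
  shows "\<exists>h\<in>S. shifted_op T c h = g \<and> decomposable T S D h"
proof -
  obtain C g' where C: "finite C" "C \<subseteq> D" "\<forall>d\<in>C. g' d \<in> S \<and> g' d \<in> gen_eigenspace T d" "g = (\<lambda>z. \<Sum>d\<in>C. g' d z)"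
    using g unfolding decomposable_def by blast
  have "\<exists>h\<in>S. shifted_op T c h = g' d \<and> h \<in> gen_eigenspace T d" if d: "d \<in> C" for d
  proof -
    obtain p where "(shifted_op T d ^^ p) (g' d) = (\<lambda>_. 0)" using C(3) d by (auto simp: gen_eigenspace_def)
    moreover have "d \<noteq> c" using d C(2) c by auto
    ultimately show ?thesis using shifted_solve[OF S TS, of d c "g' d" p] C(3) d by (auto simp: gen_eigenspace_def)
  qed
  then obtain h where h: "\<And>d. d \<in> C \<Longrightarrow> h d \<in> S \<and> shifted_op T c (h d) = g' d \<and> h d \<in> gen_eigenspace T d"
    by metis
  define H where "H z = (\<Sum>d\<in>C. h d z)" for z
  have "H \<in> S" unfolding H_def[abs_def] using h by (intro function_space_sum[OF S]) auto
  moreover have "shifted_op T c H = g"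
  proof
    fix z
    have "shifted_op T c H z = (\<Sum>d\<in>C. shifted_op T c (h d) z)"
      by (simp add: shifted_op_def H_def[abs_def] linear_operator_sum sum_subtractf sum_distrib_left)
    also have "\<dots> = g z" unfolding C(4) using h by (intro sum.cong) auto
    finally show "shifted_op T c H z = g z" .
  qed
  moreover have "decomposable T S D H"
    unfolding decomposable_def using C(1,2) h H_def[abs_def] by (intro exI[of _ C] exI[of _ h]) auto
  ultimately show ?thesis by blast
qed

text \<open>The triangular step. The components of \<open>(T - c) f\<close> at eigenvalues other
  than \<open>c\<close> are solved away by \<open>h\<close>; the operator \<open>T - c\<close> sends
  the rest \<open>f - h\<close> into the generalised eigenspace of \<open>c\<close>, so
  \<open>f - h\<close> lies there itself.\<close>

lemma decomposable_insert:
  assumes S: "function_space S" and TS: "\<And>f. f \<in> S \<Longrightarrow> T f \<in> S" and f: "f \<in> S"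
    and g: "decomposable T S D (shifted_op T c f)"
  shows "decomposable T S (insert c D) f"
proof -
  obtain C g' where C: "finite C" "C \<subseteq> D" "\<forall>d\<in>C. g' d \<in> S \<and> g' d \<in> gen_eigenspace T d"
      "shifted_op T c f = (\<lambda>z. \<Sum>d\<in>C. g' d z)"
    using g unfolding decomposable_def by blast
  define G where "G z = (\<Sum>d\<in>C - {c}. g' d z)" for z
  have "decomposable T S (D - {c}) G"
    unfolding decomposable_def using C by (intro exI[of _ "C - {c}"] exI[of _ g']) (auto simp: G_def[abs_def])
  from decomposable_solve[OF S TS this, of c] obtain h where h: "h \<in> S" "shifted_op T c h = G"
    "decomposable T S (D - {c}) h" by auto
  define k where "k z = f z - h z" for z
  have k: "shifted_op T c k = (if c \<in> C then g' c else (\<lambda>_. 0))"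
  proof
    fix z
    have "shifted_op T c k z = shifted_op T c f z - shifted_op T c h z"
      by (simp add: shifted_op_def k_def[abs_def] linear_operator_diff algebra_simps)
    also have "\<dots> = (if c \<in> C then g' c else (\<lambda>_. 0)) z"
      unfolding h(2) C(4) G_def using C(1) by (auto simp: sum.remove[of C c])
    finally show "shifted_op T c k z = (if c \<in> C then g' c else (\<lambda>_. 0)) z" .
  qed
  have "shifted_op T c k \<in> gen_eigenspace T c"
    using C(3) gen_eigenspace_space[of c] unfolding k function_space_def by auto
  then obtain p where "(shifted_op T c ^^ p) (shifted_op T c k) = (\<lambda>_. 0)" by (auto simp: gen_eigenspace_def)
  then have "(shifted_op T c ^^ Suc p) k = (\<lambda>_. 0)" by (simp add: funpow_Suc_right del: funpow.simps)
  then have "k \<in> gen_eigenspace T c" unfolding gen_eigenspace_def by blast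
  moreover have "k \<in> S" unfolding k_def[abs_def] by (rule function_space_diff[OF S f h(1)])
  ultimately have "decomposable T S (insert c D) k" by (intro decomposable_eigen) auto
  moreover have "decomposable T S (insert c D) h" using h(3) by (rule decomposable_mono) auto
  ultimately have "decomposable T S (insert c D) (\<lambda>z. k z + h z)" by (rule decomposable_add[OF S])
  then show ?thesis by (simp add: k_def)
qed

text \<open>A power of \<open>T - e\<close> removes one summand and preserves the eigenspaces of the
  others, so by induction it annihilates each remaining \<open>g d\<close>. Since \<open>g d\<close>
  is also annihilated by a power of \<open>T - d\<close> and \<open>d \<noteq> e\<close>, it is
  zero.\<close>

lemma gen_eigenspace_independent:
  assumes "finite C" "\<And>d. d \<in> C \<Longrightarrow> g d \<in> gen_eigenspace T d" "(\<lambda>z. \<Sum>d\<in>C. g d z) = (\<lambda>_. 0)" "c \<in> C"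
  shows "g c = (\<lambda>_. 0)"
  using assms
proof (induction C arbitrary: g c rule: finite_induct)
  case (insert e C)
  obtain p where p: "(shifted_op T e ^^ p) (g e) = (\<lambda>_. 0)" using insert.prems(1)[of e] by (auto simp: gen_eigenspace_def)
  have commute: "shifted_op T e (shifted_op T d f) = shifted_op T d (shifted_op T e f)" for d f
    unfolding shifted_op_def[abs_def] by (auto simp: linear_operator_diff linear_operator_scale algebra_simps)
  have inv: "shifted_op T e f \<in> gen_eigenspace T d" if f: "f \<in> gen_eigenspace T d" for d f
  proof -
    obtain q where q: "(shifted_op T d ^^ q) f = (\<lambda>_. 0)" using f by (auto simp: gen_eigenspace_def)
    have "(shifted_op T d ^^ q) (shifted_op T e f) = shifted_op T e ((shifted_op T d ^^ q) f)"
      by (induction q) (simp_all add: commute)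
    also have "\<dots> = (\<lambda>_. 0)" unfolding q using shifted_zero by simp
    finally show ?thesis unfolding gen_eigenspace_def by blast
  qed
  have invp: "(shifted_op T e ^^ n) f \<in> gen_eigenspace T d" if "f \<in> gen_eigenspace T d" for d f n
    using that by (induction n) (auto intro: inv)
  have powsum: "(shifted_op T e ^^ n) (\<lambda>z. \<Sum>d\<in>I. f d z) = (\<lambda>z. \<Sum>d\<in>I. (shifted_op T e ^^ n) (f d) z)" for n I and f :: "complex \<Rightarrow> 'z \<Rightarrow> complex"
  proof (induction I rule: infinite_finite_induct)
    case (insert x F)
    have "(shifted_op T e ^^ n) (\<lambda>z. f x z + (\<lambda>z. \<Sum>d\<in>F. f d z) z)
       = (\<lambda>z. (shifted_op T e ^^ n) (f x) z + (shifted_op T e ^^ n) (\<lambda>z. \<Sum>d\<in>F. f d z) z)"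
      by (rule shifted_pow_add)
    then show ?case using insert by simp
  qed (simp_all add: shifted_pow_zero)
  have "(\<lambda>z. \<Sum>d\<in>C. (shifted_op T e ^^ p) (g d) z) = (\<lambda>_. 0)"
  proof -
    have "(\<lambda>z. \<Sum>d\<in>insert e C. (shifted_op T e ^^ p) (g d) z) = (\<lambda>_. 0)"
      unfolding powsum[symmetric] insert.prems(2) by (rule shifted_pow_zero)
    then show ?thesis using insert.hyps p by simp
  qed
  then have zero: "(shifted_op T e ^^ p) (g d) = (\<lambda>_. 0)" if "d \<in> C" for d
    using insert.IH[of "\<lambda>d. (shifted_op T e ^^ p) (g d)" d] insert.prems(1) invp that by simp
  have gd: "g d = (\<lambda>_. 0)" if d: "d \<in> C" for d
  proof -
    have ne: "d \<noteq> e" using d insert.hyps by auto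
    obtain q where q: "(shifted_op T d ^^ q) (g d) = (\<lambda>_. 0)" using insert.prems(1)[of d] d by (auto simp: gen_eigenspace_def)
    \<comment> \<open>On a function killed by \<open>T - e\<close> the operator \<open>T - d\<close>
      acts as the nonzero scalar \<open>e - d\<close>, hence it cannot be nilpotent there.\<close>
    have "f = (\<lambda>_. 0)" if "(shifted_op T d ^^ q) f = (\<lambda>_. 0)" "shifted_op T e f = (\<lambda>_. 0)" for f
      using that
    proof (induction q arbitrary: f)
      case (Suc q)
      let ?f = "shifted_op T d f"
      have "(shifted_op T d ^^ q) ?f = (\<lambda>_. 0)" using Suc.prems(1) by (simp add: funpow_Suc_right del: funpow.simps)
      moreover have "shifted_op T e ?f = (\<lambda>_. 0)" using commute[of d f] Suc.prems(2) shifted_zero by simp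
      ultimately have "?f = (\<lambda>_. 0)" by (rule Suc.IH)
      then have fz: "shifted_op T d f z = 0" for z by (rule fun_cong)
      have "(d - e) * f z = 0" for z
      proof -
        have "(d - e) * f z = shifted_op T e f z - shifted_op T d f z"
          by (simp add: shifted_op_def algebra_simps)
        also have "\<dots> = 0" using fz[of z] fun_cong[OF Suc.prems(2), of z] by simp
        finally show ?thesis .
      qed
      then show ?case using ne by auto
    qed simp
    note base = this
    have step: "(shifted_op T d ^^ q) ((shifted_op T e ^^ n) (g d)) = (\<lambda>_. 0)" for n
    proof -
      have c1: "(shifted_op T d ^^ q) (shifted_op T e f) = shifted_op T e ((shifted_op T d ^^ q) f)" for f
        by (induction q) (simp_all add: commute)
      show ?thesis
      proof (induction n)
        case (Suc n)
        then show ?case using shifted_zero by (simp add: c1)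
      qed (simp add: q)
    qed
    \<comment> \<open>The powers of \<open>T - e\<close> are stripped off one at a time, each time
      by \<open>base\<close>.\<close>
    have "(shifted_op T e ^^ (p - n)) (g d) = (\<lambda>_. 0)" for n
    proof (induction n)
      case (Suc n)
      show ?case
      proof (cases "n < p")
        case True
        then have "p - n = Suc (p - Suc n)" by simp
        then show ?thesis using base[OF step[of "p - Suc n"]] Suc by simp
      next
        case False
        then show ?thesis using Suc by simp
      qed
    qed (simp add: zero[OF d])
    from this[of p] show ?thesis by simp
  qed
  show ?case
  proof (cases "c = e")
    case True
    have "(\<lambda>z. g e z) = (\<lambda>_. 0)" using insert.prems(2) insert.hyps gd by (simp add: fun_eq_iff)
    then show ?thesis using True by simp
  next
    case False
    then show ?thesis using gd insert.prems(3) by simp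
  qed
qed simp

end

subsection \<open>The transition operator on weighted polynomials\<close>

context polya_jordan
begin

abbreviation "\<Phi> \<equiv> transition_op w l"

lemma Phi_linear: "linear_operator \<Phi>"
  unfolding linear_operator_def transition_op_def
  by (auto simp: fun_eq_iff sum.distrib[symmetric] sum_distrib_left algebra_simps intro!: sum.cong)

lemma char_subspace_eq: "char_subspace w l c = polynomial_functions \<inter> gen_eigenspace \<Phi> c"
proof -
  have "(\<lambda>g z. \<Phi> g z - c * g z) = shifted_op \<Phi> c" by (simp add: shifted_op_def fun_eq_iff)
  then show ?thesis by (auto simp: char_subspace_def gen_eigenspace_def)
qed

text \<open>A monomial \<open>u\<^sup>\<alpha>\<close> is represented by a list in which the index \<open>k\<close> occurs \<open>\<alpha>\<^sub>k\<close> times.\<close>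

definition monomial :: "nat list \<Rightarrow> 'a \<times> 'a \<Rightarrow> complex" where
  "monomial ks z = (\<Prod>k\<leftarrow>ks. u k z)"

lemma monomial_simps [simp]: "monomial [] = (\<lambda>_. 1)" "monomial (k # ks) = (\<lambda>z. u k z * monomial ks z)"
  by (simp_all add: fun_eq_iff monomial_def)

definition mono_root :: "nat list \<Rightarrow> complex" where
  "mono_root ks = (\<Sum>k\<leftarrow>ks. \<Lambda> k)"

lemma mono_root_simps [simp]: "mono_root [] = 0" "mono_root (k # ks) = \<Lambda> k + mono_root ks"
  by (auto simp: mono_root_def)

inductive_set mono_span :: "(nat list \<Rightarrow> bool) \<Rightarrow> ('a \<times> 'a \<Rightarrow> complex) set" for P where
  zero: "(\<lambda>_. 0) \<in> mono_span P"
| step: "f \<in> mono_span P \<Longrightarrow> set ks \<subseteq> {1..DIM('a)} \<Longrightarrow> P ks \<Longrightarrow> (\<lambda>z. f z + c * monomial ks z) \<in> mono_span P"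

lemma mono_span_mono_base: "set ks \<subseteq> {1..DIM('a)} \<Longrightarrow> P ks \<Longrightarrow> monomial ks \<in> mono_span P"
  using mono_span.step[OF mono_span.zero, of ks P 1] by simp

lemma mono_span_mono:
  assumes f: "f \<in> mono_span P" and Q: "\<And>ks. set ks \<subseteq> {1..DIM('a)} \<Longrightarrow> P ks \<Longrightarrow> Q ks"
  shows "f \<in> mono_span Q"
  using f
proof (induction rule: mono_span.induct)
  case (step f ks c)
  show ?case by (rule mono_span.step[OF step.IH step.hyps(2)]) (rule Q[OF step.hyps(2,3)])
qed (rule mono_span.zero)

lemma mono_span_add: "g \<in> mono_span P \<Longrightarrow> f \<in> mono_span P \<Longrightarrow> (\<lambda>z. f z + g z) \<in> mono_span P"
proof (induction rule: mono_span.induct)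
  case (step g ks c)
  have "(\<lambda>z. (\<lambda>z. f z + g z) z + c * monomial ks z) \<in> mono_span P" using step by (intro mono_span.step) auto
  then show ?case by (simp add: add.assoc)
qed simp

lemma mono_span_scale: "f \<in> mono_span P \<Longrightarrow> (\<lambda>z. a * f z) \<in> mono_span P"
proof (induction rule: mono_span.induct)
  case (step f ks c)
  have "(\<lambda>z. (\<lambda>z. a * f z) z + (a * c) * monomial ks z) \<in> mono_span P" using step by (intro mono_span.step) auto
  then show ?case by (simp add: algebra_simps)
qed (simp add: mono_span.zero)

lemma mono_span_space: "function_space (mono_span P)"
  unfolding function_space_def using mono_span_add mono_span_scale mono_span.zero by blast

lemma mono_span_sum: "(\<And>i. i \<in> I \<Longrightarrow> f i \<in> mono_span P) \<Longrightarrow> (\<lambda>z. \<Sum>i\<in>I. f i z) \<in> mono_span P"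
  by (rule function_space_sum[OF mono_span_space])

lemma mono_span_form_mult:
  assumes k: "k \<in> {1..DIM('a)}" and Q: "\<And>ks. P ks \<Longrightarrow> Q (k # ks)"
  shows "f \<in> mono_span P \<Longrightarrow> (\<lambda>z. u k z * f z) \<in> mono_span Q"
proof (induction rule: mono_span.induct)
  case (step f ks c)
  have "(\<lambda>z. (\<lambda>z. u k z * f z) z + c * monomial (k # ks) z) \<in> mono_span Q"
    using step Q k by (intro mono_span.step) auto
  then show ?case by (simp add: algebra_simps)
qed (simp add: mono_span.zero)

lemma monomial_polynomial: "set ks \<subseteq> {1..DIM('a)} \<Longrightarrow> monomial ks \<in> polynomial_functions"
proof (induction ks)
  case (Cons k ks)
  then show ?case unfolding monomial_simps
    by (intro polynomial_functions.mult polynomial_functions.form[OF u_form]) auto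
qed (simp add: polynomial_functions.const)

lemma mono_span_polynomial: "f \<in> mono_span P \<Longrightarrow> f \<in> polynomial_functions"
  by (induction rule: mono_span.induct)
    (auto intro!: polynomial_functions.const polynomial_functions.add polynomial_functions.mult monomial_polynomial)

end

section \<open>Weights and the triangular action of the transition operator\<close>

locale polya_weights = polya_jordan M X x1 w l u v \<Lambda> \<epsilon>
  for M :: "'b measure" and X :: "nat \<Rightarrow> 'b \<Rightarrow> 'a::euclidean_space"
    and x1 :: 'a and w :: "nat \<Rightarrow> 'a" and l :: "nat \<Rightarrow> 'a \<Rightarrow> real"
    and u :: "nat \<Rightarrow> 'a \<times> 'a \<Rightarrow> complex" and v :: "nat \<Rightarrow> 'a \<times> 'a"
    and \<Lambda> :: "nat \<Rightarrow> complex" and \<epsilon> :: "nat \<Rightarrow> nat" +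
  fixes \<sigma> :: real
  assumes \<sigma>_half: "\<sigma> > 1/2" and \<sigma>_less_1: "\<sigma> < 1"
    and Re_Lam_le: "\<And>k. k \<in> {2..DIM('a)} \<Longrightarrow> Re (\<Lambda> k) \<le> \<sigma>"
begin

text \<open>A common upper bound for \<open>Re (\<Lambda> k)\<close> and for the growth exponent, up
  to logarithms, of the \<open>k\<close>-th coordinate. Smaller real parts are not distinguished,
  since only terms of top order matter.\<close>

definition weight :: "nat \<Rightarrow> real" where
  "weight k = (if k = 1 then 1 else \<sigma>)"

definition mono_weight :: "nat list \<Rightarrow> real" where
  "mono_weight ks = (\<Sum>k\<leftarrow>ks. weight k)"

lemma mono_weight_simps [simp]: "mono_weight [] = 0" "mono_weight (k # ks) = weight k + mono_weight ks"
  by (auto simp: mono_weight_def)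

lemma weight_bounds: "\<sigma> \<le> weight k" "weight k \<le> 1" "0 < weight k"
  using \<sigma>_half \<sigma>_less_1 by (auto simp: weight_def)

lemma Re_Lam_le_weight: "k \<in> {1..DIM('a)} \<Longrightarrow> Re (\<Lambda> k) \<le> weight k"
  using Re_Lam_le[of k] Lam_1 by (auto simp: weight_def)

text \<open>Only index 1 has a different weight, and it cannot precede an index with
  \<open>\<epsilon> k = 1\<close>, because that chain would lie at the eigenvalue 1. So the
  nilpotent part preserves weights.\<close>

lemma weight_pred:
  assumes k: "k \<in> {1..DIM('a)}" and e: "\<epsilon> k = 1"
  shows "weight (k - 1) = weight k"
proof -
  have "k \<ge> 2" "\<Lambda> k = \<Lambda> (k - 1)" using eps_Lam[OF k e] by auto
  moreover have "k - 1 \<noteq> 1" using eps_1_imp_Lam[OF k e] calculation Lam_1 by auto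
  ultimately show ?thesis by (auto simp: weight_def)
qed

lemma Re_mono_root_le: "set ks \<subseteq> {1..DIM('a)} \<Longrightarrow> Re (mono_root ks) \<le> mono_weight ks"
  using Re_Lam_le_weight by (induction ks) (auto intro: add_mono)

text \<open>A difference in direction \<open>y\<close> has lost at least one factor, and every
  factor weighs at least \<open>\<sigma>\<close>.\<close>

lemma difference_mono:
  assumes "set ks \<subseteq> {1..DIM('a)}"
  shows "(\<lambda>z. monomial ks (z + y) - monomial ks z)
    \<in> mono_span (\<lambda>ks'. length ks' < length ks \<and> mono_weight ks' \<le> mono_weight ks - \<sigma>)"
  using assms
proof (induction ks)
  case Nil
  then show ?case by (simp add: mono_span.zero)
next
  case (Cons k ks)
  let ?P = "\<lambda>ks ks'. length ks' < length ks \<and> mono_weight ks' \<le> mono_weight ks - \<sigma>"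
  let ?D = "\<lambda>z. monomial ks (z + y) - monomial ks z"
  have k: "k \<in> {1..DIM('a)}" and ks: "set ks \<subseteq> {1..DIM('a)}" using Cons.prems by auto
  have D: "?D \<in> mono_span (?P ks)" using Cons by simp
  have 1: "(\<lambda>z. u k z * ?D z) \<in> mono_span (?P (k # ks))"
    by (rule mono_span_form_mult[OF k _ D]) auto
  have 2: "(\<lambda>z. u k y * monomial ks z) \<in> mono_span (?P (k # ks))"
    using weight_bounds[of k] by (intro mono_span_scale mono_span_mono_base ks) auto
  have 3: "(\<lambda>z. u k y * ?D z) \<in> mono_span (?P (k # ks))"
    using weight_bounds[of k] by (intro mono_span_scale mono_span_mono[OF D]) auto
  have "(\<lambda>z. u k z * ?D z + (u k y * monomial ks z + u k y * ?D z)) \<in> mono_span (?P (k # ks))"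
    by (intro mono_span_add 1 2 3)
  moreover have "u k (z + y) = u k z + u k y" for z by (rule complex_linear_form_add[OF u_form[OF k]])
  ultimately show ?case by (simp add: algebra_simps)
qed

text \<open>The first alternative comes from the terms of order at least two in the Taylor expansion, which remove
  two factors and insert one linear form; the second from the nilpotent part of the endomorphism.\<close>

definition lower :: "nat list \<Rightarrow> nat list \<Rightarrow> bool" where
  "lower ks ks' \<longleftrightarrow>
     length ks' < length ks \<and> mono_weight ks' \<le> mono_weight ks + 1 - 2 * \<sigma> \<or>
     length ks' = length ks \<and> sum_list ks' < sum_list ks \<and> mono_weight ks' = mono_weight ks \<and> (\<exists>k\<in>set ks. \<epsilon> k = 1)"

text \<open>For a product of \<open>u k\<close> and a monomial \<open>g\<close>, \<Phi> obeys a
  Leibniz rule with three terms: \<open>u k\<close> times \<Phi> of \<open>g\<close>, the image of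
  \<open>u k\<close> under the endomorphism times \<open>g\<close>, and a mixed sum of
  \<open>l j\<close> times a difference of \<open>g\<close>. In the mixed sum \<open>u k\<close> and
  one factor of \<open>g\<close> are gone, at least \<open>2 * \<sigma>\<close> in weight, and
  \<open>l j\<close> brings back at most 1.\<close>

lemma Phi_mono:
  assumes "set ks \<subseteq> {1..DIM('a)}"
  shows "shifted_op \<Phi> (mono_root ks) (monomial ks) \<in> mono_span (lower ks)"
  using assms
proof (induction ks)
  case Nil
  have "shifted_op \<Phi> (mono_root []) (monomial []) = (\<lambda>_. 0)"
    by (simp add: shifted_op_def transition_op_def fun_eq_iff)
  then show ?case by (simp add: mono_span.zero)
next
  case (Cons k ks)
  let ?L = "mono_span (lower (k # ks))"
  have k: "k \<in> {1..DIM('a)}" and ks: "set ks \<subseteq> {1..DIM('a)}" using Cons.prems by auto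
  let ?D = "\<lambda>j z. monomial ks (z + cembed (w j)) - monomial ks z"
  let ?x = "\<lambda>j. cext_form (l j)"
  have 1: "(\<lambda>z. u k z * shifted_op \<Phi> (mono_root ks) (monomial ks) z) \<in> ?L"
    by (rule mono_span_form_mult[OF k _ Cons.IH[OF ks]]) (auto simp: lower_def)
  have 2: "(\<lambda>z. of_nat (\<epsilon> k) * (u (k - 1) z * monomial ks z)) \<in> ?L"
  proof (cases "\<epsilon> k = 1")
    case True
    have k1: "k \<ge> 2" "k - 1 \<in> {1..DIM('a)}" using eps_Lam[OF k True] by auto
    then have "monomial ((k - 1) # ks) \<in> ?L" using ks True weight_pred[OF k True]
      by (intro mono_span_mono_base) (auto simp: lower_def)
    then show ?thesis using True by simp
  next
    case False
    then show ?thesis using eps_01[OF k] by (simp add: mono_span.zero)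
  qed
  have 3: "(\<lambda>z. ?x j z * ?D j z) \<in> ?L" if j: "j \<in> {1..DIM('a)}" for j
  proof -
    from form_expansion[OF cext_form_l[OF j]]
    obtain c where c: "\<forall>z. ?x j z = (\<Sum>i=1..DIM('a). c i * u i z)" ..
    have "(\<lambda>z. u i z * ?D j z) \<in> ?L" if i: "i \<in> {1..DIM('a)}" for i
      by (rule mono_span_form_mult[OF i _ difference_mono[OF ks]])
        (use weight_bounds[of i] weight_bounds[of k] in \<open>auto simp: lower_def\<close>)
    then have "(\<lambda>z. \<Sum>i=1..DIM('a). c i * (u i z * ?D j z)) \<in> ?L"
      by (intro mono_span_sum mono_span_scale)
    moreover have "?x j z * ?D j z = (\<Sum>i=1..DIM('a). c i * (u i z * ?D j z))" for z
      unfolding c[rule_format, of z] by (simp add: sum_distrib_right mult.assoc)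
    ultimately show ?thesis by (simp only:)
  qed
  have 4: "(\<lambda>z. \<Sum>j=1..DIM('a). u k (cembed (w j)) * (?x j z * ?D j z)) \<in> ?L"
    by (intro mono_span_sum mono_span_scale 3)
  have eq: "shifted_op \<Phi> (mono_root (k # ks)) (monomial (k # ks)) z =
      u k z * shifted_op \<Phi> (mono_root ks) (monomial ks) z + (of_nat (\<epsilon> k) * (u (k - 1) z * monomial ks z)
      + (\<Sum>j=1..DIM('a). u k (cembed (w j)) * (?x j z * ?D j z)))" for z
  proof -
    have uk: "u k (z + y) = u k z + u k y" for y by (rule complex_linear_form_add[OF u_form[OF k]])
    have A: "(\<Sum>j=1..DIM('a). ?x j z * u k (cembed (w j))) = \<Lambda> k * u k z + of_nat (\<epsilon> k) * u (k - 1) z"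
      using u_A[OF k, of z] cext_endo_form[OF u_form[OF k], of z] by simp
    have "\<Phi> (monomial (k # ks)) z = (\<Sum>j=1..DIM('a). u k z * (?x j z * ?D j z) + (?x j z * u k (cembed (w j))) * monomial ks z
        + u k (cembed (w j)) * (?x j z * ?D j z))"
      unfolding transition_op_def monomial_simps uk by (intro sum.cong) (auto simp: algebra_simps)
    also have "\<dots> = u k z * \<Phi> (monomial ks) z + (\<Lambda> k * u k z + of_nat (\<epsilon> k) * u (k - 1) z) * monomial ks z
        + (\<Sum>j=1..DIM('a). u k (cembed (w j)) * (?x j z * ?D j z))"
      unfolding sum.distrib A[symmetric] transition_op_def sum_distrib_left sum_distrib_right ..
    finally show ?thesis by (simp add: shifted_op_def algebra_simps)
  qed
  show ?case unfolding eq[abs_def, folded fun_eq_iff] fun_eq_iff[symmetric]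
    using mono_span_add[OF mono_span_add[OF 4 2] 1] eq by (simp add: fun_eq_iff[symmetric] ext)
qed

definition weight_space :: "real \<Rightarrow> ('a \<times> 'a \<Rightarrow> complex) set" where
  "weight_space \<theta> = mono_span (\<lambda>ks. mono_weight ks \<le> \<theta>)"

lemma weight_space_space: "function_space (weight_space \<theta>)"
  by (simp add: weight_space_def mono_span_space)

lemma lower_weight: "lower ks ks' \<Longrightarrow> mono_weight ks' \<le> mono_weight ks"
  using \<sigma>_half by (auto simp: lower_def)

lemma Phi_weight_space: "f \<in> weight_space \<theta> \<Longrightarrow> \<Phi> f \<in> weight_space \<theta>"
  unfolding weight_space_def
proof (induction rule: mono_span.induct)
  case zero
  then show ?case by (simp add: linear_operator_zero[OF Phi_linear] mono_span.zero)
next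
  case (step f ks c)
  let ?S = "mono_span (\<lambda>ks. mono_weight ks \<le> \<theta>)"
  have "shifted_op \<Phi> (mono_root ks) (monomial ks) \<in> ?S"
    using Phi_mono[OF step.hyps(2)] by (rule mono_span_mono) (use lower_weight step.hyps(3) in force)
  moreover have "(\<lambda>z. mono_root ks * monomial ks z) \<in> ?S"
    using step.hyps by (intro mono_span_scale mono_span_mono_base)
  ultimately have "(\<lambda>z. shifted_op \<Phi> (mono_root ks) (monomial ks) z + mono_root ks * monomial ks z) \<in> ?S"
    by (rule mono_span_add[rotated])
  then have "\<Phi> (monomial ks) \<in> ?S" by (simp add: shifted_op_def)
  then have "(\<lambda>z. \<Phi> f z + c * \<Phi> (monomial ks) z) \<in> ?S"
    using step.IH by (intro mono_span_add mono_span_scale)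
  then show ?case by (simp add: linear_operator_add[OF Phi_linear] linear_operator_scale[OF Phi_linear])
qed

lemma mono_span_decomposable:
  assumes f: "f \<in> mono_span P" and S: "function_space S"
    and P: "\<And>ks. set ks \<subseteq> {1..DIM('a)} \<Longrightarrow> P ks \<Longrightarrow> decomposable \<Phi> S D (monomial ks)"
  shows "decomposable \<Phi> S D f"
  using f
proof (induction rule: mono_span.induct)
  case zero
  show ?case by (rule decomposable_zero[OF Phi_linear])
next
  case (step f ks c)
  show ?case
    by (intro decomposable_add[OF Phi_linear S] decomposable_scale[OF Phi_linear S] step.IH P step.hyps)
qed

text \<open>The induction is lexicographic in length and index sum: the first alternative of
  \<open>lower\<close> shortens the list, the second keeps its length and lowers an index. The
  weight itself would not do, being unchanged in the second case.\<close>

lemma mono_decomposable: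
  assumes "set ks \<subseteq> {1..DIM('a)}"
  shows "decomposable \<Phi> (weight_space (mono_weight ks)) {d. Re d \<le> mono_weight ks} (monomial ks)"
  using assms
proof (induction ks rule: wf_induct_rule[OF wf_measures[of "[length, sum_list]"]])
  case (1 ks)
  let ?S = "weight_space (mono_weight ks)" and ?D = "{d. Re d \<le> mono_weight ks}"
  have "decomposable \<Phi> ?S ?D (shifted_op \<Phi> (mono_root ks) (monomial ks))"
  proof (rule mono_span_decomposable[OF Phi_mono[OF "1.prems"] weight_space_space])
    fix ks' assume ks': "set ks' \<subseteq> {1..DIM('a)}" "lower ks ks'"
    have le: "mono_weight ks' \<le> mono_weight ks" using lower_weight[OF ks'(2)] .
    have "(ks', ks) \<in> measures [length, sum_list]" using ks'(2) by (auto simp: lower_def)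
    then have "decomposable \<Phi> (weight_space (mono_weight ks')) {d. Re d \<le> mono_weight ks'} (monomial ks')"
      using "1.IH" ks'(1) by blast
    then show "decomposable \<Phi> ?S ?D (monomial ks')"
      by (rule decomposable_mono[OF Phi_linear]) (use le in \<open>auto simp: weight_space_def intro: mono_span_mono\<close>)
  qed
  moreover have "monomial ks \<in> ?S"
    unfolding weight_space_def by (rule mono_span_mono_base[OF "1.prems"]) simp
  ultimately have "decomposable \<Phi> ?S (insert (mono_root ks) ?D) (monomial ks)"
    by (intro decomposable_insert[OF Phi_linear weight_space_space Phi_weight_space])
  moreover have "insert (mono_root ks) ?D = ?D" using Re_mono_root_le[OF "1.prems"] by auto
  ultimately show ?case by simp
qed

text \<open>All factors have real part exactly \<open>\<sigma>\<close>, so the eigenvalue of the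
  monomial has real part \<open>mono_weight ks\<close>. As \<open>\<epsilon>\<close> vanishes on
  them, only the first alternative of \<open>lower\<close> occurs, and the defect of the monomial
  has spectrum at real part smaller by at least \<open>2 * \<sigma> - 1\<close>. Solving for
  \<open>h\<close> in that space leaves an honest eigenvector \<open>Q\<close>.\<close>

lemma reduced_decomposition:
  assumes ks: "set ks \<subseteq> {2..DIM('a)}" "\<And>k. k \<in> set ks \<Longrightarrow> \<epsilon> k = 0 \<and> Re (\<Lambda> k) = \<sigma>"
  obtains Q h where "monomial ks = (\<lambda>z. Q z + h z)" "shifted_op \<Phi> (mono_root ks) Q = (\<lambda>_. 0)"
    "Q \<in> polynomial_functions" "h \<in> weight_space (mono_weight ks + 1 - 2 * \<sigma>)"
    "char_component w l (mono_root ks) (monomial ks) = Q"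
proof -
  let ?c = "mono_root ks" and ?\<theta> = "mono_weight ks + 1 - 2 * \<sigma>"
  have ks1: "set ks \<subseteq> {1..DIM('a)}" using ks by auto
  have Rec: "Re ?c = mono_weight ks"
    using ks by (induction ks) (auto simp: weight_def)
  have "shifted_op \<Phi> ?c (monomial ks) \<in> mono_span (lower ks)" by (rule Phi_mono[OF ks1])
  then have "decomposable \<Phi> (weight_space ?\<theta>) {d. Re d \<le> ?\<theta>} (shifted_op \<Phi> ?c (monomial ks))"
  proof (rule mono_span_decomposable[OF _ weight_space_space])
    fix ks' assume ks': "set ks' \<subseteq> {1..DIM('a)}" "lower ks ks'"
    have "\<not> (\<exists>k\<in>set ks. \<epsilon> k = 1)" using ks(2) by fastforce
    then have le: "mono_weight ks' \<le> ?\<theta>" using ks'(2) unfolding lower_def by blast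
    show "decomposable \<Phi> (weight_space ?\<theta>) {d. Re d \<le> ?\<theta>} (monomial ks')"
      using mono_decomposable[OF ks'(1)] by (rule decomposable_mono[OF Phi_linear])
        (use le in \<open>auto simp: weight_space_def intro: mono_span_mono\<close>)
  qed
  from decomposable_solve[OF Phi_linear weight_space_space Phi_weight_space this, of ?c]
  obtain h where h: "h \<in> weight_space ?\<theta>" "shifted_op \<Phi> ?c h = shifted_op \<Phi> ?c (monomial ks)"
    "decomposable \<Phi> (weight_space ?\<theta>) {d. Re d \<le> ?\<theta>} h"
    using \<sigma>_half Rec by auto
  obtain C g where C: "finite C" "C \<subseteq> {d. Re d \<le> ?\<theta>}" "\<And>d. d \<in> C \<Longrightarrow> g d \<in> weight_space ?\<theta> \<and> g d \<in> gen_eigenspace \<Phi> d"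
     "h = (\<lambda>z. \<Sum>d\<in>C. g d z)"
    using h(3) unfolding decomposable_def by blast
  have cC: "?c \<notin> C" using C(2) Rec \<sigma>_half by auto
  define Q where "Q z = monomial ks z - h z" for z
  have ws_poly: "f \<in> polynomial_functions" if "f \<in> weight_space \<theta>" for f \<theta>
    using that mono_span_polynomial by (auto simp: weight_space_def)
  have Qker: "shifted_op \<Phi> ?c Q = (\<lambda>_. 0)"
  proof
    fix z
    have "shifted_op \<Phi> ?c Q z = shifted_op \<Phi> ?c (monomial ks) z - shifted_op \<Phi> ?c h z"
      by (simp add: shifted_op_def Q_def[abs_def] linear_operator_diff[OF Phi_linear] algebra_simps)
    then show "shifted_op \<Phi> ?c Q z = 0" using h(2) by simp
  qed
  have "(\<lambda>z. monomial ks z + (-1) * h z) \<in> polynomial_functions"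
    by (intro polynomial_functions.add monomial_polynomial ks1 polynomial_functions.mult polynomial_functions.const ws_poly[OF h(1)])
  then have Qpoly: "Q \<in> polynomial_functions" by (simp add: Q_def[abs_def])
  have Qgen: "Q \<in> gen_eigenspace \<Phi> ?c" using Qker unfolding gen_eigenspace_def by (auto intro!: exI[of _ 1])
  have "char_component w l ?c (monomial ks) = Q"
    unfolding char_component_def
  proof (rule the_equality)
    let ?g = "\<lambda>d. if d = ?c then Q else g d"
    show "\<exists>C g. finite C \<and> ?c \<in> C \<and> (\<forall>d\<in>C. g d \<in> char_subspace w l d) \<and> monomial ks = (\<lambda>z. \<Sum>d\<in>C. g d z) \<and> Q = g ?c"
    proof (intro exI[of _ "insert ?c C"] exI[of _ ?g] conjI ballI)
      show "?g d \<in> char_subspace w l d" if "d \<in> insert ?c C" for d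
        using that C(3) Qpoly Qgen cC ws_poly by (auto simp: char_subspace_eq)
      have "(\<Sum>d\<in>insert ?c C. ?g d z) = Q z + (\<Sum>d\<in>C. g d z)" for z
        using C(1) cC by (auto intro!: sum.cong)
      then show "monomial ks = (\<lambda>z. \<Sum>d\<in>insert ?c C. ?g d z)" by (simp add: Q_def C(4) fun_eq_iff)
    qed (use C(1) in auto)
    fix q assume "\<exists>C g. finite C \<and> ?c \<in> C \<and> (\<forall>d\<in>C. g d \<in> char_subspace w l d) \<and> monomial ks = (\<lambda>z. \<Sum>d\<in>C. g d z) \<and> q = g ?c"
    then obtain C' g' where C': "finite C'" "?c \<in> C'" "\<And>d. d \<in> C' \<Longrightarrow> g' d \<in> gen_eigenspace \<Phi> d"
      "monomial ks = (\<lambda>z. \<Sum>d\<in>C'. g' d z)" "q = g' ?c" by (auto simp: char_subspace_eq)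
    \<comment> \<open>Two decompositions may use different finite sets of eigenvalues; extending
      both by 0 allows a termwise comparison.\<close>
    define e where "e d = (if d \<in> C' then g' d else (\<lambda>_. 0))" for d
    define e' where "e' d = (if d = ?c then Q else if d \<in> C then g d else (\<lambda>_. 0))" for d
    let ?I = "insert ?c (C \<union> C')"
    have zero: "(\<lambda>_. 0) \<in> gen_eigenspace \<Phi> d" for d
      using gen_eigenspace_space[OF Phi_linear, of d] by (simp add: function_space_def)
    have "(\<lambda>z. e d z - e' d z) \<in> gen_eigenspace \<Phi> d" for d
      using C(3) C'(3) Qgen zero
      by (intro function_space_diff[OF gen_eigenspace_space[OF Phi_linear]]) (auto simp: e_def e'_def)
    moreover have "(\<Sum>d\<in>?I. e d z - e' d z) = 0" for z
    proof -
      have "(\<Sum>d\<in>?I. e d z) = (\<Sum>d\<in>C'. g' d z)"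
        using C(1) C'(1) by (intro sum.mono_neutral_cong_right) (auto simp: e_def)
      moreover have "(\<Sum>d\<in>?I. e' d z) = (\<Sum>d\<in>insert ?c C. e' d z)"
        using C(1) C'(1) by (intro sum.mono_neutral_cong_right) (auto simp: e'_def)
      moreover have "(\<Sum>d\<in>insert ?c C. e' d z) = Q z + (\<Sum>d\<in>C. g d z)"
        using C(1) cC by (auto simp: e'_def intro!: sum.cong)
      moreover have "(\<Sum>d\<in>C'. g' d z) = monomial ks z" by (simp add: C'(4))
      ultimately show ?thesis by (simp add: sum_subtractf Q_def C(4))
    qed
    ultimately have "(\<lambda>z. e ?c z - e' ?c z) = (\<lambda>_. 0)"
      using C(1) C'(1) by (intro gen_eigenspace_independent[OF Phi_linear, of ?I "\<lambda>d z. e d z - e' d z"]) auto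
    then show "q = Q" using C'(2,5) by (simp add: e_def e'_def fun_eq_iff)
  qed
  then show ?thesis using that[of Q h] Qker Qpoly h(1) by (simp add: Q_def fun_eq_iff)
qed

end

subsection \<open>Coordinates along a Jordan basis\<close>

lemma ln_power_times_powr_tendsto_0:
  assumes "a < b"
  shows "(\<lambda>n. real n powr a * (1 + ln (real n)) ^ N / real n powr b) \<longlonglongrightarrow> 0"
  using assms by real_asymp

text \<open>The quotient for Stolz-Cesaro: the factor \<open>1 / (i + 1)\<close> gained at each link
  of a chain builds up the \<open>1 / \<nu>!\<close> of the expansion.\<close>

lemma ln_power_increment:
  "(\<lambda>n. ln (real n) ^ i / (real n * (ln (real (Suc n)) ^ Suc i - ln (real n) ^ Suc i))) \<longlonglongrightarrow> 1 / real (Suc i)"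
  by (real_asymp simp: field_simps)

lemma ln_power_bigo: "(\<lambda>n. real n powr \<sigma> * (1 + ln (real n)) ^ \<nu>) \<in> O(\<lambda>n. real n powr \<sigma> * ln (real n) ^ \<nu>)"
  by real_asymp

lemma ln_power_ratio: "(\<lambda>n. ln (real n) ^ i / (1 + ln (real n)) ^ i) \<longlonglongrightarrow> 1"
  by real_asymp

lemma ln_power_strict: "eventually (\<lambda>n. ln (real n) ^ Suc i < ln (real (Suc n)) ^ Suc i) sequentially"
  by real_asymp

lemma ln_power_top: "filterlim (\<lambda>n. ln (real n) ^ Suc i) at_top sequentially"
  by real_asymp

lemma of_nat_over_shift_tendsto_1: "(\<lambda>n. of_nat n / (of_nat n + c :: complex)) \<longlonglongrightarrow> 1"
proof -
  have "(\<lambda>n. 1 / (1 + c / of_nat n)) \<longlonglongrightarrow> 1 / (1 + 0)"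
    by (intro tendsto_intros lim_const_over_n) simp
  moreover have "eventually (\<lambda>n. 1 / (1 + c / of_nat n) = of_nat n / (of_nat n + c)) sequentially"
    using eventually_gt_at_top[of 0] by eventually_elim (auto simp: field_simps)
  ultimately show ?thesis by (auto intro: Lim_transform_eventually)
qed

lemma (in prob_space) dominated_tendsto_0:
  fixes R :: "nat \<Rightarrow> 'a \<Rightarrow> 'v::real_normed_vector"
  assumes "dominated M g R" and g: "g \<longlonglongrightarrow> 0"
  shows "AE \<omega> in M. (\<lambda>n. R n \<omega>) \<longlonglongrightarrow> 0"
proof -
  obtain K where K: "AE \<omega> in M. \<forall>n\<ge>1. norm (R n \<omega>) \<le> K \<omega> * g n"
    using assms(1) unfolding dominated_def by blast
  show ?thesis using K
  proof eventually_elim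
    case (elim \<omega>)
    have lim: "(\<lambda>n. K \<omega> * g n) \<longlonglongrightarrow> 0" using tendsto_mult[OF tendsto_const g] by simp
    have "eventually (\<lambda>n. norm (R n \<omega>) \<le> K \<omega> * g n) sequentially"
      using elim by (intro eventually_sequentiallyI[of 1]) simp
    then show ?case using lim by (rule Lim_null_comparison)
  qed
qed

context polya_weights
begin

definition coord :: "nat \<Rightarrow> nat \<Rightarrow> 'b \<Rightarrow> complex" where
  "coord k n \<omega> = u k (cembed (X n \<omega>))"

text \<open>The noise with index \<open>j\<close> enters the coordinate at time \<open>j + 1\<close>
  and is normalised by the factor at that time.\<close>

definition transform :: "nat \<Rightarrow> complex \<Rightarrow> nat \<Rightarrow> 'b \<Rightarrow> complex" where
  "transform k c n \<omega> = (\<Sum>j=1..<n. inverse (polya_factor \<tau> c (Suc j)) * u k (cembed (noise j \<omega>)))"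

text \<open>For \<open>k = 1\<close> the predecessor has the unspecified index 0, but its
  coefficient \<open>\<epsilon> 1\<close> is 0.\<close>

lemma coord_Suc:
  assumes k: "k \<in> {1..DIM('a)}" and n: "n \<ge> 1"
  shows "coord k (Suc n) \<omega> = (1 + \<Lambda> k / of_real (real n + \<tau> - 1)) * coord k n \<omega>
    + of_nat (\<epsilon> k) * coord (k - 1) n \<omega> / of_real (real n + \<tau> - 1) + u k (cembed (noise n \<omega>))"
proof -
  let ?d = "real n + \<tau> - 1"
  have "X (Suc n) \<omega> = X n \<omega> + (1 / ?d) *\<^sub>R A (X n \<omega>) + noise n \<omega>" by (simp add: noise_def)
  then have "coord k (Suc n) \<omega> = coord k n \<omega> + of_real (1 / ?d) * u k (cext_endo A (cembed (X n \<omega>))) + u k (cembed (noise n \<omega>))"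
    by (simp only: coord_def cembed_add cembed_scaleR complex_linear_form_add[OF u_form[OF k]]
        complex_linear_form_cscale[OF u_form[OF k]] cext_endo_embed)
  then show ?thesis unfolding u_A[OF k] coord_def[symmetric]
    by (simp add: distrib_right add_divide_distrib del: of_real_add of_real_diff)
qed

lemma transform_1 [simp]: "transform k c (Suc 0) \<omega> = 0"
  by (simp add: transform_def)

lemma transform_Suc:
  "n \<ge> 1 \<Longrightarrow> transform k c (Suc n) \<omega> = transform k c n \<omega> + u k (cembed (noise n \<omega>)) / polya_factor \<tau> c (Suc n)"
  by (simp add: transform_def divide_inverse mult.commute)

text \<open>The exponent \<open>c\<close> is independent of the eigenvalue of \<open>u k\<close>, so
  that subcritical coordinates can be normalised with a real exponent above 1/2.\<close>

lemma transform_limit: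
  assumes k: "k \<in> {1..DIM('a)}" and c: "Re c > 1/2"
  obtains U where "U \<in> borel_measurable M" "AE \<omega> in M. (\<lambda>n. transform k c n \<omega>) \<longlonglongrightarrow> U \<omega>"
    "dominated M (\<lambda>_. 1) (transform k c)" "dominated M (\<lambda>_. 1) (\<lambda>_. U)"
proof -
  obtain B where B: "B > 0" "\<And>n. n \<ge> 1 \<Longrightarrow> norm (inverse (polya_factor \<tau> c n)) \<le> B * real n powr (- Re c)"
  proof -
    have "Re c \<ge> 0" using c by simp
    from polya_factor_bounds[OF tau_pos this] show ?thesis using that by metis
  qed
  have c': "norm (inverse (polya_factor \<tau> c (Suc j))) \<le> B * real j powr (- Re c)" if j: "j \<ge> 1" for j
  proof -
    have "real (Suc j) powr (- Re c) \<le> real j powr (- Re c)" using j c by (intro powr_mono2') auto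
    then have "B * real (Suc j) powr (- Re c) \<le> B * real j powr (- Re c)" using B(1) by simp
    then show ?thesis using B(2)[of "Suc j"] by simp
  qed
  have f1: "u k (cembed (r *\<^sub>R x)) = of_real r * u k (cembed x)" for r x
    by (simp only: cembed_scaleR complex_linear_form_cscale[OF u_form[OF k]])
  have f2: "u k (cembed (x + y)) = u k (cembed x) + u k (cembed y)" for x y
    by (simp only: cembed_add complex_linear_form_add[OF u_form[OF k]])
  obtain U where U: "U \<in> borel_measurable M"
    "dominated M (\<lambda>n. real n powr (- (Re c - 1/2) / 2)) (\<lambda>n \<omega>. transform k c n \<omega> - U \<omega>)"
    unfolding transform_def
    by (rule martingale_transform_limit[of "u k" "Re c" "\<lambda>j. inverse (polya_factor \<tau> c (Suc j))" B, OF f1 f2 c c'])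
  have g1: "real n powr (- (Re c - 1/2) / 2) \<le> 1" if "n \<ge> 1" for n
  proof -
    have "real n powr (- (Re c - 1/2) / 2) \<le> real n powr 0" using that c by (intro powr_mono) auto
    then show ?thesis using that by simp
  qed
  have conv: "AE \<omega> in M. (\<lambda>n. transform k c n \<omega>) \<longlonglongrightarrow> U \<omega>"
  proof -
    have "(\<lambda>n. real n powr (- (Re c - 1/2) / 2)) \<longlonglongrightarrow> 0" using c by real_asymp
    from dominated_tendsto_0[OF U(2) this] show ?thesis
      by eventually_elim (simp add: LIM_zero_cancel)
  qed
  have diff: "dominated M (\<lambda>_. 1) (\<lambda>n \<omega>. transform k c n \<omega> - U \<omega>)"
    by (rule dominated_mono[OF U(2) g1])
  \<comment> \<open>For a constant sequence, domination by 1 says that the variable has moments of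
    all orders.\<close>
  have domU: "dominated M (\<lambda>_. 1) (\<lambda>_. U)"
    unfolding dominated_def
  proof
    fix p :: nat
    obtain K where K: "K \<in> borel_measurable M" "\<And>\<omega>. 0 \<le> K \<omega>" "integrable M (\<lambda>\<omega>. K \<omega> ^ p)"
      "AE \<omega> in M. \<forall>n\<ge>1. norm (transform k c n \<omega> - U \<omega>) \<le> K \<omega> * 1"
      using diff unfolding dominated_def by blast
    have "AE \<omega> in M. \<forall>n\<ge>(1::nat). norm (U \<omega>) \<le> K \<omega> * 1"
      using K(4)
    proof eventually_elim
      case (elim \<omega>)
      from elim[rule_format, of 1] show ?case by simp
    qed
    then show "\<exists>K\<in>borel_measurable M. (\<forall>\<omega>. 0 \<le> K \<omega>) \<and> integrable M (\<lambda>\<omega>. K \<omega> ^ p) \<and>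
        (AE \<omega> in M. \<forall>n\<ge>(1::nat). norm (U \<omega>) \<le> K \<omega> * 1)" using K(1-3) by blast
  qed
  have "dominated M (\<lambda>_. 1) (\<lambda>n \<omega>. (transform k c n \<omega> - U \<omega>) + U \<omega>)"
    by (rule dominated_add[OF diff domU]) simp
  then have "dominated M (\<lambda>_. 1) (transform k c)" by simp
  with U(1) conv domU that show ?thesis by blast
qed

text \<open>Normalisation uses \<open>\<rho>\<close> in place of \<open>\<Lambda> k\<close>, at the
  price of a multiplier \<open>b n\<close> that contracts. The induction runs along the chain: the
  predecessor has the same eigenvalue and is already of order \<open>n powr \<rho>\<close>, so after
  normalisation it contributes only order \<open>1 / n\<close>.\<close>

lemma coord_subcritical:
  assumes \<rho>: "\<rho> > 1/2" and sub: "\<And>k. k \<in> {2..DIM('a)} \<Longrightarrow> Re (\<Lambda> k) < \<sigma> \<Longrightarrow> Re (\<Lambda> k) < \<rho>"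
  shows "k \<in> {2..DIM('a)} \<Longrightarrow> Re (\<Lambda> k) < \<sigma> \<Longrightarrow> dominated M (\<lambda>n. real n powr \<rho>) (coord k)"
proof (induction k rule: less_induct)
  case (less k)
  have k: "k \<in> {1..DIM('a)}" using less.prems by auto
  define d where "d n = real n + \<tau> - 1" for n
  have d: "d n > 0" if "n \<ge> 1" for n using denominator_pos[OF that] by (simp add: d_def)
  define pf where "pf n = polya_factor \<tau> (of_real \<rho>) n" for n
  obtain B where B: "B > 0" "\<And>n. n \<ge> 1 \<Longrightarrow> norm (pf n) \<le> B * real n powr \<rho>"
    "\<And>n. n \<ge> 1 \<Longrightarrow> norm (inverse (pf n)) \<le> B * real n powr (- \<rho>)"
  proof -
    have "Re (complex_of_real \<rho>) \<ge> 0" using \<rho> by simp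
    from polya_factor_bounds[OF tau_pos this] show ?thesis using that unfolding pf_def Re_complex_of_real by metis
  qed
  have pf0: "pf n \<noteq> 0" if "n \<ge> 1" for n
    using polya_factor_nonzero[OF tau_pos _ that, of "of_real \<rho>"] \<rho> by (simp add: pf_def)
  define b where "b n = (1 + \<Lambda> k / of_real (d n)) / (1 + of_real \<rho> / of_real (d n))" for n
  have Re: "Re (\<Lambda> k) < \<rho>" using sub less.prems by blast
  obtain \<kappa> where \<kappa>: "\<kappa> > 0" "eventually (\<lambda>n. norm (b n) \<le> 1 - \<kappa> / d n) sequentially"
    using norm_factor_quotient_bound[OF Re tau_pos] unfolding b_def d_def by blast
  obtain C where C: "C \<ge> 0"
    "\<And>(r :: nat \<Rightarrow> complex) H n. (\<And>n. n \<ge> 1 \<Longrightarrow> norm (r (Suc n) - b n * r n) \<le> H / d n) \<Longrightarrow> n \<ge> 1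
       \<Longrightarrow> norm (r n) \<le> C * (norm (r 1) + H)"
    using perturbed_contraction_bounded[of d \<kappa> b, OF d \<kappa>] by blast
  define T where "T = transform k (of_real \<rho>)"
  have T: "dominated M (\<lambda>_. 1) T"
  proof -
    have "Re (complex_of_real \<rho>) > 1/2" using \<rho> by simp
    from transform_limit[OF k this] show ?thesis unfolding T_def by metis
  qed
  define Y where "Y n \<omega> = of_nat (\<epsilon> k) * coord (k - 1) n \<omega>" for n \<omega>
  have Y: "dominated M (\<lambda>n. real n powr \<rho>) Y"
  proof (cases "\<epsilon> k = 1")
    case True
    have "k - 1 \<noteq> 1"
    proof
      assume "k - 1 = 1"
      then have "\<Lambda> k = 1" using eps_Lam[OF k True] Lam_1 by simp
      then show False using eps_1_imp_Lam[OF k True] by simp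
    qed
    then have "k - 1 < k" "k - 1 \<in> {2..DIM('a)}" "Re (\<Lambda> (k - 1)) < \<sigma>"
      using eps_Lam[OF k True] less.prems by auto
    from less.IH[OF this] show ?thesis using True by (simp add: Y_def[abs_def])
  next
    case False
    then have "Y = (\<lambda>_ _. 0)" using eps_01[OF k] by (auto simp: Y_def fun_eq_iff)
    then show ?thesis by (simp add: dominated_bounded[of _ 0])
  qed
  define c0 where "c0 = norm (u k (cembed x1))"
  define D where "D = norm (\<Lambda> k - of_real \<rho>)"
  show ?case
  \<comment> \<open>In the constant, the outer \<open>B\<close> returns from normalised to actual
    coordinates, \<open>C\<close> comes from the contraction, \<open>c0\<close> is the starting
    value, \<open>D\<close> and the inner \<open>B\<close> measure the perturbations by
    \<open>T\<close> and \<open>Y\<close>, and 1 accounts for adding \<open>T\<close> back.\<close>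
  proof (rule dominated_combine[of "UNIV :: bool set" "\<lambda>i n. if i then 1 else real n powr \<rho>" "\<lambda>i. if i then T else Y"
        "B * (C * (c0 + D + B) + 1)"])
    show "dominated M (\<lambda>n. if i then 1 else real n powr \<rho>) (if i then T else Y)" for i
      using T Y by (cases i) auto
    show "0 \<le> B * (C * (c0 + D + B) + 1)" using B(1) C(1) by (simp add: c0_def D_def)
    show "AE \<omega> in M. \<forall>h. (\<forall>i\<in>UNIV. h i \<ge> 0 \<and> (\<forall>n\<ge>1. norm ((if i then T else Y) n \<omega>) \<le> h i * (if i then 1 else real n powr \<rho>))) \<longrightarrow>
       (\<forall>n\<ge>1. norm (coord k n \<omega>) \<le> B * (C * (c0 + D + B) + 1) * (1 + (\<Sum>i\<in>UNIV. h i)) * real n powr \<rho>)"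
      using AE_start
    proof eventually_elim
      case (elim \<omega>)
      show ?case
      proof (intro allI impI)
        fix h n
        assume h: "\<forall>i\<in>UNIV. (0::real) \<le> h i \<and> (\<forall>n\<ge>1. norm ((if i then T else Y) n \<omega>) \<le> h i * (if i then 1 else real n powr \<rho>))"
          and n: "(1::nat) \<le> n"
        have hT: "h True \<ge> 0" "\<And>n. n \<ge> 1 \<Longrightarrow> norm (T n \<omega>) \<le> h True" using bspec[OF h, of True] by auto
        have hY: "h False \<ge> 0" "\<And>n. n \<ge> 1 \<Longrightarrow> norm (Y n \<omega>) \<le> h False * real n powr \<rho>" using bspec[OF h, of False] by auto
        \<comment> \<open>Subtracting the convergent martingale leaves a contraction with perturbation of order \<open>1/n\<close>.\<close>
        define r where "r n = coord k n \<omega> / pf n - T n \<omega>" for n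
        define H where "H = D * h True + B * h False"
        have H0: "H \<ge> 0" using hT hY B by (simp add: H_def D_def)
        have step: "norm (r (Suc n) - b n * r n) \<le> H / d n" if n: "n \<ge> 1" for n
        proof -
          have dn: "d n > 0" by (rule d[OF n])
          have e1: "1 + of_real \<rho> / of_real (d n) \<noteq> (0::complex)"
          proof -
            have "Re (1 + of_real \<rho> / of_real (d n)) > 0" using \<rho> dn by (simp add: add_pos_pos)
            then show ?thesis by (metis zero_complex.sel(1) less_irrefl)
          qed
          have pS: "pf (Suc n) = pf n * (1 + of_real \<rho> / of_real (d n))"
            unfolding pf_def d_def by (rule polya_factor_Suc[OF n])
          have "coord k (Suc n) \<omega> / pf (Suc n) = b n * (coord k n \<omega> / pf n)
              + Y n \<omega> / of_real (d n) / pf (Suc n) + u k (cembed (noise n \<omega>)) / pf (Suc n)"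
            unfolding coord_Suc[OF k n] Y_def d_def[symmetric] add_divide_distrib
            using e1 pf0[OF n] by (simp add: b_def pS)
          moreover have "T (Suc n) \<omega> = T n \<omega> + u k (cembed (noise n \<omega>)) / pf (Suc n)"
            unfolding T_def pf_def by (rule transform_Suc[OF n])
          ultimately have eq: "r (Suc n) - b n * r n = (b n - 1) * T n \<omega> + Y n \<omega> / of_real (d n) / pf (Suc n)"
            by (simp add: r_def algebra_simps)
          have "b n - 1 = ((\<Lambda> k - of_real \<rho>) / of_real (d n)) / (1 + of_real \<rho> / of_real (d n))"
          proof -
            have gen: "(1 + a) / (1 + t) - 1 = (a - t) / (1 + t)" if "1 + t \<noteq> 0" for a t :: complex
            proof -
              have "a - t = (1 + a) - (1 + t)" by simp
              then show ?thesis using that by (simp only: diff_divide_distrib) simp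
            qed
            show ?thesis unfolding b_def gen[OF e1] diff_divide_distrib ..
          qed
          then have "norm (b n - 1) = D / d n / norm (1 + of_real \<rho> / of_real (d n) :: complex)"
            unfolding D_def by (simp only: norm_divide norm_of_real abs_of_pos[OF dn])
          also have "\<dots> \<le> D / d n / 1"
          proof (rule divide_left_mono)
            have "1 \<le> Re (1 + of_real \<rho> / of_real (d n))" using \<rho> dn by simp
            also have "\<dots> \<le> norm (1 + of_real \<rho> / of_real (d n) :: complex)" by (rule complex_Re_le_cmod)
            finally show "1 \<le> norm (1 + of_real \<rho> / of_real (d n) :: complex)" .
            show "0 < norm (1 + of_real \<rho> / of_real (d n) :: complex) * 1" using e1 by simp
          qed (use dn in \<open>simp add: D_def\<close>)
          finally have b1: "norm (b n - 1) \<le> D / d n" by simp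
          have "norm ((b n - 1) * T n \<omega>) \<le> D / d n * h True"
            unfolding norm_mult using b1 hT(2)[OF n] dn by (intro mult_mono) (auto simp: D_def)
          moreover have "norm (Y n \<omega> / of_real (d n) / pf (Suc n)) \<le> B * h False / d n"
          proof -
            have "norm (inverse (pf (Suc n))) \<le> B * real n powr (- \<rho>)"
            proof -
              have "real (Suc n) powr (- \<rho>) \<le> real n powr (- \<rho>)" using n \<rho> by (intro powr_mono2') auto
              then have "B * real (Suc n) powr (- \<rho>) \<le> B * real n powr (- \<rho>)" using B(1) by simp
              then show ?thesis using B(3)[of "Suc n"] by simp
            qed
            then have "norm (Y n \<omega>) * norm (inverse (pf (Suc n))) \<le> (h False * real n powr \<rho>) * (B * real n powr (- \<rho>))"
              using hY(2)[OF n] hY(1) by (intro mult_mono) auto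
            also have "\<dots> = B * h False" using n by (simp add: powr_minus)
            finally have "norm (Y n \<omega>) * norm (inverse (pf (Suc n))) / d n \<le> B * h False / d n"
              using dn by (intro divide_right_mono) auto
            moreover have "norm (Y n \<omega> / of_real (d n) / pf (Suc n)) = norm (Y n \<omega>) * norm (inverse (pf (Suc n))) / d n"
              by (simp only: norm_divide norm_inverse norm_of_real abs_of_pos[OF dn]) (simp add: divide_inverse mult_ac)
            ultimately show ?thesis by simp
          qed
          ultimately have "norm (r (Suc n) - b n * r n) \<le> D / d n * h True + B * h False / d n"
            unfolding eq by (rule norm_triangle_mono)
          then show ?thesis by (simp add: H_def add_divide_distrib)
        qed
        have r1: "norm (r 1) = c0"
          using elim by (simp add: r_def pf_def T_def coord_def c0_def)
        have rn: "norm (r n) \<le> C * (c0 + H)" using C(2)[OF step n] r1 by simp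
        have "coord k n \<omega> = pf n * (r n + T n \<omega>)" using pf0[OF n] by (simp add: r_def field_simps)
        then have "norm (coord k n \<omega>) \<le> (B * real n powr \<rho>) * (C * (c0 + H) + h True)"
          using B(2)[OF n] norm_triangle_mono[OF rn hT(2)[OF n]] B(1) by (auto simp: norm_mult intro!: mult_mono)
        also have "\<dots> \<le> (B * real n powr \<rho>) * ((C * (c0 + D + B) + 1) * (1 + (\<Sum>i\<in>UNIV. h i)))"
        proof (intro mult_left_mono)
          let ?s = "1 + (\<Sum>i\<in>UNIV. h i)"
          have s: "?s = 1 + h True + h False" by (simp add: UNIV_bool)
          have c00: "c0 \<ge> 0" "D \<ge> 0" by (simp_all add: c0_def D_def)
          have "c0 + H \<le> (c0 + D + B) * ?s"
            unfolding s H_def using c00 B(1) hT(1) hY(1) by (simp add: algebra_simps add_increasing add_increasing2)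
          then have "C * (c0 + H) \<le> C * ((c0 + D + B) * ?s)" using C(1) by (rule mult_left_mono)
          moreover have "h True \<le> 1 * ?s" unfolding s using hY(1) by simp
          ultimately show "C * (c0 + H) + h True \<le> (C * (c0 + D + B) + 1) * ?s" by (simp add: algebra_simps)
        qed (use B(1) in simp)
        finally show "norm (coord k n \<omega>) \<le> B * (C * (c0 + D + B) + 1) * (1 + (\<Sum>i\<in>UNIV. h i)) * real n powr \<rho>"
          by (simp add: algebra_simps)
      qed
    qed
  qed simp
qed

text \<open>Variation of constants. The predecessor appears over
  \<open>n + \<tau> - 1 + \<Lambda> k\<close> because the product at \<open>n + 1\<close> absorbs
  the factor \<open>n + \<tau> - 1\<close> from its denominator.\<close>

lemma coord_normalized:
  assumes k: "k \<in> {1..DIM('a)}" and Re: "Re (\<Lambda> k) \<ge> 0" and start: "X 1 \<omega> = x1" and n: "n \<ge> 1"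
  shows "coord k n \<omega> / polya_factor \<tau> (\<Lambda> k) n = u k (cembed x1) + transform k (\<Lambda> k) n \<omega>
     + of_nat (\<epsilon> k) * (\<Sum>j=1..<n. coord (k - 1) j \<omega> / polya_factor \<tau> (\<Lambda> k) j / (of_real (real j + \<tau> - 1) + \<Lambda> k))"
  using n
proof (induction n rule: dec_induct)
  case base
  then show ?case using start by (simp add: coord_def)
next
  case (step n)
  define d where "d = complex_of_real (real n + \<tau> - 1)"
  define p where "p = polya_factor \<tau> (\<Lambda> k) n"
  have d0: "d \<noteq> 0" using denominator_pos[OF step.hyps(1)] by (simp add: d_def del: of_real_add of_real_diff)
  have d1: "d + \<Lambda> k \<noteq> 0"
  proof -
    have "Re (d + \<Lambda> k) > 0" using denominator_pos[OF step.hyps(1)] Re by (simp add: d_def)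
    then show ?thesis by (metis zero_complex.sel(1) less_irrefl)
  qed
  have p0: "p \<noteq> 0" unfolding p_def by (rule polya_factor_nonzero[OF tau_pos Re step.hyps(1)])
  have pS: "polya_factor \<tau> (\<Lambda> k) (Suc n) = p * ((d + \<Lambda> k) / d)"
    unfolding p_def d_def polya_factor_Suc[OF step.hyps(1)] using d0 by (simp add: d_def add_divide_distrib)
  have "coord k (Suc n) \<omega> / (p * ((d + \<Lambda> k) / d)) = coord k n \<omega> / p
      + of_nat (\<epsilon> k) * (coord (k - 1) n \<omega> / p / (d + \<Lambda> k)) + u k (cembed (noise n \<omega>)) / (p * ((d + \<Lambda> k) / d))"
    unfolding coord_Suc[OF k step.hyps(1)] d_def[symmetric] add_divide_distrib
    using d0 d1 p0 by (simp add: divide_simps)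
  then show ?case
    unfolding transform_Suc[OF step.hyps(1)] pS using step.IH step.hyps(1)
    by (simp add: p_def d_def algebra_simps)
qed

end

lemma (in prob_space) dominated_cong_AE:
  assumes "dominated M g R" "AE \<omega> in M. \<forall>n\<ge>1. R n \<omega> = S n \<omega>"
  shows "dominated M g S"
  unfolding dominated_def
proof
  fix p :: nat
  obtain K where K: "K \<in> borel_measurable M" "\<And>\<omega>. 0 \<le> K \<omega>" "integrable M (\<lambda>\<omega>. K \<omega> ^ p)"
    "AE \<omega> in M. \<forall>n\<ge>1. norm (R n \<omega>) \<le> K \<omega> * g n"
    using assms(1) unfolding dominated_def by blast
  have "AE \<omega> in M. \<forall>n\<ge>1. norm (S n \<omega>) \<le> K \<omega> * g n"
    using K(4) assms(2) by eventually_elim auto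
  then show "\<exists>K\<in>borel_measurable M. (\<forall>\<omega>. 0 \<le> K \<omega>) \<and> integrable M (\<lambda>\<omega>. K \<omega> ^ p) \<and>
      (AE \<omega> in M. \<forall>n\<ge>1. norm (S n \<omega>) \<le> K \<omega> * g n)" using K(1-3) by blast
qed

lemma (in prob_space) dominated_const: "dominated M (\<lambda>_. 1) (\<lambda>_ _. c)"
  by (rule dominated_bounded[of _ "norm c"]) auto

lemma (in prob_space) dominated_ratio_tendsto_0:
  fixes R :: "nat \<Rightarrow> 'a \<Rightarrow> complex"
  assumes dom: "dominated M h R" and g: "\<And>n. n \<ge> 1 \<Longrightarrow> g n > 0" and hg: "(\<lambda>n. h n / g n) \<longlonglongrightarrow> 0"
  shows "AE \<omega> in M. (\<lambda>n. R n \<omega> / of_real (g n)) \<longlonglongrightarrow> 0"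
proof -
  obtain K where K: "AE \<omega> in M. \<forall>n\<ge>1. norm (R n \<omega>) \<le> K \<omega> * h n"
    using dom unfolding dominated_def by blast
  show ?thesis using K
  proof eventually_elim
    case (elim \<omega>)
    have lim: "(\<lambda>n. K \<omega> * (h n / g n)) \<longlonglongrightarrow> 0" using tendsto_mult[OF tendsto_const hg] by simp
    have "norm (R n \<omega> / of_real (g n)) \<le> K \<omega> * (h n / g n)" if "n \<ge> 1" for n
      using elim g[OF that] that by (simp add: norm_divide divide_right_mono)
    then have "eventually (\<lambda>n. norm (R n \<omega> / of_real (g n)) \<le> K \<omega> * (h n / g n)) sequentially"
      by (intro eventually_sequentiallyI[of 1])
    then show ?case using lim by (rule Lim_null_comparison)
  qed
qed

lemma one_plus_ln_ge_1: "n \<ge> 1 \<Longrightarrow> 1 + ln (real n) \<ge> 1"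
  by simp

context polya_weights
begin

text \<open>One variable \<open>Z\<close> serves the whole chain, hence its position before
  \<open>i\<close>: the martingale of each later form converges and is negligible against a power of
  the logarithm, so only the limit at the root survives, multiplied by \<open>ln n ^ i / i!\<close>
  after \<open>i\<close> summations.\<close>

lemma critical_coord:
  assumes m: "m \<in> {2..DIM('a)}" "\<epsilon> m = 0" "Re (\<Lambda> m) = \<sigma>"
  shows "\<exists>Z\<in>borel_measurable M. dominated M (\<lambda>_. 1) (\<lambda>_. Z) \<and>
    (\<forall>i. m + i \<le> DIM('a) \<longrightarrow> (\<forall>j. m < j \<and> j \<le> m + i \<longrightarrow> \<epsilon> j = 1) \<longrightarrow>
       dominated M (\<lambda>n. (1 + ln (real n)) ^ i) (\<lambda>n \<omega>. coord (m + i) n \<omega> / polya_factor \<tau> (\<Lambda> m) n) \<and>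
       (AE \<omega> in M. (\<lambda>n. coord (m + i) n \<omega> / polya_factor \<tau> (\<Lambda> m) n / of_real (ln (real n)) ^ i) \<longlonglongrightarrow> Z \<omega> / fact i))"
proof -
  have m1: "m \<in> {1..DIM('a)}" using m by auto
  have Re12: "Re (\<Lambda> m) > 1/2" and Re0: "Re (\<Lambda> m) \<ge> 0" using m \<sigma>_half by auto
  define pf where "pf = polya_factor \<tau> (\<Lambda> m)"
  obtain U where U: "U \<in> borel_measurable M" "AE \<omega> in M. (\<lambda>n. transform m (\<Lambda> m) n \<omega>) \<longlonglongrightarrow> U \<omega>"
    "dominated M (\<lambda>_. 1) (transform m (\<Lambda> m))" "dominated M (\<lambda>_. 1) (\<lambda>_. U)"
    using transform_limit[OF m1 Re12] by blast
  define Z where "Z \<omega> = u m (cembed x1) + U \<omega>" for \<omega>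
  have Zm: "Z \<in> borel_measurable M" unfolding Z_def using U(1) by measurable
  have Zd: "dominated M (\<lambda>_. 1) (\<lambda>_. Z)"
    unfolding Z_def using dominated_add[OF dominated_const U(4)] by simp
  have main: "dominated M (\<lambda>n. (1 + ln (real n)) ^ i) (\<lambda>n \<omega>. coord (m + i) n \<omega> / pf n) \<and>
       (AE \<omega> in M. (\<lambda>n. coord (m + i) n \<omega> / pf n / of_real (ln (real n)) ^ i) \<longlonglongrightarrow> Z \<omega> / fact i)"
    if "m + i \<le> DIM('a)" "\<And>j. m < j \<Longrightarrow> j \<le> m + i \<Longrightarrow> \<epsilon> j = 1" for i
    using that
  proof (induction i)
    case 0
    have eq: "AE \<omega> in M. \<forall>n\<ge>1. u m (cembed x1) + transform m (\<Lambda> m) n \<omega> = coord m n \<omega> / pf n"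
      using AE_start by eventually_elim (simp add: pf_def coord_normalized[OF m1 Re0] m(2))
    have "dominated M (\<lambda>_. 1) (\<lambda>n \<omega>. u m (cembed x1) + transform m (\<Lambda> m) n \<omega>)"
      by (rule dominated_add[OF dominated_const U(3)]) simp
    from dominated_cong_AE[OF this eq] have d: "dominated M (\<lambda>_. 1) (\<lambda>n \<omega>. coord m n \<omega> / pf n)" .
    have "AE \<omega> in M. (\<lambda>n. coord m n \<omega> / pf n) \<longlonglongrightarrow> Z \<omega>"
      using eq U(2)
    proof eventually_elim
      case (elim \<omega>)
      have "(\<lambda>n. u m (cembed x1) + transform m (\<Lambda> m) n \<omega>) \<longlonglongrightarrow> Z \<omega>"
        unfolding Z_def by (intro tendsto_intros elim)
      then show ?case
        by (rule Lim_transform_eventually) (use elim(1) in \<open>auto intro!: eventually_sequentiallyI[of 1]\<close>)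
    qed
    with d show ?case by simp
  next
    case (Suc i)
    define k where "k = m + Suc i"
    have k: "k \<in> {1..DIM('a)}" "\<epsilon> k = 1" "k - 1 = m + i" using Suc.prems by (auto simp: k_def)
    have Lk: "\<Lambda> k = \<Lambda> m" by (rule chain_Lam[OF m1]) (use Suc.prems k in \<open>auto simp: k_def\<close>)
    define z where "z n \<omega> = coord (m + i) n \<omega> / pf n" for n \<omega>
    have IH: "dominated M (\<lambda>n. (1 + ln (real n)) ^ i) z"
      "AE \<omega> in M. (\<lambda>n. z n \<omega> / of_real (ln (real n)) ^ i) \<longlonglongrightarrow> Z \<omega> / fact i"
      unfolding z_def using Suc by auto
    define e where "e j = complex_of_real (real j + \<tau> - 1) + \<Lambda> m" for j
    have e: "norm (e j) \<ge> real j / 2" "e j \<noteq> 0" if "j \<ge> 1" for j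
    proof -
      have "real j / 2 \<le> Re (e j)" using that tau_pos \<sigma>_half m(3) by (simp add: e_def)
      also have "\<dots> \<le> norm (e j)" by (rule complex_Re_le_cmod)
      finally show "norm (e j) \<ge> real j / 2" .
      then show "e j \<noteq> 0" using that by auto
    qed
    define S where "S n \<omega> = (\<Sum>j=1..<n. z j \<omega> / e j)" for n \<omega>
    \<comment> \<open>The denominators satisfy \<open>norm (e j) \<ge> j / 2\<close>, so the sum
      costs one harmonic sum, that is one more factor \<open>1 + ln n\<close>.\<close>
    have Sdom: "dominated M (\<lambda>n. (1 + ln (real n)) ^ Suc i) S"
    proof (rule dominated_combine[of "{()}" "\<lambda>_ n. (1 + ln (real n)) ^ i" "\<lambda>_. z" 2])
      show "AE \<omega> in M. \<forall>h. (\<forall>x\<in>{()}. h x \<ge> 0 \<and> (\<forall>n\<ge>1. norm (z n \<omega>) \<le> h x * (1 + ln (real n)) ^ i)) \<longrightarrow>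
         (\<forall>n\<ge>1. norm (S n \<omega>) \<le> 2 * (1 + (\<Sum>x\<in>{()}. h x)) * (1 + ln (real n)) ^ Suc i)"
      proof (intro AE_I2 allI impI)
        fix \<omega> and h :: "unit \<Rightarrow> real" and n :: nat
        assume h: "\<forall>x\<in>{()}. 0 \<le> h x \<and> (\<forall>n\<ge>1. norm (z n \<omega>) \<le> h x * (1 + ln (real n)) ^ i)" and n: "1 \<le> n"
        have "norm (S n \<omega>) \<le> (\<Sum>j=1..<n. (h () * (1 + ln (real n)) ^ i) * (2 * (1 / real j)))"
          unfolding S_def
        proof (rule sum_norm_le)
          fix j assume j: "j \<in> {1..<n}"
          have "norm (z j \<omega>) \<le> h () * (1 + ln (real j)) ^ i" using h j by auto
          also have "\<dots> \<le> h () * (1 + ln (real n)) ^ i"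
            using h j by (intro mult_left_mono power_mono) auto
          finally have 1: "norm (z j \<omega>) \<le> h () * (1 + ln (real n)) ^ i" .
          have 2: "1 / norm (e j) \<le> 2 * (1 / real j)"
            using e[of j] j by (simp add: field_simps)
          have "norm (z j \<omega> / e j) = norm (z j \<omega>) * (1 / norm (e j))" by (simp add: norm_divide)
          also have "\<dots> \<le> (h () * (1 + ln (real n)) ^ i) * (2 * (1 / real j))"
            using 1 2 by (intro mult_mono) (auto intro: order_trans[OF norm_ge_zero])
          finally show "norm (z j \<omega> / e j) \<le> (h () * (1 + ln (real n)) ^ i) * (2 * (1 / real j))" .
        qed
        also have "\<dots> = 2 * (h () * (1 + ln (real n)) ^ i) * (\<Sum>j=1..<n. 1 / real j)"
          by (simp add: sum_distrib_left mult_ac)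
        also have "\<dots> \<le> 2 * (h () * (1 + ln (real n)) ^ i) * (1 + ln (real n))"
          using sum_inverse_le_ln[OF n] h n by (intro mult_left_mono) auto
        also have "\<dots> = 2 * h () * (1 + ln (real n)) ^ Suc i" by simp
        also have "\<dots> \<le> 2 * (1 + h ()) * (1 + ln (real n)) ^ Suc i"
          using n by (intro mult_right_mono) auto
        finally show "norm (S n \<omega>) \<le> 2 * (1 + (\<Sum>x\<in>{()}. h x)) * (1 + ln (real n)) ^ Suc i" by simp
      qed
    qed (use IH in auto)
    have Re12k: "Re (\<Lambda> k) > 1/2" and Re0k: "Re (\<Lambda> k) \<ge> 0" using Re12 Re0 Lk by auto
    obtain V where V: "AE \<omega> in M. (\<lambda>n. transform k (\<Lambda> k) n \<omega>) \<longlonglongrightarrow> V \<omega>"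
      "dominated M (\<lambda>_. 1) (transform k (\<Lambda> k))"
      using transform_limit[OF k(1) Re12k] by blast
    have eq: "AE \<omega> in M. \<forall>n\<ge>1. (u k (cembed x1) + transform k (\<Lambda> k) n \<omega>) + S n \<omega> = coord k n \<omega> / pf n"
      using AE_start
    proof eventually_elim
      case (elim \<omega>)
      show ?case
      proof (intro allI impI)
        fix n :: nat assume n: "n \<ge> 1"
        show "(u k (cembed x1) + transform k (\<Lambda> k) n \<omega>) + S n \<omega> = coord k n \<omega> / pf n"
          using coord_normalized[OF k(1) Re0k elim n] k(2,3) by (simp add: Lk pf_def S_def z_def e_def)
      qed
    qed
    have one_le: "1 \<le> (1 + ln (real n)) ^ Suc i" if "n \<ge> 1" for n
      using one_plus_ln_ge_1[OF that] by (rule one_le_power)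
    have "dominated M (\<lambda>_. 1) (\<lambda>n \<omega>. u k (cembed x1) + transform k (\<Lambda> k) n \<omega>)"
      by (rule dominated_add[OF dominated_const V(2)]) simp
    then have "dominated M (\<lambda>n. (1 + ln (real n)) ^ Suc i) (\<lambda>n \<omega>. u k (cembed x1) + transform k (\<Lambda> k) n \<omega>)"
      by (rule dominated_mono) (rule one_le)
    then have "dominated M (\<lambda>n. (1 + ln (real n)) ^ Suc i) (\<lambda>n \<omega>. (u k (cembed x1) + transform k (\<Lambda> k) n \<omega>) + S n \<omega>)"
      using Sdom by (rule dominated_add) simp
    from dominated_cong_AE[OF this eq]
    have dom: "dominated M (\<lambda>n. (1 + ln (real n)) ^ Suc i) (\<lambda>n \<omega>. coord k n \<omega> / pf n)" .
    have "AE \<omega> in M. (\<lambda>n. coord k n \<omega> / pf n / of_real (ln (real n)) ^ Suc i) \<longlonglongrightarrow> Z \<omega> / fact (Suc i)"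
      using eq V(1) IH(2)
    proof eventually_elim
      case (elim \<omega>)
      let ?b = "\<lambda>n. ln (real n) ^ Suc i"
      \<comment> \<open>The Stolz-Cesaro quotient as a product of three convergent factors: the
        previous coordinate over its logarithm, the replacement of \<open>e n\<close> by
        \<open>n\<close>, and the increment of the logarithmic power.\<close>
      have "(\<lambda>n. (z n \<omega> / of_real (ln (real n)) ^ i) * (of_nat n / (of_nat n + (of_real (\<tau> - 1) + \<Lambda> m)))
           * of_real (ln (real n) ^ i / (real n * (?b (Suc n) - ?b n)))) \<longlonglongrightarrow> Z \<omega> / fact i * 1 * of_real (1 / real (Suc i))"
        by (intro tendsto_mult tendsto_of_real elim of_nat_over_shift_tendsto_1 ln_power_increment)
      note lim0 = this
      have val: "Z \<omega> / fact i * 1 * of_real (1 / real (Suc i)) = Z \<omega> / fact (Suc i)"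
        by (simp add: field_simps)
      note lim = lim0[unfolded val]
      have "eventually (\<lambda>n. (z n \<omega> / of_real (ln (real n)) ^ i) * (of_nat n / (of_nat n + (of_real (\<tau> - 1) + \<Lambda> m)))
           * of_real (ln (real n) ^ i / (real n * (?b (Suc n) - ?b n))) = (S (Suc n) \<omega> - S n \<omega>) /\<^sub>R (?b (Suc n) - ?b n)) sequentially"
        using eventually_gt_at_top[of 1] ln_power_strict[of i]
      proof eventually_elim
        case (elim n)
        have "ln (real n) > 0" using elim by simp
        then have l0: "complex_of_real (ln (real n)) ^ i \<noteq> 0" by simp
        have en: "e n = of_nat n + (of_real (\<tau> - 1) + \<Lambda> m)" by (simp add: e_def)
        have S: "S (Suc n) \<omega> - S n \<omega> = z n \<omega> / e n" using elim by (simp add: S_def)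
        have "of_real (ln (real n) ^ i / (real n * (?b (Suc n) - ?b n)))
            = complex_of_real (ln (real n)) ^ i / of_nat n / of_real (?b (Suc n) - ?b n)" by simp
        then show ?case unfolding S en[symmetric] scaleR_conv_of_real
          using l0 elim e(2)[of n] by (simp add: divide_simps)
      qed
      from Lim_transform_eventually[OF lim this]
      have Slim: "(\<lambda>n. S n \<omega> /\<^sub>R ?b n) \<longlonglongrightarrow> Z \<omega> / fact (Suc i)"
        by (intro stolz_cesaro[of ?b] ln_power_strict ln_power_top)
      have inv0: "(\<lambda>n. inverse (?b n)) \<longlonglongrightarrow> 0"
        by (rule tendsto_inverse_0_at_top[OF ln_power_top])
      have "(\<lambda>n. inverse (?b n) *\<^sub>R (u k (cembed x1) + transform k (\<Lambda> k) n \<omega>) + S n \<omega> /\<^sub>R ?b n)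
          \<longlonglongrightarrow> 0 *\<^sub>R (u k (cembed x1) + V \<omega>) + Z \<omega> / fact (Suc i)"
        by (intro tendsto_intros inv0 elim Slim)
      moreover have "eventually (\<lambda>n. inverse (?b n) *\<^sub>R (u k (cembed x1) + transform k (\<Lambda> k) n \<omega>) + S n \<omega> /\<^sub>R ?b n
          = coord k n \<omega> / pf n / of_real (ln (real n)) ^ Suc i) sequentially"
        using eventually_ge_at_top[of 1]
      proof eventually_elim
        case (elim n)
        have c: "coord k n \<omega> / pf n = (u k (cembed x1) + transform k (\<Lambda> k) n \<omega>) + S n \<omega>"
          using \<open>\<forall>n\<ge>1. _ = coord k n \<omega> / pf n\<close> elim by simp
        show ?case unfolding c scaleR_conv_of_real
          by (simp add: divide_inverse distrib_right distrib_left mult.commute)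
      qed
      ultimately show ?case by (auto intro: Lim_transform_eventually)
    qed
    with dom show ?case by (simp add: k_def)
  qed
  show ?thesis
    using Zm Zd main unfolding pf_def by (intro bexI[of _ Z]) blast+
qed

text \<open>Only finitely many real parts occur. Inserting 1/2 makes the set nonempty and places
  \<open>\<rho>\<close> in the range where the normalised noise converges.\<close>

lemma weight_gap_subcritical:
  obtains \<rho> where "1/2 < \<rho>" "\<rho> < \<sigma>" "\<And>k. k \<in> {2..DIM('a)} \<Longrightarrow> Re (\<Lambda> k) < \<sigma> \<Longrightarrow> Re (\<Lambda> k) < \<rho>"
proof -
  let ?S = "insert (1/2) {Re (\<Lambda> k) | k. k \<in> {2..DIM('a)} \<and> Re (\<Lambda> k) < \<sigma>}"
  have fin: "finite ?S" by simp
  have "Max ?S < \<sigma>" using fin \<sigma>_half by (subst Max_less_iff) auto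
  then obtain \<rho> where \<rho>: "Max ?S < \<rho>" "\<rho> < \<sigma>" using dense by blast
  have le: "x < \<rho>" if "x \<in> ?S" for x by (rule order_le_less_trans[OF Max_ge[OF fin that] \<rho>(1)])
  show ?thesis
  proof (rule that[OF _ \<rho>(2)])
    show "1/2 < \<rho>" by (rule le) simp
    show "Re (\<Lambda> k) < \<rho>" if "k \<in> {2..DIM('a)}" "Re (\<Lambda> k) < \<sigma>" for k
      by (rule le) (use that in blast)
  qed
qed

lemma coord_1: "AE \<omega> in M. \<forall>n\<ge>1. coord 1 n \<omega> = of_real (real n + \<tau> - 1)"
  using AE_mass by eventually_elim (simp add: coord_def u_1_embed[unfolded One_nat_def])

end

subsection \<open>Principal blocks and the expansion\<close>

lemma monogenic_indicesE:
  assumes "monogenic_indices s \<epsilon> B"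
  obtains m e where "1 \<le> m" "m \<le> e" "e \<le> s" "B = {m..e}" "\<epsilon> m = 0" "\<And>k. m < k \<Longrightarrow> k \<le> e \<Longrightarrow> \<epsilon> k = 1"
proof -
  obtain m r' where "1 \<le> m" "m + r' \<le> s" "B = {m..m + r'}" "\<epsilon> m = 0" "\<forall>k. m < k \<and> k \<le> m + r' \<longrightarrow> \<epsilon> k = 1"
    using assms unfolding monogenic_indices_def by blast
  then show ?thesis using that[of m "m + r'"] by simp
qed

lemma monogenic_indicesI:
  assumes "1 \<le> m" "m \<le> e" "e \<le> s" "\<epsilon> m = 0" "\<And>k. m < k \<Longrightarrow> k \<le> e \<Longrightarrow> \<epsilon> k = 1"
  shows "monogenic_indices s \<epsilon> {m..e}"
  unfolding monogenic_indices_def using assms by (intro exI[of _ m] exI[of _ "e - m"]) auto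

lemma continuous_on_polynomial_function:
  fixes f :: "'a::euclidean_space \<times> 'a \<Rightarrow> complex"
  assumes "f \<in> polynomial_functions"
  shows "continuous_on UNIV f"
  using assms
proof (induction rule: polynomial_functions.induct)
  case (form f)
  then show ?case by (intro linear_continuous_on complex_linear_form_bounded_linear)
qed (auto intro: continuous_intros)

lemma norm_cscale_le: "norm (cscale c z) \<le> 2 * norm c * norm z"
proof -
  have "cscale c z = Re c *\<^sub>R z + Im c *\<^sub>R (- snd z, fst z)"
    by (simp add: cscale_def prod_eq_iff)
  moreover have n1: "norm (- snd z, fst z) = norm z" by (cases z) (simp add: norm_Pair add.commute)
  ultimately have "norm (cscale c z) \<le> \<bar>Re c\<bar> * norm z + \<bar>Im c\<bar> * norm z"
    using norm_triangle_ineq[of "Re c *\<^sub>R z" "Im c *\<^sub>R (- snd z, fst z)"] by (simp only: norm_scaleR n1)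
  also have "\<dots> \<le> norm c * norm z + norm c * norm z"
    by (intro add_mono mult_right_mono abs_Re_le_cmod abs_Im_le_cmod) auto
  finally show ?thesis by simp
qed

lemma cscale_linear: "linear (\<lambda>c. cscale c z)"
  by (rule linearI) (auto simp: cscale_def algebra_simps scaleR_add_left)

context polya_jordan
begin

lemma sigma2_bounds:
  assumes "\<not> principally_semisimple DIM('a) \<Lambda> \<epsilon> (sigma2 w l)"
  shows "sigma2 w l < 1" and "\<And>k. k \<in> {2..DIM('a)} \<Longrightarrow> Re (\<Lambda> k) \<le> sigma2 w l"
proof -
  obtain B where B: "principal_block DIM('a) \<Lambda> \<epsilon> (sigma2 w l) B" "card B \<noteq> 1"
    using assms by (auto simp: principally_semisimple_def)
  then have mi: "monogenic_indices DIM('a) \<epsilon> B" and root: "Re (block_root \<Lambda> B) = sigma2 w l"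
    by (auto simp: principal_block_def monogenic_block_def)
  obtain m e where me: "1 \<le> m" "m \<le> e" "e \<le> DIM('a)" "B = {m..e}" "\<epsilon> m = 0" "\<And>k. m < k \<Longrightarrow> k \<le> e \<Longrightarrow> \<epsilon> k = 1"
    by (rule monogenic_indicesE[OF mi]) (rule that, assumption+)
  have lt: "m < e" using B(2) me(2,4) by (cases "m = e") auto
  have sm: "Suc m \<in> {1..DIM('a)}" "\<epsilon> (Suc m) = 1" using me lt by auto
  have Lm: "\<Lambda> m \<noteq> 1" using eps_Lam[OF sm] eps_1_imp_Lam[OF sm] by simp
  have "Min B = m" using me by (simp add: Min_eq_iff)
  then have Rem: "Re (\<Lambda> m) = sigma2 w l" using root by (simp add: block_root_def)
  show less: "sigma2 w l < 1" using Re_Lam_less_1[of m] Lm me Rem by auto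
  have mult: "\<not> alg_multiplicity A 1 \<ge> 2" using less by (auto simp: sigma2_def Let_def)
  let ?S = "{Re \<mu> | \<mu>. eigenvalue A \<mu> \<and> \<mu> \<noteq> 1}"
  have s2: "sigma2 w l = Max ?S" using mult by (simp add: sigma2_def Let_def)
  have "?S \<subseteq> Re ` \<Lambda> ` {1..DIM('a)}" using eigenvalue_Lam by blast
  then have fin: "finite ?S" by (rule finite_subset) auto
  fix k assume k: "k \<in> {2..DIM('a)}"
  then have "\<Lambda> k \<noteq> 1" using multiplicity_1 mult by blast
  moreover have "eigenvalue A (\<Lambda> k)" using Lam_eigenvalue[of k] k by auto
  ultimately have "Re (\<Lambda> k) \<in> ?S" by blast
  then show "Re (\<Lambda> k) \<le> sigma2 w l" unfolding s2 using fin by (rule Max_ge[rotated])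
qed

end

section \<open>Expectations of polynomials along the chain\<close>

context polya_weights
begin

lemma polynomial_meas:
  assumes "f \<in> polynomial_functions" "n \<ge> 1"
  shows "(\<lambda>\<omega>. f (cembed (X n \<omega>))) \<in> borel_measurable M"
proof -
  have "continuous_on UNIV (\<lambda>x::'a. (x, 0::'a))" by (intro continuous_intros)
  then have "continuous_on UNIV (\<lambda>x::'a. f (x, 0))"
    using continuous_on_compose2[OF continuous_on_polynomial_function[OF assms(1)]] by auto
  then show ?thesis unfolding cembed_def using X_meas[OF assms(2)]
    by (intro borel_measurable_continuous_on[of "\<lambda>x. f (x, 0)"])
qed

lemma Phi_embed: "\<Phi> f (cembed x) = (\<Sum>k=1..DIM('a). of_real (l k x) * (f (cembed (x + w k)) - f (cembed x)))"
proof -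
  have "cext_form (l k) (cembed x) = of_real (l k x)" if "k \<in> {1..DIM('a)}" for k
    using linear_0[OF l_linear[OF that]] by (simp add: cext_form_def cembed_def complex_eq_iff)
  then show ?thesis unfolding transition_op_def cembed_add by (intro sum.cong) auto
qed

text \<open>The jump probabilities are \<open>l k (X n \<omega>)\<close> over the almost sure mass,
  so averaging \<open>f\<close> after a jump is the identity plus \<Phi> divided by that
  mass.\<close>

lemma polynomial_step:
  assumes f: "f \<in> polynomial_functions" and n: "n \<ge> 1"
  shows "integrable M (\<lambda>\<omega>. f (cembed (X (Suc n) \<omega>)))"
    and "expectation (\<lambda>\<omega>. f (cembed (X (Suc n) \<omega>))) =
      expectation (\<lambda>\<omega>. f (cembed (X n \<omega>)) + \<Phi> f (cembed (X n \<omega>)) / of_real (real n + \<tau> - 1))"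
proof -
  let ?d = "real n + \<tau> - 1"
  let ?F = "\<lambda>(ps :: 'a list) y. f (cembed y)"
  have shift: "(\<lambda>\<omega>. f (cembed (X n \<omega> + w k))) \<in> borel_measurable M" for k
  proof -
    have "continuous_on UNIV (\<lambda>x::'a. (x + w k, 0::'a))" by (intro continuous_intros)
    then have "continuous_on UNIV (\<lambda>x::'a. f (x + w k, 0))"
      using continuous_on_compose2[OF continuous_on_polynomial_function[OF f]] by auto
    then show ?thesis unfolding cembed_def using X_meas[OF n]
      by (intro borel_measurable_continuous_on[of "\<lambda>x. f (x + w k, 0)"])
  qed
  have ml: "(\<lambda>\<omega>. l k (X n \<omega>)) \<in> borel_measurable M" if "k \<in> {1..DIM('a)}" for k
    by (rule linear_borel_measurable[OF l_linear[OF that] X_meas[OF n]])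
  have mlc: "(\<lambda>\<omega>. complex_of_real (l k (X n \<omega>))) \<in> borel_measurable M" if "k \<in> {1..DIM('a)}" for k
    using ml[OF that] by measurable
  have m1: "(\<lambda>\<omega>. ?F (trajectory n \<omega>) (X (Suc n) \<omega>)) \<in> borel_measurable M"
    by (rule polynomial_meas[OF f]) simp
  have m2: "(\<lambda>\<omega>. \<Sum>k=1..DIM('a). (l k (X n \<omega>) / ?d) *\<^sub>R ?F (trajectory n \<omega>) (X n \<omega> + w k)) \<in> borel_measurable M"
    by (intro borel_measurable_sum borel_measurable_scaleR borel_measurable_divide borel_measurable_const shift ml)
  show "integrable M (\<lambda>\<omega>. f (cembed (X (Suc n) \<omega>)))" by (rule expectation_transition(1)[OF n m1 m2])
  have mPhi: "(\<lambda>\<omega>. f (cembed (X n \<omega>)) + \<Phi> f (cembed (X n \<omega>)) / of_real ?d) \<in> borel_measurable M"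
    unfolding Phi_embed
    by (intro borel_measurable_add borel_measurable_divide borel_measurable_const borel_measurable_sum
      borel_measurable_times borel_measurable_diff shift polynomial_meas[OF f n] mlc)
  have "expectation (\<lambda>\<omega>. f (cembed (X (Suc n) \<omega>)))
      = expectation (\<lambda>\<omega>. \<Sum>k=1..DIM('a). (l k (X n \<omega>) / ?d) *\<^sub>R f (cembed (X n \<omega> + w k)))"
    by (rule expectation_transition(2)[OF n m1 m2])
  also have "\<dots> = expectation (\<lambda>\<omega>. f (cembed (X n \<omega>)) + \<Phi> f (cembed (X n \<omega>)) / of_real ?d)"
  proof (rule integral_cong_AE[OF m2 mPhi])
    show "AE \<omega> in M. (\<Sum>k=1..DIM('a). (l k (X n \<omega>) / ?d) *\<^sub>R f (cembed (X n \<omega> + w k)))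
        = f (cembed (X n \<omega>)) + \<Phi> f (cembed (X n \<omega>)) / of_real ?d"
      using AE_mass
    proof eventually_elim
      case (elim \<omega>)
      let ?x = "X n \<omega>"
      have d0: "complex_of_real ?d \<noteq> 0" using denominator_pos[OF n] by (simp only: of_real_eq_0_iff)
      have "(\<Sum>k=1..DIM('a). complex_of_real (l k ?x)) = of_real ?d"
        using elim n by (simp add: mass_def flip: of_real_sum)
      then have "\<Phi> f (cembed ?x) = (\<Sum>k=1..DIM('a). of_real (l k ?x) * f (cembed (?x + w k))) - of_real ?d * f (cembed ?x)"
        unfolding Phi_embed by (simp add: right_diff_distrib sum_subtractf sum_distrib_right[symmetric])
      then have "f (cembed ?x) + \<Phi> f (cembed ?x) / of_real ?d
          = (\<Sum>k=1..DIM('a). of_real (l k ?x) * f (cembed (?x + w k))) / of_real ?d"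
        using d0 by (simp add: diff_divide_distrib)
      then show ?case by (simp add: scaleR_conv_of_real sum_divide_distrib)
    qed
  qed
  finally show "expectation (\<lambda>\<omega>. f (cembed (X (Suc n) \<omega>))) =
      expectation (\<lambda>\<omega>. f (cembed (X n \<omega>)) + \<Phi> f (cembed (X n \<omega>)) / of_real (real n + \<tau> - 1))" .
qed

lemma polynomial_integrable:
  assumes f: "f \<in> polynomial_functions" and n: "n \<ge> 1"
  shows "integrable M (\<lambda>\<omega>. f (cembed (X n \<omega>)))"
proof (cases "n = 1")
  case True
  have "AE \<omega> in M. f (cembed (X n \<omega>)) = f (cembed x1)" using AE_start by eventually_elim (simp add: True)
  then show ?thesis
    using integrable_cong_AE[OF polynomial_meas[OF f n] borel_measurable_const[of "f (cembed x1)"]] by simp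
next
  case False
  then show ?thesis using polynomial_step(1)[OF f, of "n - 1"] n by simp
qed

text \<open>The hypothesis is a true eigenvalue equation, not a generalised one; this gives a pure
  product without logarithmic terms.\<close>

lemma eigen_expectation:
  assumes Q: "Q \<in> polynomial_functions" "shifted_op \<Phi> c Q = (\<lambda>_. 0)" and n: "n \<ge> 1"
  shows "expectation (\<lambda>\<omega>. Q (cembed (X n \<omega>))) = polya_factor \<tau> c n * Q (cembed x1)"
  using n
proof (induction n rule: dec_induct)
  case base
  have "AE \<omega> in M. Q (cembed (X 1 \<omega>)) = Q (cembed x1)" using AE_start by eventually_elim simp
  then have "expectation (\<lambda>\<omega>. Q (cembed (X 1 \<omega>))) = expectation (\<lambda>\<omega>. Q (cembed x1))"
    by (intro integral_cong_AE polynomial_meas[OF Q(1)] borel_measurable_const) auto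
  then show ?case by (simp add: prob_space)
next
  case (step n)
  have "\<Phi> Q z = c * Q z" for z using fun_cong[OF Q(2), of z] by (simp add: shifted_op_def)
  then have "expectation (\<lambda>\<omega>. Q (cembed (X (Suc n) \<omega>)))
      = expectation (\<lambda>\<omega>. (1 + c / of_real (real n + \<tau> - 1)) * Q (cembed (X n \<omega>)))"
    unfolding polynomial_step(2)[OF Q(1) step.hyps(1)] by (simp add: algebra_simps)
  also have "\<dots> = (1 + c / of_real (real n + \<tau> - 1)) * expectation (\<lambda>\<omega>. Q (cembed (X n \<omega>)))" by simp
  finally show ?case unfolding step.IH polya_factor_Suc[OF step.hyps(1)] by simp
qed

end

subsection \<open>The limit variables\<close>

lemma prod_list_replicate_blocks:
  fixes f :: "nat \<Rightarrow> 'c::comm_monoid_mult"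
  shows "(\<Prod>i\<leftarrow>concat (map (\<lambda>k. replicate (a k) (g k)) [m..<Suc n]). f i) = (\<Prod>k=m..n. f (g k) ^ a k)"
proof -
  have "(\<Prod>i\<leftarrow>concat (map (\<lambda>k. replicate (a k) (g k)) xs). f i) = (\<Prod>k\<leftarrow>xs. f (g k) ^ a k)" for xs
    by (induction xs) (auto simp: prod_list_replicate map_replicate)
  also have "(\<Prod>k\<leftarrow>[m..<Suc n]. f (g k) ^ a k) = (\<Prod>k\<in>set [m..<Suc n]. f (g k) ^ a k)"
    by (rule prod.distinct_set_conv_list[symmetric]) (rule distinct_upt)
  also have "set [m..<Suc n] = {m..n}" by auto
  finally show ?thesis .
qed

lemma sum_list_replicate_blocks:
  fixes f :: "nat \<Rightarrow> complex"
  shows "(\<Sum>i\<leftarrow>concat (map (\<lambda>k. replicate (a k) (g k)) [m..<Suc n]). f i) = (\<Sum>k=m..n. of_nat (a k) * f (g k))"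
proof -
  have "(\<Sum>i\<leftarrow>concat (map (\<lambda>k. replicate (a k) (g k)) xs). f i) = (\<Sum>k\<leftarrow>xs. of_nat (a k) * f (g k))" for xs
    by (induction xs) (auto simp: sum_list_replicate map_replicate)
  also have "(\<Sum>k\<leftarrow>[m..<Suc n]. of_nat (a k) * f (g k)) = (\<Sum>k\<in>set [m..<Suc n]. of_nat (a k) * f (g k))"
    by (rule sum.distinct_set_conv_list[symmetric]) (rule distinct_upt)
  also have "set [m..<Suc n] = {m..n}" by auto
  finally show ?thesis .
qed

locale polya_principal = polya_weights M X x1 w l u v \<Lambda> \<epsilon> \<sigma>
  for M :: "'b measure" and X :: "nat \<Rightarrow> 'b \<Rightarrow> 'a::euclidean_space"
    and x1 :: 'a and w :: "nat \<Rightarrow> 'a" and l :: "nat \<Rightarrow> 'a \<Rightarrow> real"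
    and u :: "nat \<Rightarrow> 'a \<times> 'a \<Rightarrow> complex" and v :: "nat \<Rightarrow> 'a \<times> 'a"
    and \<Lambda> :: "nat \<Rightarrow> complex" and \<epsilon> :: "nat \<Rightarrow> nat" and \<sigma> :: real +
  fixes \<nu> r :: nat and J :: "nat \<Rightarrow> nat set"
  assumes nu: "\<nu> \<ge> 1" and r: "2 \<le> r"
    and blocks: "bij_betw J {2..r} {B. principal_block DIM('a) \<Lambda> \<epsilon> \<sigma> B}"
    and size: "\<And>k. k \<in> {2..r} \<Longrightarrow> card (J k) = \<nu> + 1"
begin

definition root :: "nat \<Rightarrow> nat" where "root k = Min (J k)"
definition block_top :: "nat \<Rightarrow> nat" where "block_top k = Max (J k)"

definition critical_root :: "nat \<Rightarrow> bool" where
  "critical_root m \<longleftrightarrow> m \<in> {2..DIM('a)} \<and> \<epsilon> m = 0 \<and> Re (\<Lambda> m) = \<sigma>"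

lemma J_principal: "k \<in> {2..r} \<Longrightarrow> principal_block DIM('a) \<Lambda> \<epsilon> \<sigma> (J k)"
  using bij_betwE[OF blocks] by blast

lemma J_props:
  assumes k: "k \<in> {2..r}"
  shows "critical_root (root k)" "block_top k = root k + \<nu>" "root k + \<nu> \<le> DIM('a)"
    "\<And>j. root k < j \<Longrightarrow> j \<le> root k + \<nu> \<Longrightarrow> \<epsilon> j = 1"
proof -
  have mi: "monogenic_indices DIM('a) \<epsilon> (J k)" and re: "Re (\<Lambda> (root k)) = \<sigma>"
    using J_principal[OF k] by (auto simp: principal_block_def monogenic_block_def block_root_def root_def)
  obtain m e where me: "1 \<le> m" "m \<le> e" "e \<le> DIM('a)" "J k = {m..e}" "\<epsilon> m = 0" "\<And>j. m < j \<Longrightarrow> j \<le> e \<Longrightarrow> \<epsilon> j = 1"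
    by (rule monogenic_indicesE[OF mi]) (rule that, assumption+)
  have "e = m + \<nu>" using size[OF k] me by simp
  moreover have "root k = m" "block_top k = e" using me by (auto simp: root_def block_top_def intro!: Min_eqI Max_eqI)
  moreover have "m \<noteq> 1" using re \<open>root k = m\<close> Lam_1 \<sigma>_less_1 by auto
  ultimately show "critical_root (root k)" "block_top k = root k + \<nu>" "root k + \<nu> \<le> DIM('a)"
    "\<And>j. root k < j \<Longrightarrow> j \<le> root k + \<nu> \<Longrightarrow> \<epsilon> j = 1"
    using me re by (auto simp: critical_root_def)
qed

lemma root_range: "k \<in> {2..r} \<Longrightarrow> root k \<in> {2..DIM('a)} \<and> block_top k \<in> {2..DIM('a)} \<and> \<Lambda> (block_top k) = \<Lambda> (root k)"
  using J_props[of k] chain_Lam[of "root k" "root k + \<nu>"] by (auto simp: critical_root_def)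

lemma block_top_start:
  assumes k: "k \<in> {2..r}"
  shows "block_start (block_top k) = root k"
proof -
  have i: "block_top k \<in> {1..DIM('a)}" using root_range[OF k] by auto
  note b = block_start[OF i]
  have r0: "\<epsilon> (root k) = 0" using J_props(1)[OF k] by (simp add: critical_root_def)
  have "\<not> block_start (block_top k) < root k"
  proof
    assume "block_start (block_top k) < root k"
    then have "\<epsilon> (root k) = 1" using b(4) J_props(2)[OF k] by simp
    with r0 show False by simp
  qed
  moreover have "\<not> root k < block_start (block_top k)"
  proof
    assume "root k < block_start (block_top k)"
    then have "\<epsilon> (block_start (block_top k)) = 1" using J_props(2,4)[OF k] b(1) by simp
    with b(3) show False by simp
  qed
  ultimately show ?thesis by simp
qed

text \<open>Ensures that each top coordinate of the remainder involves a single limit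
  variable.\<close>

lemma block_top_inj: "k \<in> {2..r} \<Longrightarrow> k' \<in> {2..r} \<Longrightarrow> block_top k = block_top k' \<Longrightarrow> k = k'"
proof -
  assume k: "k \<in> {2..r}" "k' \<in> {2..r}" "block_top k = block_top k'"
  have J: "J j = {root j..block_top j}" if j: "j \<in> {2..r}" for j
  proof -
    have mi: "monogenic_indices DIM('a) \<epsilon> (J j)"
      using J_principal[OF j] by (auto simp: principal_block_def monogenic_block_def)
    obtain m e where me: "m \<le> e" "J j = {m..e}" by (rule monogenic_indicesE[OF mi]) (rule that, assumption+)
    have "Min {m..e} = m" "Max {m..e} = e" using me(1) by (auto intro!: Min_eqI Max_eqI)
    then show ?thesis unfolding root_def block_top_def me(2) by simp
  qed
  have "J k = J k'" using J[OF k(1)] J[OF k(2)] block_top_start[OF k(1)] block_top_start[OF k(2)] k(3) by simp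
  then show "k = k'" using blocks k(1,2) by (auto simp: bij_betw_def inj_on_def)
qed

text \<open>The maximal block through \<open>i\<close> has at most \<open>\<nu> + 1\<close> indices,
  since principal blocks are the largest with this real part. So \<open>i\<close> lies at offset at
  most \<open>\<nu>\<close> from its root, and offset \<open>\<nu>\<close> forces the block to be
  principal and \<open>i\<close> to be its top.\<close>

lemma critical_position:
  assumes i: "i \<in> {2..DIM('a)}" and re: "Re (\<Lambda> i) = \<sigma>"
  obtains m p where "critical_root m" "i = m + p" "\<Lambda> i = \<Lambda> m" "\<And>j. m < j \<Longrightarrow> j \<le> m + p \<Longrightarrow> \<epsilon> j = 1"
    "p \<le> \<nu>" "m = block_start i" "p = \<nu> \<Longrightarrow> \<exists>k\<in>{2..r}. root k = m \<and> block_top k = i"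
proof -
  have i1: "i \<in> {1..DIM('a)}" using i by auto
  define m where "m = block_start i"
  note b = block_start[OF i1, folded m_def]
  have Lm: "\<Lambda> m = \<Lambda> i" using Lam_block_start[OF i1] by (simp add: m_def)
  have "m \<noteq> 1" using Lm re Lam_1 \<sigma>_less_1 by auto
  then have crit: "critical_root m" using b i Lm re by (auto simp: critical_root_def)
  let ?P = "\<lambda>e. i \<le> e \<and> e \<le> DIM('a) \<and> (\<forall>j. m < j \<and> j \<le> e \<longrightarrow> \<epsilon> j = 1)"
  \<comment> \<open>The last index to which the run of ones after \<open>m\<close> extends; the
    bound by the dimension makes \<open>GREATEST\<close> meaningful.\<close>
  define e where "e = (GREATEST e. ?P e)"
  have "?P i" using i b(4) by auto
  from GreatestI_nat[of ?P, OF this, of "DIM('a)"] have e: "?P e" by (auto simp: e_def)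
  have e_max: "e' \<le> e" if "?P e'" for e'
    using Greatest_le_nat[of ?P, OF that, of "DIM('a)"] by (auto simp: e_def)
  have mi: "monogenic_indices DIM('a) \<epsilon> {m..e}"
    by (rule monogenic_indicesI) (use e b in auto)
  have mb: "monogenic_block DIM('a) \<epsilon> {m..e}"
    unfolding monogenic_block_def
  proof (intro conjI mi allI impI)
    fix B' assume B': "monogenic_indices DIM('a) \<epsilon> B' \<and> {m..e} \<subseteq> B'"
    obtain m' e' where me: "1 \<le> m'" "m' \<le> e'" "e' \<le> DIM('a)" "B' = {m'..e'}" "\<epsilon> m' = 0" "\<And>j. m' < j \<Longrightarrow> j \<le> e' \<Longrightarrow> \<epsilon> j = 1"
      by (rule monogenic_indicesE[OF conjunct1[OF B']]) (rule that, assumption+)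
    have le: "m \<le> e" using b(1) e by auto
    have sub: "m' \<le> m" "e \<le> e'" using B' me(4) le by auto
    have "m' = m"
    proof (rule ccontr)
      assume "m' \<noteq> m"
      then have "\<epsilon> m = 1" using me(6)[of m] sub le by auto
      then show False using b(3) by simp
    qed
    moreover have "e' \<le> e" by (rule e_max) (use me sub e \<open>m' = m\<close> in auto)
    ultimately show "B' = {m..e}" using me(4) sub by auto
  qed
  have le: "m \<le> e" using b(1) e by auto
  have Min: "Min {m..e} = m" using le by (intro Min_eqI) auto
  have rootB: "Re (block_root \<Lambda> {m..e}) = \<sigma>" using Min Lm re by (simp add: block_root_def)
  have two: "2 \<in> {2..r}" using r by simp
  have pb2: "principal_block DIM('a) \<Lambda> \<epsilon> \<sigma> (J 2)" by (rule J_principal[OF two])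
  then have card_le: "card B' \<le> \<nu> + 1" if "monogenic_block DIM('a) \<epsilon> B'" "Re (block_root \<Lambda> B') = \<sigma>" for B'
    using that size[OF two] unfolding principal_block_def by auto
  have ce: "e - m \<le> \<nu>" using card_le[OF mb rootB] le by simp
  have ie: "i \<le> e" using e by blast
  show ?thesis
  proof (rule that[of m "i - m"])
    show "\<exists>k\<in>{2..r}. root k = m \<and> block_top k = i" if "i - m = \<nu>"
    proof -
      have ei: "e = i" using that ce ie b(1) by simp
      have "card {m..e} = \<nu> + 1" using that ei b(1) by simp
      then have "principal_block DIM('a) \<Lambda> \<epsilon> \<sigma> {m..e}"
        unfolding principal_block_def using mb rootB card_le by simp
      then have "{m..e} \<in> J ` {2..r}" unfolding bij_betw_imp_surj_on[OF blocks] by simp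
      then obtain k where k: "J k = {m..e}" "k \<in> {2..r}" by (elim imageE) simp
      have "root k = m" "block_top k = i"
        unfolding root_def block_top_def k(1) using Min ei le by (auto intro!: Max_eqI)
      then show ?thesis using k(2) by blast
    qed
    show "critical_root m" by (rule crit)
    show "i = m + (i - m)" using b(1) by simp
    show "\<Lambda> i = \<Lambda> m" using Lm by simp
    show "\<epsilon> j = 1" if "m < j" "j \<le> m + (i - m)" for j using b(1,4) that by simp
    show "i - m \<le> \<nu>" using ie ce by simp
    show "m = block_start i" by (rule m_def)
  qed
qed

text \<open>The conclusion of \<open>critical_coord\<close> as a predicate, so that one limit can be
  chosen for each root and shared by all members of its chain.\<close>

definition limit_property :: "nat \<Rightarrow> ('b \<Rightarrow> complex) \<Rightarrow> bool" where
  "limit_property m Z \<longleftrightarrow> Z \<in> borel_measurable M \<and> dominated M (\<lambda>_. 1) (\<lambda>_. Z) \<and>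
    (\<forall>i. m + i \<le> DIM('a) \<longrightarrow> (\<forall>j. m < j \<and> j \<le> m + i \<longrightarrow> \<epsilon> j = 1) \<longrightarrow>
       dominated M (\<lambda>n. (1 + ln (real n)) ^ i) (\<lambda>n \<omega>. coord (m + i) n \<omega> / polya_factor \<tau> (\<Lambda> m) n) \<and>
       (AE \<omega> in M. (\<lambda>n. coord (m + i) n \<omega> / polya_factor \<tau> (\<Lambda> m) n / of_real (ln (real n)) ^ i) \<longlonglongrightarrow> Z \<omega> / fact i))"

lemma limit_propertyD:
  assumes "limit_property m Z"
  shows "Z \<in> borel_measurable M" "dominated M (\<lambda>_. 1) (\<lambda>_. Z)"
  using assms unfolding limit_property_def by blast+

definition norming :: "complex \<Rightarrow> complex" where
  "norming c = Gamma (of_real \<tau>) * rGamma (of_real \<tau> + c)"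

text \<open>The chosen limit belongs to the normalisation by \<open>polya_factor\<close>; the factor
  \<open>norming (\<Lambda> m)\<close> converts it to the normalisation by
  \<open>n powr \<Lambda> m\<close>.\<close>

definition root_limit :: "nat \<Rightarrow> 'b \<Rightarrow> complex" where
  "root_limit m \<omega> = norming (\<Lambda> m) * (SOME Z. limit_property m Z) \<omega>"

lemma limit_property_some: "critical_root m \<Longrightarrow> limit_property m (SOME Z. limit_property m Z)"
  using critical_coord[of m] unfolding critical_root_def
  by (intro someI_ex[of "limit_property m"]) (auto simp: limit_property_def Bex_def)

lemma root_limit_meas: "critical_root m \<Longrightarrow> root_limit m \<in> borel_measurable M"
proof -
  assume "critical_root m"
  then have "(SOME Z. limit_property m Z) \<in> borel_measurable M" by (rule limit_propertyD(1)[OF limit_property_some])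
  then show ?thesis unfolding root_limit_def by (intro borel_measurable_times borel_measurable_const)
qed

lemma root_limit_dominated: "critical_root m \<Longrightarrow> dominated M (\<lambda>_. 1) (\<lambda>_. root_limit m)"
  by (rule dominated_scale[where R="\<lambda>_. SOME Z. limit_property m Z" and g="\<lambda>_. 1" and c="\<lambda>_. norm (norming (\<Lambda> m))"
        and C="norm (norming (\<Lambda> m))"])
    (auto simp: root_limit_def norm_mult intro: limit_propertyD(2)[OF limit_property_some])

lemma polya_factor_norming: "(\<lambda>n. polya_factor \<tau> c n / of_nat n powr c) \<longlonglongrightarrow> norming c"
  unfolding norming_def by (rule polya_factor_asymp[OF tau_pos])

lemma critical_limits:
  assumes m: "critical_root m" and i: "m + i \<le> DIM('a)" "\<And>j. m < j \<Longrightarrow> j \<le> m + i \<Longrightarrow> \<epsilon> j = 1"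
  shows "dominated M (\<lambda>n. real n powr \<sigma> * (1 + ln (real n)) ^ i) (coord (m + i))"
    and "AE \<omega> in M. (\<lambda>n. coord (m + i) n \<omega> / of_nat n powr \<Lambda> m / of_real (ln (real n)) ^ i) \<longlonglongrightarrow> root_limit m \<omega> / fact i"
proof -
  let ?pf = "polya_factor \<tau> (\<Lambda> m)"
  define Z where "Z = (SOME Z. limit_property m Z)"
  have "limit_property m Z" unfolding Z_def by (rule limit_property_some[OF m])
  then have P: "dominated M (\<lambda>n. (1 + ln (real n)) ^ i) (\<lambda>n \<omega>. coord (m + i) n \<omega> / ?pf n)"
     "AE \<omega> in M. (\<lambda>n. coord (m + i) n \<omega> / ?pf n / of_real (ln (real n)) ^ i) \<longlonglongrightarrow> Z \<omega> / fact i"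
    unfolding limit_property_def using i by blast+
  have re: "Re (\<Lambda> m) = \<sigma>" using m by (simp add: critical_root_def)
  then have re0: "Re (\<Lambda> m) \<ge> 0" using \<sigma>_half by simp
  have pf0: "?pf n \<noteq> 0" if "n \<ge> 1" for n by (rule polya_factor_nonzero[OF tau_pos re0 that])
  obtain B where B: "B > 0" "\<And>n. n \<ge> 1 \<Longrightarrow> norm (?pf n) \<le> B * real n powr \<sigma>"
    using polya_factor_bounds[OF tau_pos re0] re by metis
  show "dominated M (\<lambda>n. real n powr \<sigma> * (1 + ln (real n)) ^ i) (coord (m + i))"
  proof (rule dominated_scale[OF P(1), of B _ "\<lambda>n. norm (?pf n)"])
    show "norm (?pf n) * (1 + ln (real n)) ^ i \<le> B * (real n powr \<sigma> * (1 + ln (real n)) ^ i)" if "n \<ge> 1" for n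
      using mult_right_mono[OF B(2)[OF that], of "(1 + ln (real n)) ^ i"] that by (simp add: mult.assoc)
    show "norm (coord (m + i) n \<omega>) \<le> norm (?pf n) * norm (coord (m + i) n \<omega> / ?pf n)" if "n \<ge> 1" for n \<omega>
      using pf0[OF that] by (simp add: norm_divide)
  qed (use B in auto)
  show "AE \<omega> in M. (\<lambda>n. coord (m + i) n \<omega> / of_nat n powr \<Lambda> m / of_real (ln (real n)) ^ i) \<longlonglongrightarrow> root_limit m \<omega> / fact i"
    using P(2)
  proof eventually_elim
    case (elim \<omega>)
    have "(\<lambda>n. (coord (m + i) n \<omega> / ?pf n / of_real (ln (real n)) ^ i) * (?pf n / of_nat n powr \<Lambda> m))
       \<longlonglongrightarrow> Z \<omega> / fact i * norming (\<Lambda> m)"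
      by (intro tendsto_mult elim polya_factor_norming)
    moreover have "eventually (\<lambda>n. (coord (m + i) n \<omega> / ?pf n / of_real (ln (real n)) ^ i) * (?pf n / of_nat n powr \<Lambda> m)
       = coord (m + i) n \<omega> / of_nat n powr \<Lambda> m / of_real (ln (real n)) ^ i) sequentially"
      using eventually_ge_at_top[of 1] by eventually_elim (simp add: pf0)
    ultimately show ?case unfolding root_limit_def Z_def[symmetric]
      by (auto intro: Lim_transform_eventually simp: mult.commute)
  qed
qed

end

section \<open>Existence and uniqueness of the expansion\<close>

context polya_principal
begin

definition remainder :: "(nat \<Rightarrow> 'b \<Rightarrow> complex) \<Rightarrow> nat \<Rightarrow> 'b \<Rightarrow> 'a \<times> 'a" where
  "remainder W n \<omega> = cembed (X n \<omega>) - (real n *\<^sub>R v 1 + (1 / fact \<nu> * ln (real n) ^ \<nu>) *\<^sub>R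
     (\<Sum>k=2..r. cscale (of_nat n powr block_root \<Lambda> (J k) * W k \<omega>) (v (Max (J k)))))"

text \<open>Equivalent to the scale of the expansion, with \<open>1 + ln n\<close> in place of
  \<open>ln n\<close> to remain positive at \<open>n = 1\<close>.\<close>

definition scale :: "nat \<Rightarrow> real" where
  "scale n = real n powr \<sigma> * (1 + ln (real n)) ^ \<nu>"

definition limit_var :: "nat \<Rightarrow> 'b \<Rightarrow> complex" where
  "limit_var k = root_limit (root k)"

lemma expansion_iff:
  "polya_expansion M X v \<Lambda> \<sigma> \<nu> r J W \<longleftrightarrow> smallo_as_Lp M (remainder W) (\<lambda>n. real n powr \<sigma> * ln (real n) ^ \<nu>)"
  unfolding polya_expansion_def remainder_def[abs_def] ..

lemma scale_pos: "n \<ge> 1 \<Longrightarrow> scale n > 0"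
proof -
  assume n: "n \<ge> 1"
  then have "1 + ln (real n) > 0" using one_plus_ln_ge_1[OF n] by linarith
  then show ?thesis unfolding scale_def using n by (intro mult_pos_pos zero_less_power) auto
qed

lemma form_remainder:
  assumes i: "i \<in> {1..DIM('a)}"
  shows "u i (remainder W n \<omega>) = coord i n \<omega> - (of_nat n * (if i = 1 then 1 else 0)
     + of_real (1 / fact \<nu> * ln (real n) ^ \<nu>) *
       (\<Sum>k=2..r. of_nat n powr \<Lambda> (root k) * W k \<omega> * (if i = block_top k then 1 else 0)))"
proof -
  note f = u_form[OF i]
  have 1: "u i (v 1) = (if i = 1 then 1 else 0)" using u_v[OF i, of 1] by (simp add: DIM_positive Suc_le_eq)
  have "u i (v (Max (J k))) = (if i = block_top k then 1 else 0)" if "k \<in> {2..r}" for k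
    using u_v[OF i, of "block_top k"] root_range[OF that] by (simp add: block_top_def)
  then have 2: "(\<Sum>k=2..r. of_nat n powr block_root \<Lambda> (J k) * W k \<omega> * u i (v (Max (J k))))
      = (\<Sum>k=2..r. of_nat n powr \<Lambda> (root k) * W k \<omega> * (if i = block_top k then 1 else 0))"
    by (intro sum.cong refl) (simp only: block_root_def root_def)
  show ?thesis
    unfolding remainder_def complex_linear_form_diff[OF f] complex_linear_form_add[OF f]
      complex_linear_form_scaleR[OF f] complex_linear_form_sum[OF f] complex_linear_form_cscale[OF f]
      1 2 coord_def scaleR_conv_of_real of_real_of_nat_eq ..
qed

lemma form_remainder_not_top:
  assumes i: "i \<in> {1..DIM('a)}" and nt: "\<And>k. k \<in> {2..r} \<Longrightarrow> block_top k \<noteq> i"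
  shows "u i (remainder W n \<omega>) = coord i n \<omega> - of_nat n * (if i = 1 then 1 else 0)"
proof -
  have "(\<Sum>k=2..r. of_nat n powr \<Lambda> (root k) * W k \<omega> * (if i = block_top k then 1 else 0)) = 0"
  proof (intro sum.neutral ballI)
    fix k assume "k \<in> {2..r}"
    from nt[OF this] show "of_nat n powr \<Lambda> (root k) * W k \<omega> * (if i = block_top k then 1 else 0) = 0" by simp
  qed
  then show ?thesis unfolding form_remainder[OF i] by simp
qed

lemma form_remainder_top:
  assumes k: "k \<in> {2..r}"
  shows "u (block_top k) (remainder W n \<omega>) = coord (block_top k) n \<omega>
    - of_real (1 / fact \<nu> * ln (real n) ^ \<nu>) * (of_nat n powr \<Lambda> (root k) * W k \<omega>)"
proof -
  have i: "block_top k \<in> {1..DIM('a)}" "block_top k \<noteq> 1" using root_range[OF k] by auto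
  have "(\<Sum>j=2..r. of_nat n powr \<Lambda> (root j) * W j \<omega> * (if block_top k = block_top j then 1 else 0))
    = (\<Sum>j=2..r. if j = k then of_nat n powr \<Lambda> (root k) * W k \<omega> else 0)"
    using block_top_inj[OF k] by (intro sum.cong) auto
  also have "\<dots> = of_nat n powr \<Lambda> (root k) * W k \<omega>" using k by simp
  finally show ?thesis unfolding form_remainder[OF i(1)] using i(2) by simp
qed

lemma limit_var_meas: "k \<in> {2..r} \<Longrightarrow> limit_var k \<in> borel_measurable M"
  unfolding limit_var_def by (rule root_limit_meas[OF J_props(1)])

lemma limit_var_dominated: "k \<in> {2..r} \<Longrightarrow> dominated M (\<lambda>_. 1) (\<lambda>_. limit_var k)"
  unfolding limit_var_def by (rule root_limit_dominated[OF J_props(1)])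

lemma norm_critical_powr: "critical_root m \<Longrightarrow> n \<ge> 1 \<Longrightarrow> norm (of_nat n powr \<Lambda> m) = real n powr \<sigma>"
  by (simp add: norm_of_nat_powr critical_root_def)

lemma remainder_component_of_dominated:
  assumes dom: "dominated M h (\<lambda>n \<omega>. u i (remainder W n \<omega>))"
    and le: "\<And>n. n \<ge> 1 \<Longrightarrow> h n \<le> scale n" and lim: "(\<lambda>n. h n / scale n) \<longlonglongrightarrow> 0"
  shows "dominated M scale (\<lambda>n \<omega>. u i (remainder W n \<omega>)) \<and>
    (AE \<omega> in M. (\<lambda>n. u i (remainder W n \<omega>) / of_real (scale n)) \<longlonglongrightarrow> 0)"
  using dominated_mono[OF dom le] dominated_ratio_tendsto_0[OF dom scale_pos lim] by blast

text \<open>Four kinds of coordinates. The first is deterministic and leaves the constant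
  \<open>\<tau> - 1\<close>; a real part below \<open>\<sigma>\<close> leaves order
  \<open>n powr \<rho>\<close>; a critical coordinate at offset \<open>p < \<nu>\<close> lacks a
  power of the logarithm; only the top of a principal block has the full order, and there the limit
  variable is subtracted.\<close>

lemma remainder_component:
  assumes i: "i \<in> {1..DIM('a)}"
  shows "dominated M scale (\<lambda>n \<omega>. u i (remainder limit_var n \<omega>)) \<and>
    (AE \<omega> in M. (\<lambda>n. u i (remainder limit_var n \<omega>) / of_real (scale n)) \<longlonglongrightarrow> 0)"
proof -
  have scale1: "1 \<le> scale n" if "n \<ge> 1" for n
  proof -
    have "1 * 1 \<le> real n powr \<sigma> * (1 + ln (real n)) ^ \<nu>"
      using that \<sigma>_half by (intro mult_mono one_le_power ge_one_powr_ge_zero) auto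
    then show ?thesis by (simp add: scale_def)
  qed
  have pow1: "1 \<le> (1 + ln (real n)) ^ p" if "n \<ge> 1" for n p
    using one_plus_ln_ge_1[OF that] by (rule one_le_power)
  show ?thesis
  proof (cases "i = 1")
    case True
    have nt: "block_top k \<noteq> i" if "k \<in> {2..r}" for k using root_range[OF that] True by auto
    have "AE \<omega> in M. \<forall>n\<ge>1. of_real (\<tau> - 1) = u i (remainder limit_var n \<omega>)"
      using coord_1
    proof eventually_elim
      case (elim \<omega>)
      show ?case
      proof (intro allI impI)
        fix n :: nat assume "n \<ge> 1"
        then have c: "coord i n \<omega> = of_real (real n + \<tau> - 1)" using elim unfolding True by blast
        have "u i (remainder limit_var n \<omega>) = coord i n \<omega> - of_nat n * (if i = 1 then 1 else 0)"
          by (rule form_remainder_not_top[OF i]) (rule nt)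
        then show "of_real (\<tau> - 1) = u i (remainder limit_var n \<omega>)" unfolding c if_P[OF True] by simp
      qed
    qed
    from dominated_cong_AE[OF dominated_const this]
    show ?thesis
    proof (rule remainder_component_of_dominated)
      show "(\<lambda>n. 1 / scale n) \<longlonglongrightarrow> 0" unfolding scale_def using \<sigma>_half by real_asymp
    qed (rule scale1)
  next
    case False
    then have i2: "i \<in> {2..DIM('a)}" using i by auto
    show ?thesis
    proof (cases "Re (\<Lambda> i) = \<sigma>")
      case False
      then have re: "Re (\<Lambda> i) < \<sigma>" using Re_Lam_le[OF i2] by simp
      have nt: "block_top k \<noteq> i" if "k \<in> {2..r}" for k
        using root_range[OF that] J_props(1)[OF that] False by (auto simp: critical_root_def)
      obtain \<rho> where \<rho>: "1/2 < \<rho>" "\<rho> < \<sigma>" "\<And>k. k \<in> {2..DIM('a)} \<Longrightarrow> Re (\<Lambda> k) < \<sigma> \<Longrightarrow> Re (\<Lambda> k) < \<rho>"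
        by (rule weight_gap_subcritical) (rule that, assumption+)
      have "dominated M (\<lambda>n. real n powr \<rho>) (coord i)" by (rule coord_subcritical[OF \<rho>(1,3) i2 re])
      moreover have "coord i = (\<lambda>n \<omega>. u i (remainder limit_var n \<omega>))"
        proof (intro ext)
        fix n \<omega>
        have "u i (remainder limit_var n \<omega>) = coord i n \<omega> - of_nat n * (if i = 1 then 1 else 0)"
          by (rule form_remainder_not_top[OF i]) (rule nt)
        then show "coord i n \<omega> = u i (remainder limit_var n \<omega>)" using \<open>i \<noteq> 1\<close> by simp
      qed
      ultimately have "dominated M (\<lambda>n. real n powr \<rho>) (\<lambda>n \<omega>. u i (remainder limit_var n \<omega>))" by (simp only:)
      then show ?thesis
      proof (rule remainder_component_of_dominated)
        fix n :: nat assume n: "n \<ge> 1"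
        have "real n powr \<rho> * 1 \<le> real n powr \<sigma> * (1 + ln (real n)) ^ \<nu>"
          using n \<rho>(2) pow1[OF n] by (intro mult_mono powr_mono) auto
        then show "real n powr \<rho> \<le> scale n" by (simp add: scale_def)
      next
        show "(\<lambda>n. real n powr \<rho> / scale n) \<longlonglongrightarrow> 0" unfolding scale_def using \<rho>(2) by real_asymp
      qed
    next
      case True
      obtain m p where mp: "critical_root m" "i = m + p" "\<Lambda> i = \<Lambda> m" "\<And>j. m < j \<Longrightarrow> j \<le> m + p \<Longrightarrow> \<epsilon> j = 1"
        "p \<le> \<nu>" "m = block_start i" "p = \<nu> \<Longrightarrow> \<exists>k\<in>{2..r}. root k = m \<and> block_top k = i"
        by (rule critical_position[OF i2 True]) (rule that, assumption+)
      have mpi: "m + p \<le> DIM('a)" using i mp(2) by simp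
      have lims: "dominated M (\<lambda>n. real n powr \<sigma> * (1 + ln (real n)) ^ p) (coord i)"
        "AE \<omega> in M. (\<lambda>n. coord i n \<omega> / of_nat n powr \<Lambda> m / of_real (ln (real n)) ^ p) \<longlonglongrightarrow> root_limit m \<omega> / fact p"
        unfolding mp(2) by (rule critical_limits[OF mp(1) mpi], rule mp(4), assumption+)+
      show ?thesis
      proof (cases "p = \<nu>")
        case False
        have nt: "block_top k \<noteq> i" if "k \<in> {2..r}" for k
        proof
          assume e: "block_top k = i"
          have "root k = m" using block_top_start[OF that] unfolding e mp(6) by (rule sym)
          then have "i = m + \<nu>" using J_props(2)[OF that] e by simp
          then show False using False mp(2) by linarith
        qed
        have "coord i = (\<lambda>n \<omega>. u i (remainder limit_var n \<omega>))"
          proof (intro ext)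
        fix n \<omega>
        have "u i (remainder limit_var n \<omega>) = coord i n \<omega> - of_nat n * (if i = 1 then 1 else 0)"
          by (rule form_remainder_not_top[OF i]) (rule nt)
        then show "coord i n \<omega> = u i (remainder limit_var n \<omega>)" using \<open>i \<noteq> 1\<close> by simp
      qed
        with lims(1) have "dominated M (\<lambda>n. real n powr \<sigma> * (1 + ln (real n)) ^ p) (\<lambda>n \<omega>. u i (remainder limit_var n \<omega>))"
          by (simp only:)
        then show ?thesis
        proof (rule remainder_component_of_dominated)
          fix n :: nat assume n: "n \<ge> 1"
          show "real n powr \<sigma> * (1 + ln (real n)) ^ p \<le> scale n"
            unfolding scale_def using n mp(5) by (intro mult_left_mono power_increasing) auto
        next
          have "p < \<nu>" using False mp(5) by simp
          then show "(\<lambda>n. real n powr \<sigma> * (1 + ln (real n)) ^ p / scale n) \<longlonglongrightarrow> 0"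
            unfolding scale_def by real_asymp
        qed
      next
        case True
        then obtain k where k: "k \<in> {2..r}" "root k = m" "block_top k = i" using mp(7) by blast
        define c where "c n = complex_of_real (1 / fact \<nu> * ln (real n) ^ \<nu>) * of_nat n powr \<Lambda> m" for n
        have rem: "u i (remainder limit_var n \<omega>) = coord i n \<omega> + (- c n * limit_var k \<omega>)" for n \<omega>
          using form_remainder_top[OF k(1), of limit_var n \<omega>] by (simp add: k(2,3) c_def)
        have d2: "dominated M scale (\<lambda>n \<omega>. - c n * limit_var k \<omega>)"
        proof (rule dominated_scale[OF limit_var_dominated[OF k(1)], of 1 _ "\<lambda>n. norm (c n)"])
          fix n :: nat assume n: "n \<ge> 1"
          have "norm (c n) = real n powr \<sigma> * (1 / fact \<nu> * ln (real n) ^ \<nu>)"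
            using n unfolding c_def norm_mult norm_critical_powr[OF mp(1) n] norm_of_real by (simp add: abs_of_nonneg)
          also have "\<dots> \<le> real n powr \<sigma> * (1 * (1 + ln (real n)) ^ \<nu>)"
            using n by (intro mult_left_mono mult_mono power_mono) (auto simp: fact_ge_1)
          finally show "norm (c n) * 1 \<le> 1 * scale n" by (simp add: scale_def)
        qed (auto simp: norm_mult)
        have d1: "dominated M scale (coord i)" using lims(1) unfolding True scale_def .
        have "dominated M scale (\<lambda>n \<omega>. coord i n \<omega> + (- c n * limit_var k \<omega>))"
          by (rule dominated_add[OF d1 d2]) (simp add: scale_pos less_imp_le)
        then have dom: "dominated M scale (\<lambda>n \<omega>. u i (remainder limit_var n \<omega>))" unfolding rem .
        have "AE \<omega> in M. (\<lambda>n. u i (remainder limit_var n \<omega>) / of_real (scale n)) \<longlonglongrightarrow> 0"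
          using lims(2)
        proof eventually_elim
          case (elim \<omega>)
          let ?q = "\<lambda>n. coord i n \<omega> / of_nat n powr \<Lambda> m / of_real (ln (real n)) ^ \<nu> - limit_var k \<omega> / fact \<nu>"
          have "(\<lambda>n. coord i n \<omega> / of_nat n powr \<Lambda> m / of_real (ln (real n)) ^ \<nu>) \<longlonglongrightarrow> limit_var k \<omega> / fact \<nu>"
            using elim unfolding True limit_var_def k(2) .
          then have "?q \<longlonglongrightarrow> limit_var k \<omega> / fact \<nu> - limit_var k \<omega> / fact \<nu>"
            by (rule tendsto_diff[OF _ tendsto_const])
          then have q0: "(\<lambda>n. norm (?q n)) \<longlonglongrightarrow> 0" by (simp add: tendsto_norm_zero)
          \<comment> \<open>The second factor corrects for \<open>1 + ln n\<close> in
            \<open>scale\<close> against \<open>ln n\<close> in the limit and tends to 1.\<close>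
          have "(\<lambda>n. norm (?q n) * (ln (real n) ^ \<nu> / (1 + ln (real n)) ^ \<nu>)) \<longlonglongrightarrow> 0 * 1"
            by (intro tendsto_mult q0 ln_power_ratio)
          moreover have "eventually (\<lambda>n. norm (?q n) * (ln (real n) ^ \<nu> / (1 + ln (real n)) ^ \<nu>)
              = norm (u i (remainder limit_var n \<omega>) / of_real (scale n))) sequentially"
            using eventually_gt_at_top[of 1]
          proof eventually_elim
            case (elim n)
            have n: "n \<ge> 1" using elim by simp
            have ln0: "ln (real n) > 0" using elim by simp
            then have l0: "complex_of_real (ln (real n)) ^ \<nu> \<noteq> 0" by simp
            have p0: "of_nat n powr \<Lambda> m \<noteq> 0" using elim by simp
            have eq: "u i (remainder limit_var n \<omega>) = ?q n * of_nat n powr \<Lambda> m * of_real (ln (real n)) ^ \<nu>"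
              unfolding rem c_def using l0 p0 by (simp add: field_simps)
            have nq: "norm (u i (remainder limit_var n \<omega>)) = norm (?q n) * real n powr \<sigma> * ln (real n) ^ \<nu>"
              unfolding eq norm_mult norm_critical_powr[OF mp(1) n] using ln0 by (simp add: norm_power)
            have nd: "norm (u i (remainder limit_var n \<omega>) / of_real (scale n)) = norm (u i (remainder limit_var n \<omega>)) / scale n"
              using scale_pos[OF n] by (simp add: norm_divide)
            have "real n powr \<sigma> \<noteq> 0" using n by simp
            then show ?case unfolding nd unfolding nq unfolding scale_def by simp
          qed
          ultimately have "(\<lambda>n. norm (u i (remainder limit_var n \<omega>) / of_real (scale n))) \<longlonglongrightarrow> 0"
            by (auto intro: Lim_transform_eventually)
          then show ?case by (rule tendsto_norm_zero_cancel)
        qed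
        with dom show ?thesis by blast
      qed
    qed
  qed
qed

lemma cscale_meas: "f \<in> borel_measurable M \<Longrightarrow> (\<lambda>\<omega>. cscale (f \<omega>) z) \<in> borel_measurable M"
  for z :: "'a \<times> 'a"
  by (rule linear_borel_measurable[OF cscale_linear])

lemma remainder_meas:
  assumes n: "n \<ge> 1"
  shows "remainder limit_var n \<in> borel_measurable M"
proof -
  have "linear (cembed :: 'a \<Rightarrow> 'a \<times> 'a)" by (rule linearI) (auto simp: cembed_def)
  then have 1: "(\<lambda>\<omega>. cembed (X n \<omega>)) \<in> borel_measurable M"
    by (rule linear_borel_measurable[OF _ X_meas[OF n]])
  show ?thesis unfolding remainder_def[abs_def]
    by (intro borel_measurable_diff 1 borel_measurable_add borel_measurable_const borel_measurable_scaleR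
        borel_measurable_sum cscale_meas borel_measurable_times limit_var_meas)
qed

lemma limit_expansion: "polya_expansion M X v \<Lambda> \<sigma> \<nu> r J limit_var"
proof -
  let ?R = "remainder limit_var"
  let ?N = "\<lambda>i. 2 * norm (v i)"
  have bound: "norm (?R n \<omega>) \<le> (\<Sum>i=1..DIM('a). ?N i * norm (u i (?R n \<omega>)))" for n \<omega>
  proof -
    have "norm (?R n \<omega>) = norm (\<Sum>i=1..DIM('a). cscale (u i (?R n \<omega>)) (v i))" using expand[of "?R n \<omega>"] by simp
    also have "\<dots> \<le> (\<Sum>i=1..DIM('a). ?N i * norm (u i (?R n \<omega>)))"
    proof (rule sum_norm_le)
      fix i
      have "norm (cscale (u i (?R n \<omega>)) (v i)) \<le> 2 * norm (u i (?R n \<omega>)) * norm (v i)" by (rule norm_cscale_le)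
      then show "norm (cscale (u i (?R n \<omega>)) (v i)) \<le> ?N i * norm (u i (?R n \<omega>))" by (simp add: mult_ac)
    qed
    finally show ?thesis .
  qed
  have dom: "dominated M scale ?R"
  proof (rule dominated_combine[of "{1..DIM('a)}" "\<lambda>_. scale" "\<lambda>i n \<omega>. u i (?R n \<omega>)" "\<Sum>i=1..DIM('a). ?N i"])
    show "dominated M scale (\<lambda>n \<omega>. u i (?R n \<omega>))" if "i \<in> {1..DIM('a)}" for i
      using remainder_component[OF that] by blast
    show "(\<Sum>i=1..DIM('a). ?N i) \<ge> 0" by (intro sum_nonneg) auto
    show "AE \<omega> in M. \<forall>h. (\<forall>i\<in>{1..DIM('a)}. h i \<ge> 0 \<and> (\<forall>n\<ge>1. norm (u i (?R n \<omega>)) \<le> h i * scale n)) \<longrightarrow>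
       (\<forall>n\<ge>1. norm (?R n \<omega>) \<le> (\<Sum>i=1..DIM('a). ?N i) * (1 + (\<Sum>i\<in>{1..DIM('a)}. h i)) * scale n)"
    proof (intro AE_I2 allI impI)
      fix \<omega> h n assume h: "\<forall>i\<in>{1..DIM('a)}. (0::real) \<le> h i \<and> (\<forall>n\<ge>1. norm (u i (?R n \<omega>)) \<le> h i * scale n)"
        and n: "(1::nat) \<le> n"
      have "norm (?R n \<omega>) \<le> (\<Sum>i=1..DIM('a). ?N i * ((1 + (\<Sum>j\<in>{1..DIM('a)}. h j)) * scale n))"
      proof (rule order_trans[OF bound sum_mono])
        fix i assume i: "i \<in> {1..DIM('a)}"
        have "h i \<le> (\<Sum>j\<in>{1..DIM('a)}. h j)" using h i by (intro member_le_sum) auto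
        then have "h i * scale n \<le> (1 + (\<Sum>j\<in>{1..DIM('a)}. h j)) * scale n"
          using scale_pos[OF n] by (intro mult_right_mono) auto
        then have "norm (u i (?R n \<omega>)) \<le> (1 + (\<Sum>j\<in>{1..DIM('a)}. h j)) * scale n" using h i n by fastforce
        then show "?N i * norm (u i (?R n \<omega>)) \<le> ?N i * ((1 + (\<Sum>j\<in>{1..DIM('a)}. h j)) * scale n)"
          by (rule mult_left_mono) simp
      qed
      then show "norm (?R n \<omega>) \<le> (\<Sum>i=1..DIM('a). ?N i) * (1 + (\<Sum>i\<in>{1..DIM('a)}. h i)) * scale n"
        unfolding sum_distrib_right[symmetric] by (simp only: mult.assoc)
    qed
  qed simp
  have "AE \<omega> in M. \<forall>i\<in>{1..DIM('a)}. (\<lambda>n. u i (?R n \<omega>) / of_real (scale n)) \<longlonglongrightarrow> 0"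
    using remainder_component by (simp add: AE_finite_all)
  then have lim: "AE \<omega> in M. (\<lambda>n. norm (?R n \<omega>) / scale n) \<longlonglongrightarrow> 0"
  proof eventually_elim
    case (elim \<omega>)
    have "(\<lambda>n. \<Sum>i=1..DIM('a). ?N i * norm (u i (?R n \<omega>) / of_real (scale n))) \<longlonglongrightarrow> (\<Sum>i=1..DIM('a). ?N i * 0)"
      using elim by (intro tendsto_sum tendsto_mult tendsto_const tendsto_norm_zero) auto
    then have l0: "(\<lambda>n. \<Sum>i=1..DIM('a). ?N i * norm (u i (?R n \<omega>) / of_real (scale n))) \<longlonglongrightarrow> 0" by simp
    have "norm (norm (?R n \<omega>) / scale n) \<le> (\<Sum>i=1..DIM('a). ?N i * norm (u i (?R n \<omega>) / of_real (scale n)))"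
      if n: "n \<ge> 1" for n
    proof -
      have "norm (?R n \<omega>) / scale n \<le> (\<Sum>i=1..DIM('a). ?N i * norm (u i (?R n \<omega>))) / scale n"
        using scale_pos[OF n] by (intro divide_right_mono bound) auto
      also have "\<dots> = (\<Sum>i=1..DIM('a). ?N i * norm (u i (?R n \<omega>) / of_real (scale n)))"
        using scale_pos[OF n] by (simp add: sum_divide_distrib norm_divide)
      finally show ?thesis using scale_pos[OF n] by simp
    qed
    then have "eventually (\<lambda>n. norm (norm (?R n \<omega>) / scale n)
        \<le> (\<Sum>i=1..DIM('a). ?N i * norm (u i (?R n \<omega>) / of_real (scale n)))) sequentially"
      by (intro eventually_sequentiallyI[of 1])
    then show ?case using l0 by (rule Lim_null_comparison)
  qed
  have "scale \<in> O(\<lambda>n. real n powr \<sigma> * ln (real n) ^ \<nu>)" unfolding scale_def[abs_def] by (rule ln_power_bigo)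
  from dominated_smallo[OF dom remainder_meas scale_pos this lim] show ?thesis unfolding expansion_iff .
qed

text \<open>Applied to the difference of the two remainders, the form at the top of block
  \<open>k\<close> isolates \<open>W' k - limit_var k\<close> times a quantity of exact order
  \<open>n powr \<sigma> * ln n ^ \<nu>\<close>, while both remainders are of smaller order.\<close>

lemma expansion_unique:
  assumes W': "polya_expansion M X v \<Lambda> \<sigma> \<nu> r J W'" and k: "k \<in> {2..r}"
  shows "AE \<omega> in M. W' k \<omega> = limit_var k \<omega>"
proof -
  let ?h = "\<lambda>n. real n powr \<sigma> * ln (real n) ^ \<nu>"
  have i: "block_top k \<in> {1..DIM('a)}" using root_range[OF k] by auto
  have crit: "critical_root (root k)" by (rule J_props(1)[OF k])
  obtain C where C: "C > 0" "\<And>z. norm (u (block_top k) z) \<le> norm z * C"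
    using bounded_linear.pos_bounded[OF complex_linear_form_bounded_linear[OF u_form[OF i]]] by blast
  have "AE \<omega> in M. (\<lambda>n. norm (remainder W' n \<omega>)) \<in> o(?h)" "AE \<omega> in M. (\<lambda>n. norm (remainder limit_var n \<omega>)) \<in> o(?h)"
    using W' limit_expansion unfolding expansion_iff smallo_as_Lp_def by blast+
  then show ?thesis
  proof eventually_elim
    case (elim \<omega>)
    let ?d = "norm (W' k \<omega> - limit_var k \<omega>) / fact \<nu>"
    have "(\<lambda>n. norm (remainder W' n \<omega>) + norm (remainder limit_var n \<omega>)) \<in> o(?h)"
      using elim by (rule sum_in_smallo)
    then have lim: "(\<lambda>n. (norm (remainder W' n \<omega>) + norm (remainder limit_var n \<omega>)) / ?h n) \<longlonglongrightarrow> 0"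
      by (rule smalloD_tendsto)
    have le: "?d \<le> (norm (remainder W' n \<omega>) + norm (remainder limit_var n \<omega>)) / ?h n * C" if n: "n > 1" for n
    proof -
      have n1: "n \<ge> 1" using n by simp
      have h: "?h n > 0" using n by simp
      have "u (block_top k) (remainder limit_var n \<omega>) - u (block_top k) (remainder W' n \<omega>)
         = of_real (1 / fact \<nu> * ln (real n) ^ \<nu>) * (of_nat n powr \<Lambda> (root k) * (W' k \<omega> - limit_var k \<omega>))"
        unfolding form_remainder_top[OF k] by (simp add: right_diff_distrib)
      moreover have "norm (of_real (1 / fact \<nu> * ln (real n) ^ \<nu>) * (of_nat n powr \<Lambda> (root k) * (W' k \<omega> - limit_var k \<omega>))) = ?d * ?h n"
        unfolding norm_mult norm_critical_powr[OF crit n1] norm_of_real using n by (simp add: abs_of_nonneg)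
      ultimately have "?d * ?h n = norm (u (block_top k) (remainder limit_var n \<omega>) - u (block_top k) (remainder W' n \<omega>))" by simp
      also have "\<dots> \<le> norm (u (block_top k) (remainder limit_var n \<omega>)) + norm (u (block_top k) (remainder W' n \<omega>))"
        by (rule norm_triangle_ineq4)
      also have "\<dots> \<le> norm (remainder limit_var n \<omega>) * C + norm (remainder W' n \<omega>) * C" by (intro add_mono C(2))
      finally show ?thesis using h by (simp add: pos_le_divide_eq algebra_simps)
    qed
    have "(\<lambda>n. (norm (remainder W' n \<omega>) + norm (remainder limit_var n \<omega>)) / ?h n * C) \<longlonglongrightarrow> 0"
      using tendsto_mult[OF lim tendsto_const[of C]] by simp
    moreover have "eventually (\<lambda>n. ?d \<le> (norm (remainder W' n \<omega>) + norm (remainder limit_var n \<omega>)) / ?h n * C) sequentially"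
      using eventually_gt_at_top[of 1] by eventually_elim (rule le)
    ultimately have "?d \<le> 0" by (intro tendsto_lowerbound) auto
    then show ?case using fact_gt_zero[of \<nu>, where 'a = real] by (simp add: divide_le_0_iff)
  qed
qed

end

subsection \<open>Joint moments\<close>

context polya_principal
begin

text \<open>The dimension is a crude common bound for the logarithmic exponents; the strict gaps
  between weights later absorb any power of the logarithm.\<close>

lemma coord_dominated_weight:
  assumes k: "k \<in> {1..DIM('a)}"
  shows "dominated M (\<lambda>n. real n powr weight k * (1 + ln (real n)) ^ DIM('a)) (coord k)"
proof -
  have pow1: "1 \<le> (1 + ln (real n)) ^ p" if "n \<ge> 1" for n p
    using one_plus_ln_ge_1[OF that] by (rule one_le_power)
  have simple: "dominated M (\<lambda>n. real n powr weight k * (1 + ln (real n)) ^ DIM('a)) (coord k)"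
    if d: "dominated M (\<lambda>n. real n powr a) (coord k)" and a: "a \<le> weight k" for a
  proof (rule dominated_mono[OF d])
    fix n :: nat assume n: "n \<ge> 1"
    have "real n powr a * 1 \<le> real n powr weight k * (1 + ln (real n)) ^ DIM('a)"
      using n a pow1[OF n] by (intro mult_mono powr_mono) auto
    then show "real n powr a \<le> real n powr weight k * (1 + ln (real n)) ^ DIM('a)" by simp
  qed
  show ?thesis
  proof (cases "k = 1")
    case True
    have "dominated M (\<lambda>n. real n powr 1) (coord k)"
    proof (rule dominated_bounded)
      show "AE \<omega> in M. \<forall>n\<ge>1. norm (coord k n \<omega>) \<le> (1 + \<tau>) * real n powr 1"
        using coord_1
      proof eventually_elim
        case (elim \<omega>)
        show ?case
        proof (intro allI impI)
          fix n :: nat assume n: "n \<ge> 1"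
          have "norm (coord k n \<omega>) = real n + \<tau> - 1"
            using elim n denominator_pos[OF n] unfolding True by (simp del: of_real_add of_real_diff)
          also have "\<dots> \<le> (1 + \<tau>) * real n"
          proof -
            have "\<tau> * 1 \<le> \<tau> * real n" using n tau_pos by (intro mult_left_mono) auto
            then show ?thesis by (simp add: distrib_right)
          qed
          finally show "norm (coord k n \<omega>) \<le> (1 + \<tau>) * real n powr 1" by simp
        qed
      qed
    qed (use tau_pos in simp)
    then show ?thesis by (rule simple) (simp add: True weight_def)
  next
    case False
    then have k2: "k \<in> {2..DIM('a)}" and wt: "weight k = \<sigma>" using k by (auto simp: weight_def)
    show ?thesis
    proof (cases "Re (\<Lambda> k) = \<sigma>")
      case False
      then have re: "Re (\<Lambda> k) < \<sigma>" using Re_Lam_le[OF k2] by simp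
      obtain \<rho> where \<rho>: "1/2 < \<rho>" "\<rho> < \<sigma>" "\<And>k. k \<in> {2..DIM('a)} \<Longrightarrow> Re (\<Lambda> k) < \<sigma> \<Longrightarrow> Re (\<Lambda> k) < \<rho>"
        by (rule weight_gap_subcritical) (rule that, assumption+)
      have "dominated M (\<lambda>n. real n powr \<rho>) (coord k)" by (rule coord_subcritical[OF \<rho>(1,3) k2 re])
      then show ?thesis by (rule simple) (use \<rho>(2) wt in simp)
    next
      case True
      obtain m p where mp: "critical_root m" "k = m + p" "\<Lambda> k = \<Lambda> m" "\<And>j. m < j \<Longrightarrow> j \<le> m + p \<Longrightarrow> \<epsilon> j = 1"
        "p \<le> \<nu>" "m = block_start k" "p = \<nu> \<Longrightarrow> \<exists>j\<in>{2..r}. root j = m \<and> block_top j = k"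
        by (rule critical_position[OF k2 True]) (rule that, assumption+)
      have mpk: "m + p \<le> DIM('a)" using k mp(2) by simp
      have "dominated M (\<lambda>n. real n powr \<sigma> * (1 + ln (real n)) ^ p) (coord k)"
        unfolding mp(2) by (rule critical_limits(1)[OF mp(1) mpk], rule mp(4), assumption+)
      then show ?thesis
      proof (rule dominated_mono)
        fix n :: nat assume n: "n \<ge> 1"
        show "real n powr \<sigma> * (1 + ln (real n)) ^ p \<le> real n powr weight k * (1 + ln (real n)) ^ DIM('a)"
          unfolding wt using n mpk by (intro mult_left_mono power_increasing) auto
      qed
    qed
  qed
qed

lemma monomial_dominated:
  assumes "set ks \<subseteq> {1..DIM('a)}"
  shows "dominated M (\<lambda>n. real n powr mono_weight ks * (1 + ln (real n)) ^ (DIM('a) * length ks))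
    (\<lambda>n \<omega>. monomial ks (cembed (X n \<omega>)))"
  using assms
proof (induction ks)
  case Nil
  have "dominated M (\<lambda>_. 1) (\<lambda>n \<omega>. monomial [] (cembed (X n \<omega>)))" by (simp add: dominated_const)
  then show ?case by (rule dominated_mono) simp
next
  case (Cons k ks)
  have k: "k \<in> {1..DIM('a)}" and ks: "set ks \<subseteq> {1..DIM('a)}" using Cons.prems by auto
  have "dominated M (\<lambda>n. (real n powr weight k * (1 + ln (real n)) ^ DIM('a)) *
      (real n powr mono_weight ks * (1 + ln (real n)) ^ (DIM('a) * length ks)))
      (\<lambda>n \<omega>. coord k n \<omega> * monomial ks (cembed (X n \<omega>)))"
    by (rule dominated_mult[OF coord_dominated_weight[OF k] Cons.IH[OF ks]])
  then have "dominated M (\<lambda>n. (real n powr weight k * (1 + ln (real n)) ^ DIM('a)) *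
      (real n powr mono_weight ks * (1 + ln (real n)) ^ (DIM('a) * length ks)))
      (\<lambda>n \<omega>. monomial (k # ks) (cembed (X n \<omega>)))"
    by (simp add: coord_def)
  then show ?case by (rule dominated_mono) (simp add: powr_add power_add mult_ac)
qed

lemma weight_space_dominated:
  assumes "f \<in> weight_space \<theta>"
  shows "\<exists>N. dominated M (\<lambda>n. real n powr \<theta> * (1 + ln (real n)) ^ N) (\<lambda>n \<omega>. f (cembed (X n \<omega>)))"
  using assms unfolding weight_space_def
proof (induction rule: mono_span.induct)
  case zero
  show ?case by (intro exI[of _ 0] dominated_bounded[of _ 0]) auto
next
  case (step f ks c)
  obtain N where N: "dominated M (\<lambda>n. real n powr \<theta> * (1 + ln (real n)) ^ N) (\<lambda>n \<omega>. f (cembed (X n \<omega>)))"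
    using step.IH by blast
  let ?D = "DIM('a) * length ks"
  let ?h = "\<lambda>n. real n powr \<theta> * (1 + ln (real n)) ^ max N ?D"
  have pos: "0 \<le> real n powr a * (1 + ln (real n)) ^ q" if "n \<ge> 1" for n a q
    using that by (intro mult_nonneg_nonneg zero_le_power) auto
  have "dominated M ?h (\<lambda>n \<omega>. f (cembed (X n \<omega>)))"
  proof (rule dominated_mono[OF N])
    fix n :: nat assume n: "n \<ge> 1"
    show "real n powr \<theta> * (1 + ln (real n)) ^ N \<le> ?h n"
      using n by (intro mult_left_mono power_increasing) auto
  qed
  moreover have "dominated M ?h (\<lambda>n \<omega>. c * monomial ks (cembed (X n \<omega>)))"
  proof (rule dominated_scale[OF monomial_dominated[OF step.hyps(2)], of "norm c" _ "\<lambda>_. norm c"])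
    fix n :: nat assume n: "n \<ge> 1"
    show "norm c * (real n powr mono_weight ks * (1 + ln (real n)) ^ ?D) \<le> norm c * ?h n"
      using n step.hyps(3) by (intro mult_left_mono mult_mono power_increasing powr_mono) auto
    show "0 \<le> real n powr mono_weight ks * (1 + ln (real n)) ^ ?D" by (rule pos[OF n])
  qed (auto simp: norm_mult)
  ultimately have "dominated M ?h (\<lambda>n \<omega>. f (cembed (X n \<omega>)) + c * monomial ks (cembed (X n \<omega>)))"
    by (rule dominated_add) (rule pos)
  then show ?case by blast
qed

lemma lower_order_expectation:
  assumes f: "f \<in> weight_space \<theta>" and \<theta>: "\<theta> < Re c"
  shows "(\<lambda>n. expectation (\<lambda>\<omega>. f (cembed (X n \<omega>))) / of_nat n powr c) \<longlonglongrightarrow> 0"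
proof -
  obtain N where N: "dominated M (\<lambda>n. real n powr \<theta> * (1 + ln (real n)) ^ N) (\<lambda>n \<omega>. f (cembed (X n \<omega>)))"
    using weight_space_dominated[OF f] by blast
  have fp: "f \<in> polynomial_functions" using f mono_span_polynomial by (auto simp: weight_space_def)
  obtain C where C: "\<And>n. n \<ge> 1 \<Longrightarrow> norm (expectation (\<lambda>\<omega>. f (cembed (X n \<omega>)))) \<le> C * (real n powr \<theta> * (1 + ln (real n)) ^ N)"
    using dominated_expectation_bound[OF N polynomial_meas[OF fp]] by blast
  have lim: "(\<lambda>n. C * (real n powr \<theta> * (1 + ln (real n)) ^ N / real n powr Re c)) \<longlonglongrightarrow> 0"
    using tendsto_mult[OF tendsto_const ln_power_times_powr_tendsto_0[OF \<theta>, of N], of C] by simp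
  have "norm (expectation (\<lambda>\<omega>. f (cembed (X n \<omega>))) / of_nat n powr c)
      \<le> C * (real n powr \<theta> * (1 + ln (real n)) ^ N / real n powr Re c)" if n: "n \<ge> 1" for n
    using divide_right_mono[OF C[OF n], of "real n powr Re c"] by (simp add: norm_divide norm_of_nat_powr[OF n])
  then have "eventually (\<lambda>n. norm (expectation (\<lambda>\<omega>. f (cembed (X n \<omega>))) / of_nat n powr c)
      \<le> C * (real n powr \<theta> * (1 + ln (real n)) ^ N / real n powr Re c)) sequentially"
    by (intro eventually_sequentiallyI[of 1])
  then show ?thesis using lim by (rule Lim_null_comparison)
qed

text \<open>Domination by a constant scale accompanies the pointwise limit so that the expectation
  may be taken in the limit.\<close>

lemma monomial_limit:
  assumes "\<And>k. k \<in> set ks \<Longrightarrow> critical_root k"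
  shows "dominated M (\<lambda>_. 1) (\<lambda>n \<omega>. monomial ks (cembed (X n \<omega>)) / of_nat n powr mono_root ks) \<and>
    dominated M (\<lambda>_. 1) (\<lambda>(n::nat) \<omega>. \<Prod>k\<leftarrow>ks. root_limit k \<omega>) \<and>
    (\<lambda>\<omega>. \<Prod>k\<leftarrow>ks. root_limit k \<omega>) \<in> borel_measurable M \<and>
    (AE \<omega> in M. (\<lambda>n. monomial ks (cembed (X n \<omega>)) / of_nat n powr mono_root ks) \<longlonglongrightarrow> (\<Prod>k\<leftarrow>ks. root_limit k \<omega>))"
  using assms
proof (induction ks)
  case Nil
  have d: "dominated M (\<lambda>_. 1) (\<lambda>(n::nat) \<omega>. 1 / of_nat n powr 0 :: complex)"
    by (rule dominated_bounded[of _ 1]) auto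
  \<comment> \<open>Constant only from \<open>n = 1\<close> on, because
    \<open>0 powr 0 = 0\<close>.\<close>
  have "(\<lambda>n. 1 / of_nat n powr 0 :: complex) \<longlonglongrightarrow> 1"
    by (rule Lim_transform_eventually[OF tendsto_const])
      (use eventually_gt_at_top[of 0] in \<open>eventually_elim, simp\<close>)
  then show ?case using d by (simp add: dominated_const)
next
  case (Cons k ks)
  have k: "critical_root k" using Cons.prems by simp
  have kD: "k + 0 \<le> DIM('a)" using k by (simp add: critical_root_def)
  have IH: "dominated M (\<lambda>_. 1) (\<lambda>n \<omega>. monomial ks (cembed (X n \<omega>)) / of_nat n powr mono_root ks)"
    "dominated M (\<lambda>_. 1) (\<lambda>(n::nat) \<omega>. \<Prod>k\<leftarrow>ks. root_limit k \<omega>)"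
    "(\<lambda>\<omega>. \<Prod>k\<leftarrow>ks. root_limit k \<omega>) \<in> borel_measurable M"
    "AE \<omega> in M. (\<lambda>n. monomial ks (cembed (X n \<omega>)) / of_nat n powr mono_root ks) \<longlonglongrightarrow> (\<Prod>k\<leftarrow>ks. root_limit k \<omega>)"
    using Cons by auto
  have L1: "dominated M (\<lambda>n. real n powr \<sigma> * (1 + ln (real n)) ^ 0) (coord (k + 0))"
    by (rule critical_limits(1)[OF k kD]) simp
  have L2: "AE \<omega> in M. (\<lambda>n. coord (k + 0) n \<omega> / of_nat n powr \<Lambda> k / of_real (ln (real n)) ^ 0) \<longlonglongrightarrow> root_limit k \<omega> / fact 0"
    by (rule critical_limits(2)[OF k kD]) simp
  have d1: "dominated M (\<lambda>_. 1) (\<lambda>n \<omega>. coord k n \<omega> / of_nat n powr \<Lambda> k)"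
  proof (rule dominated_scale[OF L1, of 1 _ "\<lambda>n. real n powr (- \<sigma>)"])
    fix n :: nat and \<omega> assume n: "n \<ge> 1"
    show "norm (coord k n \<omega> / of_nat n powr \<Lambda> k) \<le> real n powr (- \<sigma>) * norm (coord (k + 0) n \<omega>)"
      unfolding norm_divide norm_critical_powr[OF k n] by (simp add: powr_minus divide_inverse mult.commute)
    show "real n powr (- \<sigma>) * (real n powr \<sigma> * (1 + ln (real n)) ^ 0) \<le> 1 * 1"
      using n by (simp add: powr_minus)
  qed auto
  have split: "monomial (k # ks) (cembed (X n \<omega>)) / of_nat n powr mono_root (k # ks)
      = coord k n \<omega> / of_nat n powr \<Lambda> k * (monomial ks (cembed (X n \<omega>)) / of_nat n powr mono_root ks)" for n \<omega>
    by (simp add: coord_def powr_add)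
  have "dominated M (\<lambda>_. 1 * 1) (\<lambda>n \<omega>. monomial (k # ks) (cembed (X n \<omega>)) / of_nat n powr mono_root (k # ks))"
    unfolding split by (rule dominated_mult[OF d1 IH(1)])
  moreover have "dominated M (\<lambda>_. 1 * 1) (\<lambda>(n::nat) \<omega>. root_limit k \<omega> * (\<Prod>k\<leftarrow>ks. root_limit k \<omega>))"
    by (rule dominated_mult[OF root_limit_dominated[OF k] IH(2)])
  moreover have "(\<lambda>\<omega>. root_limit k \<omega> * (\<Prod>k\<leftarrow>ks. root_limit k \<omega>)) \<in> borel_measurable M"
    by (intro borel_measurable_times root_limit_meas[OF k] IH(3))
  moreover have "AE \<omega> in M. (\<lambda>n. monomial (k # ks) (cembed (X n \<omega>)) / of_nat n powr mono_root (k # ks))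
      \<longlonglongrightarrow> root_limit k \<omega> * (\<Prod>k\<leftarrow>ks. root_limit k \<omega>)"
    using L2 IH(4)
  proof eventually_elim
    case (elim \<omega>)
    have "(\<lambda>n. coord k n \<omega> / of_nat n powr \<Lambda> k) \<longlonglongrightarrow> root_limit k \<omega>" using elim(1) by simp
    from tendsto_mult[OF this elim(2)] show ?case unfolding split .
  qed
  ultimately show ?case by simp
qed

text \<open>The limit of the normalised expectation of the monomial is computed twice: by dominated
  convergence it is the moment, and by the splitting into \<open>Q\<close> and \<open>h\<close> it
  is the explicit value for the eigenvector plus a term that vanishes.\<close>

lemma moment_formula:
  assumes crit: "\<And>k. k \<in> set ks \<Longrightarrow> critical_root k"
  shows "integrable M (\<lambda>\<omega>. \<Prod>k\<leftarrow>ks. root_limit k \<omega>)"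
    and "expectation (\<lambda>\<omega>. \<Prod>k\<leftarrow>ks. root_limit k \<omega>)
      = norming (mono_root ks) * char_component w l (mono_root ks) (monomial ks) (cembed x1)"
proof -
  let ?P = "\<lambda>\<omega>. \<Prod>k\<leftarrow>ks. root_limit k \<omega>"
  let ?c = "mono_root ks"
  have L: "dominated M (\<lambda>_. 1) (\<lambda>n \<omega>. monomial ks (cembed (X n \<omega>)) / of_nat n powr ?c)"
    "dominated M (\<lambda>_. 1) (\<lambda>(n::nat). ?P)" "?P \<in> borel_measurable M"
    "AE \<omega> in M. (\<lambda>n. monomial ks (cembed (X n \<omega>)) / of_nat n powr ?c) \<longlonglongrightarrow> ?P \<omega>"
    using monomial_limit[OF crit] by auto
  have props: "\<epsilon> k = 0 \<and> Re (\<Lambda> k) = \<sigma>" if "k \<in> set ks" for k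
    using crit that by (auto simp: critical_root_def)
  have ks2: "set ks \<subseteq> {2..DIM('a)}" using crit by (auto simp: critical_root_def)
  then have ks1: "set ks \<subseteq> {1..DIM('a)}" by auto
  have "integrable M (\<lambda>\<omega>. norm (?P \<omega>) ^ 1)"
    by (rule dominated_integrable_power[OF L(2), where n = 1]) (use L(3) in auto)
  then show "integrable M ?P" using L(3) by (simp add: integrable_norm_iff)
  obtain Q h where Qh: "monomial ks = (\<lambda>z. Q z + h z)" "shifted_op \<Phi> ?c Q = (\<lambda>_. 0)"
    "Q \<in> polynomial_functions" "h \<in> weight_space (mono_weight ks + 1 - 2 * \<sigma>)"
    "char_component w l ?c (monomial ks) = Q"
    by (rule reduced_decomposition[OF ks2 props]) (assumption | rule that)+
  have hp: "h \<in> polynomial_functions" using Qh(4) mono_span_polynomial by (auto simp: weight_space_def)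
  have Rec: "Re ?c = mono_weight ks"
    using crit
  proof (induction ks)
    case (Cons k ks)
    have "weight k = \<sigma>" "Re (\<Lambda> k) = \<sigma>" using Cons.prems[of k] by (auto simp: critical_root_def weight_def)
    then show ?case using Cons by simp
  qed simp
  have "(\<lambda>n. expectation (\<lambda>\<omega>. monomial ks (cembed (X (Suc n) \<omega>)) / of_nat (Suc n) powr ?c)) \<longlonglongrightarrow> expectation ?P"
  proof -
    obtain K where K: "K \<in> borel_measurable M" "\<And>\<omega>. 0 \<le> K \<omega>" "integrable M (\<lambda>\<omega>. K \<omega> ^ 1)"
      "AE \<omega> in M. \<forall>n\<ge>1. norm (monomial ks (cembed (X n \<omega>)) / of_nat n powr ?c) \<le> K \<omega> * 1"
      using L(1) unfolding dominated_def by blast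
    show ?thesis
    proof (rule integral_dominated_convergence[where w = K])
      show "AE \<omega> in M. (\<lambda>n. monomial ks (cembed (X (Suc n) \<omega>)) / of_nat (Suc n) powr ?c) \<longlonglongrightarrow> ?P \<omega>"
        using L(4) by eventually_elim (rule LIMSEQ_Suc)
      show "AE \<omega> in M. norm (monomial ks (cembed (X (Suc n) \<omega>)) / of_nat (Suc n) powr ?c) \<le> K \<omega>" for n
        using K(4)
      proof eventually_elim
        case (elim \<omega>)
        from elim[rule_format, of "Suc n"] show ?case by (simp del: of_nat_Suc)
      qed
      show "(\<lambda>\<omega>. monomial ks (cembed (X (Suc n) \<omega>)) / of_nat (Suc n) powr ?c) \<in> borel_measurable M" for n
        by (intro borel_measurable_divide borel_measurable_const polynomial_meas monomial_polynomial ks1) simp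
    qed (use K L in auto)
  qed
  then have lim1: "(\<lambda>n. expectation (\<lambda>\<omega>. monomial ks (cembed (X n \<omega>)) / of_nat n powr ?c)) \<longlonglongrightarrow> expectation ?P"
    by (rule LIMSEQ_imp_Suc)
  have lim2: "(\<lambda>n. polya_factor \<tau> ?c n / of_nat n powr ?c * Q (cembed x1)
      + expectation (\<lambda>\<omega>. h (cembed (X n \<omega>))) / of_nat n powr ?c) \<longlonglongrightarrow> norming ?c * Q (cembed x1) + 0"
    by (intro tendsto_intros polya_factor_norming lower_order_expectation[OF Qh(4)]) (use Rec \<sigma>_half in simp)
  have ev: "eventually (\<lambda>n. polya_factor \<tau> ?c n / of_nat n powr ?c * Q (cembed x1)
      + expectation (\<lambda>\<omega>. h (cembed (X n \<omega>))) / of_nat n powr ?c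
      = expectation (\<lambda>\<omega>. monomial ks (cembed (X n \<omega>)) / of_nat n powr ?c)) sequentially"
    using eventually_ge_at_top[of 1]
  proof eventually_elim
    case (elim n)
    have "expectation (\<lambda>\<omega>. monomial ks (cembed (X n \<omega>)))
       = expectation (\<lambda>\<omega>. Q (cembed (X n \<omega>))) + expectation (\<lambda>\<omega>. h (cembed (X n \<omega>)))"
      unfolding Qh(1) by (rule Bochner_Integration.integral_add) (rule polynomial_integrable[OF Qh(3) elim] polynomial_integrable[OF hp elim])+
    then show ?case by (simp add: eigen_expectation[OF Qh(3,2) elim] add_divide_distrib)
  qed
  have "expectation ?P = norming ?c * Q (cembed x1) + 0"
    by (rule LIMSEQ_unique[OF lim1 Lim_transform_eventually[OF lim2 ev]])
  then show "expectation ?P = norming ?c * char_component w l ?c (monomial ks) (cembed x1)" by (simp add: Qh(5))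
qed

text \<open>The exponents are turned into a list containing \<open>a k\<close> copies of
  \<open>root k\<close>; its multiplicities are \<open>\<alpha>\<close>, which identifies monomial,
  eigenvalue and reduced polynomial.\<close>

lemma joint_moments:
  fixes a :: "nat \<Rightarrow> nat"
  defines "\<alpha> \<equiv> (\<lambda>i. \<Sum>k=2..r. a k * (if i = Min (J k) then 1 else 0))"
  shows "integrable M (\<lambda>\<omega>. \<Prod>k=2..r. limit_var k \<omega> ^ a k)"
    and "expectation (\<lambda>\<omega>. \<Prod>k=2..r. limit_var k \<omega> ^ a k)
      = norming (pairing DIM('a) \<alpha> \<Lambda>) * reduced_polynomial w l u \<Lambda> \<alpha> (cembed x1)"
proof -
  define ks where "ks = concat (map (\<lambda>k. replicate (a k) (root k)) [2..<Suc r])"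
  have crit: "critical_root k" if "k \<in> set ks" for k
    using that J_props(1) by (auto simp: ks_def)
  have prod: "(\<Prod>k\<leftarrow>ks. root_limit k \<omega>) = (\<Prod>k=2..r. limit_var k \<omega> ^ a k)" for \<omega>
    unfolding ks_def limit_var_def by (rule prod_list_replicate_blocks)
  have alpha: "\<alpha> i = (\<Sum>k=2..r. if i = root k then a k else 0)" for i
    unfolding \<alpha>_def root_def by (intro sum.cong) auto
  have mon: "monomial ks = (\<lambda>z. \<Prod>i=1..DIM('a). u i z ^ \<alpha> i)"
  proof
    fix z
    have "(\<Prod>i=1..DIM('a). u i z ^ \<alpha> i) = (\<Prod>i=1..DIM('a). \<Prod>k=2..r. u i z ^ (if i = root k then a k else 0))"
      unfolding alpha by (simp add: power_sum)
    also have "\<dots> = (\<Prod>k=2..r. \<Prod>i=1..DIM('a). u i z ^ (if i = root k then a k else 0))" by (rule prod.swap)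
    also have "\<dots> = (\<Prod>k=2..r. u (root k) z ^ a k)"
    proof (rule prod.cong)
      fix k assume k: "k \<in> {2..r}"
      have "(\<Prod>i=1..DIM('a). u i z ^ (if i = root k then a k else 0))
          = (\<Prod>i=1..DIM('a). if i = root k then u i z ^ a k else 1)" by (intro prod.cong) auto
      also have "\<dots> = u (root k) z ^ a k" using root_range[OF k] by (subst prod.delta) auto
      finally show "(\<Prod>i=1..DIM('a). u i z ^ (if i = root k then a k else 0)) = u (root k) z ^ a k" .
    qed simp
    also have "\<dots> = monomial ks z" unfolding monomial_def ks_def by (rule prod_list_replicate_blocks[symmetric])
    finally show "monomial ks z = (\<Prod>i=1..DIM('a). u i z ^ \<alpha> i)" by simp
  qed
  have root: "mono_root ks = pairing DIM('a) \<alpha> \<Lambda>"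
  proof -
    have "pairing DIM('a) \<alpha> \<Lambda> = (\<Sum>i=1..DIM('a). \<Sum>k=2..r. (if i = root k then of_nat (a k) * \<Lambda> i else 0))"
      unfolding pairing_def alpha of_nat_sum sum_distrib_right by (intro sum.cong) auto
    also have "\<dots> = (\<Sum>k=2..r. \<Sum>i=1..DIM('a). (if i = root k then of_nat (a k) * \<Lambda> i else 0))" by (rule sum.swap)
    also have "\<dots> = (\<Sum>k=2..r. of_nat (a k) * \<Lambda> (root k))"
    proof (rule sum.cong)
      fix k assume k: "k \<in> {2..r}"
      show "(\<Sum>i=1..DIM('a). (if i = root k then of_nat (a k) * \<Lambda> i else 0)) = of_nat (a k) * \<Lambda> (root k)"
        using root_range[OF k] by (subst sum.delta) auto
    qed simp
    also have "\<dots> = mono_root ks" unfolding mono_root_def ks_def by (rule sum_list_replicate_blocks[symmetric])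
    finally show ?thesis by simp
  qed
  show "integrable M (\<lambda>\<omega>. \<Prod>k=2..r. limit_var k \<omega> ^ a k)"
  proof -
    have "integrable M (\<lambda>\<omega>. \<Prod>k\<leftarrow>ks. root_limit k \<omega>)" by (rule moment_formula(1)) (rule crit)
    then show ?thesis unfolding prod .
  qed
  show "expectation (\<lambda>\<omega>. \<Prod>k=2..r. limit_var k \<omega> ^ a k)
      = norming (pairing DIM('a) \<alpha> \<Lambda>) * reduced_polynomial w l u \<Lambda> \<alpha> (cembed x1)"
  proof -
    have "expectation (\<lambda>\<omega>. \<Prod>k\<leftarrow>ks. root_limit k \<omega>)
        = norming (mono_root ks) * char_component w l (mono_root ks) (monomial ks) (cembed x1)"
      by (rule moment_formula(2)) (rule crit)
    then show ?thesis unfolding prod root mon reduced_polynomial_def .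
  qed
qed

end

theorem theorem3p6:
  fixes M :: "'b measure" and X :: "nat \<Rightarrow> 'b \<Rightarrow> 'a::euclidean_space"
    and x1 :: 'a and w :: "nat \<Rightarrow> 'a" and l :: "nat \<Rightarrow> 'a \<Rightarrow> real"
    and u :: "nat \<Rightarrow> 'a \<times> 'a \<Rightarrow> complex" and v :: "nat \<Rightarrow> 'a \<times> 'a"
    and \<Lambda> :: "nat \<Rightarrow> complex" and \<epsilon> :: "nat \<Rightarrow> nat"
    and r \<nu> :: nat and J :: "nat \<Rightarrow> nat set"
  assumes process: "polya_process M X x1 w l"
    and large: "large_process w l"
    and jordan: "jordan_basis w l u \<Lambda> \<epsilon>"
    and dual: "dual_basis u v"
    and nonsemisimple: "\<not> principally_semisimple DIM('a) \<Lambda> \<epsilon> (sigma2 w l)"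
    and blocks: "bij_betw J {2..r} {B. principal_block DIM('a) \<Lambda> \<epsilon> (sigma2 w l) B}"
    and size: "\<And>k. k \<in> {2..r} \<Longrightarrow> card (J k) = \<nu> + 1"
  shows "\<exists>W :: nat \<Rightarrow> 'b \<Rightarrow> complex.
    (\<forall>k\<in>{2..r}. W k \<in> borel_measurable M) \<and>
    polya_expansion M X v \<Lambda> (sigma2 w l) \<nu> r J W \<and>
    (\<forall>W'. (\<forall>k\<in>{2..r}. W' k \<in> borel_measurable M) \<and>
          polya_expansion M X v \<Lambda> (sigma2 w l) \<nu> r J W' \<longrightarrow>
          (\<forall>k\<in>{2..r}. AE \<omega> in M. W' k \<omega> = W k \<omega>)) \<and>
    (\<forall>a :: nat \<Rightarrow> nat.
       let \<alpha> = (\<lambda>i. \<Sum>k=2..r. a k * (if i = Min (J k) then 1 else 0)) in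
       integrable M (\<lambda>\<omega>. \<Prod>k=2..r. W k \<omega> ^ a k) \<and>
       (\<integral>\<omega>. (\<Prod>k=2..r. W k \<omega> ^ a k) \<partial>M)
         = Gamma (of_real (tau1 x1 l)) * rGamma (of_real (tau1 x1 l) + pairing DIM('a) \<alpha> \<Lambda>)
           * reduced_polynomial w l u \<Lambda> \<alpha> (cembed x1))"
proof -
  interpret polya_jordan M X x1 w l u v \<Lambda> \<epsilon>
    by unfold_locales (rule process jordan dual)+
  interpret polya_weights M X x1 w l u v \<Lambda> \<epsilon> "sigma2 w l"
  proof unfold_locales
    show "sigma2 w l > 1/2" using large by (simp add: small_process_def)
  qed (rule sigma2_bounds[OF nonsemisimple], assumption?)+
  \<comment> \<open>Nonsemisimplicity provides an actual principal block of size other than 1; being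
    one of the \<open>J k\<close>, it shows that there is at least one block and that
    \<open>\<nu> \<ge> 1\<close>.\<close>
  obtain B where B: "principal_block DIM('a) \<Lambda> \<epsilon> (sigma2 w l) B" "card B \<noteq> 1"
    using nonsemisimple by (auto simp: principally_semisimple_def)
  then have "B \<in> J ` {2..r}" using bij_betw_imp_surj_on[OF blocks] by simp
  then obtain k where "B = J k" "k \<in> {2..r}" by (rule imageE)
  then have "\<nu> \<ge> 1" "2 \<le> r" using size[of k] B(2) by auto
  then interpret polya_principal M X x1 w l u v \<Lambda> \<epsilon> "sigma2 w l" \<nu> r J
    by unfold_locales (assumption | rule blocks size)+
  show ?thesis
  proof (intro exI[of _ limit_var] conjI ballI allI impI)
    show "limit_var k \<in> borel_measurable M" if "k \<in> {2..r}" for k by (rule limit_var_meas[OF that])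
    show "polya_expansion M X v \<Lambda> (sigma2 w l) \<nu> r J limit_var" by (rule limit_expansion)
    show "AE \<omega> in M. W' k \<omega> = limit_var k \<omega>"
      if "(\<forall>k\<in>{2..r}. W' k \<in> borel_measurable M) \<and> polya_expansion M X v \<Lambda> (sigma2 w l) \<nu> r J W'" "k \<in> {2..r}" for W' k
      by (rule expansion_unique[OF conjunct2[OF that(1)] that(2)])
  qed (use joint_moments in \<open>simp add: Let_def norming_def\<close>)
qed

end
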